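(* Let $\alpha\in(0,1)$ and $b\in(0,1]$, and define $$\lambda_{\alpha,b}=\inf\left\{\lambda>0:\ 2\cos\left(\pi\left(\tfrac{\lambda}{3}+\tfrac13\right)\right)=\alpha b^{\lambda}\right\}$$ and, for $x>0$, $v\in\mathbb{R}$, $$\phi_{\alpha,b}(x,v)=x^{\frac{\lambda_{\alpha,b}}3}\left(M\left(-\tfrac{\lambda_{\alpha,b}}{3},\tfrac23,-\tfrac{v^3}{9x}\right)+\frac{\Gamma(\frac23)\Gamma(\frac{1-\lambda_{\alpha,b}}3)}{\Gamma(-\frac{\lambda_{\alpha,b}}3)\Gamma(\frac43)}\frac{v}{(9x)^{\frac13}}M\left(-\tfrac{\lambda_{\alpha,b}-1}{3},\tfrac43,-\tfrac{v^3}{9x}\right)\right),$$ extended continuously to $x=0$. Then: (a) $\lambda_{\alpha,b}\in(0,\frac12)$; in particular $\lambda_{\alpha,1}=\frac{3}{\pi}\arccos(\frac{\alpha}{2})-1$. (b) $\phi_{\alpha,b}>0$ in $([0,\infty)\times\mathbb{R})\setminus\{(0,0)\}$. (c) $\phi_{\alpha,b}(0,v)=c|v|^{\lambda_{\alpha,b}}$ for $v\le0$, for some constant $c$. (d) $\phi_{\alpha,b}$ is a weak solution to $$\begin{cases}v\partial_x\phi_{\alpha,b}-\partial_{vv}\phi_{\alpha,b}=0&\text{in }\{x>0\},\\ \phi_{\alpha,b}(0,v)=\alpha\phi_{\alpha,b}(0,-bv)&\text{on }\{x=0\}\times\{v>0\}.\end{cases}$$ In particular, $\partial_v\phi_{\alpha,b}\in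 L^{4+\delta}(H_R)$ for some small $\delta=\delta(\alpha,b)>0$ and any $R>1$. (e) $\phi_{\alpha,b}(x,v)\eqsim\max\{|x|^{\frac13},|v|\}^{\lambda_{\alpha,b}}$, i.e. the two sides are comparable up to positive multiplicative constants depending only on $\alpha,b$. (f) For any $R>0$, $\phi_{\alpha,b}\in C^{\lambda_{\alpha,b}}(H_R)$, but $\phi_{\alpha,b}\notin C^{\lambda_{\alpha,b}+\varepsilon}(H_R)$ for any $\varepsilon>0$.
   Context: $M(a,b,\zeta)=\sum_{k\ge0}\frac{(a)_k}{(b)_k}\frac{\zeta^k}{k!}$ is Kummer's confluent hypergeometric function and $\Gamma$ the Gamma function. Here $x,v\in\mathbb{R}$ and $H_R=(0,R^3)\times(-R,R)$. Weak solution: for every $R>0$, $h,\partial_vh\in L^2(H_R)$, $|\int_{H_R}h\,v\partial_x\psi|\le C\|\partial_v\psi\|_{L^2(H_R)}$ for $\psi\in C_c^\infty(H_R)$ (so $h$ has a trace at $x=0$), $-\int_{H_R}hv\partial_x\psi\,dx\,dv-\int_{\{x=0\}}h\psi v\,dv+\int_{H_R}\partial_vh\,\partial_v\psi\,dx\,dv=0$ for all $\psi\in C_c^\infty(\mathbb{R}^2)$ whose support meets $\partial H_R$ only in $\{x=0\}$, and the boundary condition holds a.e. for the traces. Kinetic Hölder spaces: functions of $(x,v)$ are regarded as functions of $z=(t,x,v)$ independent of $t$ (on $\mathbb{R}\times H_R$). $\mathrm{dist}_{\rm kin}(z_1,z_2)=\min_{w\in\mathbb{R}}\max\{|t_1-t_2|^{1/2},|x_1-(x_2+(t_1-t_2)w)|^{1/3},|v_1-w|,|v_2-w|\}$;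 $\mathcal{P}_k$ is the span of monomials $t^{i}x^{j}v^{l}$ with $2i+3j+l\le k$; $[f]_{C^{k,a}(D)}=\sup_{z_1\in D}\inf_{p\in\mathcal{P}_k}\sup_{z_2\in D\setminus\{z_1\}}\frac{|(f-p)(z_2)|}{\mathrm{dist}_{\rm kin}(z_1,z_2)^{k+a}}$ for $k\in\mathbb{N}\cup\{0\}$, $a\in[0,1)$; $f\in C^{k,a}(D)$ iff $[f]_{C^{k,a}(D)}+\|f\|_{L^\infty(D)}<\infty$; $C^s=C^{\lfloor s\rfloor,s-\lfloor s\rfloor}$. *)

theory Defs
  imports "HOL-Analysis.Analysis"
begin

text \<open>Points of the phase space are pairs \<open>(x, v)\<close>; points including time are triples
  \<open>(t, x, v)\<close>.\<close>

definition kummer_M :: "real \<Rightarrow> real \<Rightarrow> real \<Rightarrow> real" where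
  "kummer_M a b \<zeta> = (\<Sum>k. pochhammer a k / pochhammer b k * (\<zeta> ^ k / fact k))"

definition lam :: "real \<Rightarrow> real \<Rightarrow> real" where
  "lam \<alpha> b = Inf {l. l > 0 \<and> 2 * cos (pi * (l / 3 + 1 / 3)) = \<alpha> * b powr l}"

definition phi_interior :: "real \<Rightarrow> real \<Rightarrow> real \<times> real \<Rightarrow> real" where
  "phi_interior \<alpha> b = (\<lambda>(x, v). let l = lam \<alpha> b in
     x powr (l / 3) *
       (kummer_M (- l / 3) (2 / 3) (- (v ^ 3) / (9 * x))
        + Gamma (2 / 3) * Gamma ((1 - l) / 3) / (Gamma (- l / 3) * Gamma (4 / 3))
          * (v / (9 * x) powr (1 / 3))
          * kummer_M (- (l - 1) / 3) (4 / 3) (- (v ^ 3) / (9 * x))))"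

text \<open>Continuous extension to \<open>x = 0\<close>; the values for \<open>x < 0\<close> are irrelevant.  Since \<open>Lim\<close> is
  total, continuity on the closed half-plane has to be asserted separately where it is used.\<close>

definition phi :: "real \<Rightarrow> real \<Rightarrow> real \<times> real \<Rightarrow> real" where
  "phi \<alpha> b z = (if fst z > 0 then phi_interior \<alpha> b z
                else Lim (at z within {0<..} \<times> UNIV) (phi_interior \<alpha> b))"

definition H :: "real \<Rightarrow> (real \<times> real) set" where
  "H R = {0<..<R ^ 3} \<times> {-R<..<R}"


section \<open>Test functions and function spaces\<close>

primrec cont_diff :: "nat \<Rightarrow> ('a::euclidean_space \<Rightarrow> real) \<Rightarrow> bool" where
  "cont_diff 0 f \<longleftrightarrow> continuous_on UNIV f"
| "cont_diff (Suc n) f \<longleftrightarrow> (\<forall>z. f differentiable (at z)) \<and>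
     (\<forall>w. cont_diff n (\<lambda>z. frechet_derivative f (at z) w))"

definition supp :: "('a::euclidean_space \<Rightarrow> real) \<Rightarrow> 'a set" where
  "supp f = closure {z. f z \<noteq> 0}"

text \<open>\<open>test_fun D \<psi>\<close> is \<open>\<psi> \<in> C\<^sub>c\<^sup>\<infinity>(D)\<close>, with \<open>\<psi>\<close> extended by zero to the whole space.\<close>

definition test_fun :: "'a::euclidean_space set \<Rightarrow> ('a \<Rightarrow> real) \<Rightarrow> bool" where
  "test_fun D \<psi> \<longleftrightarrow> (\<forall>n. cont_diff n \<psi>) \<and> compact (supp \<psi>) \<and> supp \<psi> \<subseteq> D"

definition dx :: "(real \<times> real \<Rightarrow> real) \<Rightarrow> real \<times> real \<Rightarrow> real" where
  "dx f = (\<lambda>(x, v). deriv (\<lambda>y. f (y, v)) x)"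

definition dv :: "(real \<times> real \<Rightarrow> real) \<Rightarrow> real \<times> real \<Rightarrow> real" where
  "dv f = (\<lambda>(x, v). deriv (\<lambda>w. f (x, w)) v)"

definition in_Lp :: "real \<Rightarrow> 'a::euclidean_space set \<Rightarrow> ('a \<Rightarrow> real) \<Rightarrow> bool" where
  "in_Lp p D f \<longleftrightarrow> set_borel_measurable lborel D f \<and>
     set_integrable lborel D (\<lambda>z. \<bar>f z\<bar> powr p)"

text \<open>\<open>g\<close> is the weak (distributional) derivative of \<open>h\<close> with respect to \<open>v\<close> in the open set \<open>D\<close>.\<close>

definition weak_dv :: "(real \<times> real) set \<Rightarrow> (real \<times> real \<Rightarrow> real) \<Rightarrow> (real \<times> real \<Rightarrow> real) \<Rightarrow> bool" where
  "weak_dv D h g \<longleftrightarrow>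
     (\<forall>K. compact K \<and> K \<subseteq> D \<longrightarrow> set_integrable lborel K h \<and> set_integrable lborel K g) \<and>
     (\<forall>\<psi>. test_fun D \<psi> \<longrightarrow>
        (LINT z:D|lborel. h z * dv \<psi> z) = - (LINT z:D|lborel. g z * \<psi> z))"


section \<open>Weak solutions\<close>

text \<open>
  \<open>\<tau>\<close> is the trace of \<open>h\<close> at \<open>x = 0\<close>.  If \<open>h \<in> L\<^sup>2(H\<^sub>R)\<close> and \<open>v \<partial>\<^sub>x h\<close> is bounded with respect to
  \<open>\<parallel>\<partial>\<^sub>v \<psi>\<parallel>\<close>, then for each \<open>\<eta>\<close> the moment \<open>x \<mapsto> \<integral> h(x,v) \<eta>(v) v dv\<close> has an
  absolutely continuous representative, so it has a limit as \<open>x \<rightarrow> 0+\<close>.  The limit is expressed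
  through averages over \<open>(0, \<epsilon>)\<close>, which makes it independent of the representative.  As the weight
  \<open>v\<close> vanishes only at \<open>0\<close>, \<open>\<tau>\<close> is unique almost everywhere.
\<close>

definition is_trace :: "(real \<times> real \<Rightarrow> real) \<Rightarrow> (real \<Rightarrow> real) \<Rightarrow> bool" where
  "is_trace h \<tau> \<longleftrightarrow>
     (\<forall>r>0. set_integrable lborel {-r..r} (\<lambda>v. \<tau> v * v)) \<and>
     (\<forall>\<eta>. test_fun UNIV \<eta> \<longrightarrow>
        ((\<lambda>\<epsilon>. (LINT z:{0<..<\<epsilon>} \<times> UNIV|lborel. h z * \<eta> (snd z) * snd z) / \<epsilon>)
           \<longlongrightarrow> (LINT v|lborel. \<tau> v * \<eta> v * v)) (at_right 0))"

text \<open>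
  Weak solutions, with trace \<open>\<tau>\<close> at \<open>x = 0\<close>, of \<open>v \<partial>\<^sub>x h - \<partial>\<^sub>v\<^sub>v h = 0\<close> in \<open>{x > 0}\<close> with
  \<open>h(0,v) = \<alpha> h(0,-bv)\<close> for \<open>v > 0\<close>.  In the weak identity, \<open>g\<close> is \<open>\<partial>\<^sub>v h\<close> and the boundary
  term is the integral over the part \<open>{0} \<times> (-R,R)\<close> of the boundary of \<open>H\<^sub>R\<close>.
\<close>

definition weak_solution ::
    "real \<Rightarrow> real \<Rightarrow> (real \<times> real \<Rightarrow> real) \<Rightarrow> (real \<Rightarrow> real) \<Rightarrow> bool" where
  "weak_solution \<alpha> b h \<tau> \<longleftrightarrow>
     is_trace h \<tau> \<and>
     (AE v in lborel. v > 0 \<longrightarrow> \<tau> v = \<alpha> * \<tau> (- b * v)) \<and>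
     (\<forall>R>0.
        in_Lp 2 (H R) h \<and>
        (\<exists>C. \<forall>\<psi>. test_fun (H R) \<psi> \<longrightarrow>
           \<bar>LINT z:H R|lborel. h z * snd z * dx \<psi> z\<bar>
             \<le> C * sqrt (LINT z:H R|lborel. (dv \<psi> z)\<^sup>2)) \<and>
        (\<exists>g. weak_dv (H R) h g \<and> in_Lp 2 (H R) g \<and>
           (\<forall>\<psi>. test_fun UNIV \<psi> \<and> supp \<psi> \<inter> frontier (H R) \<subseteq> {0} \<times> UNIV \<longrightarrow>
              - (LINT z:H R|lborel. h z * snd z * dx \<psi> z)
              - (LINT v:{-R<..<R}|lborel. \<tau> v * \<psi> (0, v) * v)
              + (LINT z:H R|lborel. g z * dv \<psi> z) = 0)))"


section \<open>Kinetic Hoelder spaces\<close>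

definition dist_kin :: "real \<times> real \<times> real \<Rightarrow> real \<times> real \<times> real \<Rightarrow> real" where
  "dist_kin = (\<lambda>(t1, x1, v1) (t2, x2, v2).
     INF w. Max {\<bar>t1 - t2\<bar> powr (1 / 2), \<bar>x1 - (x2 + (t1 - t2) * w)\<bar> powr (1 / 3),
                 \<bar>v1 - w\<bar>, \<bar>v2 - w\<bar>})"

definition kin_poly :: "nat \<Rightarrow> (real \<times> real \<times> real \<Rightarrow> real) set" where
  "kin_poly k = {p. \<exists>c. p = (\<lambda>(t, x, v).
     \<Sum>(i, j, l)\<in>{(i, j, l). 2 * i + 3 * j + l \<le> k}. c i j l * (t ^ i * x ^ j * v ^ l))}"

definition kin_seminorm ::
    "nat \<Rightarrow> real \<Rightarrow> (real \<times> real \<times> real) set \<Rightarrow> (real \<times> real \<times> real \<Rightarrow> real) \<Rightarrow> ennreal" where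
  "kin_seminorm k a D f =
     (SUP z1\<in>D. INF p\<in>kin_poly k. SUP z2\<in>D - {z1}.
        ennreal (\<bar>f z2 - p z2\<bar> / dist_kin z1 z2 powr (real k + a)))"

definition kin_C ::
    "nat \<Rightarrow> real \<Rightarrow> (real \<times> real \<times> real) set \<Rightarrow> (real \<times> real \<times> real \<Rightarrow> real) set" where
  "kin_C k a D = {f. kin_seminorm k a D f < \<infinity> \<and>
                     (\<exists>B. AE z in lborel. z \<in> D \<longrightarrow> \<bar>f z\<bar> \<le> B)}"

text \<open>The space \<open>C\<^sup>s(D)\<close> for functions of \<open>(x, v)\<close>, seen as functions of \<open>(t, x, v)\<close> on
  \<open>\<real> \<times> D\<close> that do not depend on \<open>t\<close>.\<close>

definition kin_holder :: "real \<Rightarrow> (real \<times> real) set \<Rightarrow> (real \<times> real \<Rightarrow> real) set" where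
  "kin_holder s D = {f. (\<lambda>(t, x, v). f (x, v)) \<in> kin_C (nat \<lfloor>s\<rfloor>) (s - \<lfloor>s\<rfloor>) (UNIV \<times> D)}"

end

theory Submission
  imports Defs "HOL-Real_Asymp.Real_Asymp"
begin

text \<open>
  The equation is invariant under \<open>(x, v) \<mapsto> (r\<^sup>3 x, r v)\<close>, and the function in question is homogeneous of degree
  \<open>\<lambda>\<close>: it is \<open>x\<^sup>\<lambda>\<^sup>/\<^sup>3 w (v / x\<^sup>1\<^sup>/\<^sup>3)\<close>, where the profile \<open>w\<close> combines two Kummer functions at \<open>- y\<^sup>3 / 9\<close> and
  solves \<open>w'' + (y\<^sup>2 / 3) w' = q y w\<close> with \<open>q = \<lambda> / 3\<close>.  Every claim reduces to the positivity of
  \<open>w\<close> and the behaviour of \<open>w\<close>, \<open>w'\<close> and \<open>w'' / y\<close> at \<open>\<plusminus>\<infinity>\<close>.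

  As \<open>y \<rightarrow> +\<infinity>\<close>, Kummer functions decay algebraically (\<open>kummer_M_asymptotic\<close>): this follows from Euler's integral
  by dominated convergence if \<open>b - a \<ge> 1\<close>, and from contiguous relations for the other parameters.  As
  \<open>y \<rightarrow> -\<infinity>\<close>, each Kummer function grows exponentially, and the Gamma factors in the combination make this growth
  cancel: for \<open>y < 0\<close>, the profile is \<open>1 / \<Gamma>(1/3)\<close> times the integral of \<open>e\<^sup>-\<^sup>s s\<^sup>-\<^sup>2\<^sup>/\<^sup>3\<^sup>-\<^sup>q (s - y\<^sup>3 / 9)\<^sup>q\<close> over
  \<open>s > 0\<close> (\<open>profile_neg\<close>).  The proof compares initial values at \<open>y = 0\<close>, by uniqueness for the differential
  equation.  The integral shows the size and the sign of the profile at once; for \<open>y > 0\<close> the sign comes from a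
  minimum principle (\<open>profile_pos\<close>).

  By the reflection formula for \<open>\<Gamma>\<close>, the ratio of the limits of \<open>w(y) / \<bar>y\<bar>\<^sup>\<lambda>\<close> at \<open>+\<infinity>\<close> and \<open>-\<infinity>\<close> is
  \<open>2 cos (\<pi> (\<lambda> + 1) / 3)\<close> (\<open>profile_Ap_eq\<close>).  Hence the equation that defines \<open>\<lambda>\<close> is the boundary condition.

  The facts about \<open>w\<close> are collected in the locale \<open>kinetic_profile\<close>.  They give a function that is comparable to
  \<open>\<rho>\<^sup>\<lambda>\<close>, with a derivative in \<open>v\<close> of size \<open>\<rho>\<^sup>\<lambda>\<^sup>-\<^sup>1\<close> and one in \<open>x\<close> of size \<open>\<rho>\<^sup>\<lambda>\<^sup>-\<^sup>3\<close>, where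
  \<open>\<rho> = max (x\<^sup>1\<^sup>/\<^sup>3) \<bar>v\<bar>\<close>.  Hoelder continuity is then the mean value theorem away from the origin
  (\<open>sol_increment\<close>).  The exponent is optimal because a difference operator that annihilates polynomials does
  not annihilate \<open>x\<^sup>\<lambda>\<^sup>/\<^sup>3\<close> (\<open>sol_not_kin_holder\<close>).  The integrability of \<open>\<partial>\<^sub>v f\<close> is decided by the homogeneous dimension
  \<open>4\<close> (\<open>in_Lp_sol_v\<close>), and the weak formulation is the fundamental theorem of calculus for the moment
  \<open>x \<mapsto> \<integral> v f \<psi> dv\<close> (\<open>weak_identity\<close>).
\<close>

section \<open>Kummer's function and its contiguous relations\<close>

lemma kummer_M_powser:
  "kummer_M a b z = (\<Sum>k. pochhammer a k / (pochhammer b k * fact k) * z ^ k)"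
  by (simp add: kummer_M_def field_simps)

lemma summable_kummer:
  fixes a b z :: real
  assumes b: "b > 0"
  shows "summable (\<lambda>k. pochhammer a k / (pochhammer b k * fact k) * z ^ k)"
proof -
  let ?f = "\<lambda>k. pochhammer a k / (pochhammer b k * fact k) * z ^ k"
  have lim: "(\<lambda>k. \<bar>z\<bar> * ((a + real k) / (b + real k)) / (real k + 1)) \<longlonglongrightarrow> 0"
  proof -
    have 1: "(\<lambda>k. 1 + (a - b) / (b + real k)) \<longlonglongrightarrow> 1 + 0"
      by (intro tendsto_intros tendsto_divide_0[OF tendsto_const]
          filterlim_at_top_imp_at_infinity filterlim_tendsto_add_at_top[OF tendsto_const] filterlim_real_sequentially)
    have eq: "1 + (a - b) / (b + real k) = (a + real k) / (b + real k)" for k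
    proof -
      have "b + real k \<noteq> 0" using b by auto
      then show ?thesis by (simp add: field_simps)
    qed
    have "(\<lambda>k. 1 / (real k + 1)) \<longlonglongrightarrow> 0"
      using LIMSEQ_inverse_real_of_nat by (simp add: inverse_eq_divide add.commute)
    from tendsto_mult[OF tendsto_mult[OF tendsto_const[of "\<bar>z\<bar>"] 1[unfolded eq]] this]
    show ?thesis by simp
  qed
  then have "eventually (\<lambda>k. \<bar>\<bar>z\<bar> * ((a + real k) / (b + real k)) / (real k + 1)\<bar> < 1/2) sequentially"
    using tendstoD[OF lim half_gt_zero[OF zero_less_one]] by (simp only: dist_real_def diff_0_right)
  then obtain N where N: "\<And>k. k \<ge> N \<Longrightarrow> \<bar>\<bar>z\<bar> * ((a + real k) / (b + real k)) / (real k + 1)\<bar> < 1/2"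
    by (auto simp: eventually_sequentially)
  show ?thesis
  proof (rule summable_ratio_test[of "1/2" N])
    fix k assume k: "k \<ge> N"
    have "pochhammer b k \<noteq> 0" "b + real k > 0"
      using b pochhammer_pos[of b k] by auto
    then have "?f (Suc k) = (z * ((a + real k) / (b + real k)) / (real k + 1)) * ?f k"
      by (simp add: pochhammer_Suc divide_simps)
    then have "norm (?f (Suc k)) = \<bar>\<bar>z\<bar> * ((a + real k) / (b + real k)) / (real k + 1)\<bar> * norm (?f k)"
      by (simp add: abs_mult)
    also have "\<dots> \<le> 1/2 * norm (?f k)"
      using N[OF k] by (intro mult_right_mono) auto
    finally show "norm (?f (Suc k)) \<le> 1/2 * norm (?f k)" .
  qed simp
qed

lemma kummer_M_sums:
  "b > 0 \<Longrightarrow> (\<lambda>k. pochhammer a k / (pochhammer b k * fact k) * z ^ k) sums kummer_M a b z"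
  unfolding kummer_M_powser by (rule summable_sums[OF summable_kummer])

lemma kummer_M_0 [simp]: "kummer_M a b 0 = 1"
  unfolding kummer_M_powser by (subst suminf_finite[of "{0}"]) auto

lemma DERIV_kummer_M:
  assumes b: "b > 0"
  shows "(kummer_M a b has_field_derivative a / b * kummer_M (a + 1) (b + 1) z) (at z)"
proof -
  let ?c = "\<lambda>a b k. pochhammer a k / (pochhammer b k * fact k)"
  have *: "diffs (?c a b) k = a / b * ?c (a + 1) (b + 1) k" for k
    using b by (simp add: diffs_def pochhammer_rec[of a k] pochhammer_rec[of b k] field_simps
        del: of_nat_Suc)
  have "((\<lambda>x. \<Sum>n. ?c a b n * x^n) has_field_derivative (\<Sum>n. diffs (?c a b) n * z^n)) (at z)"
    by (rule termdiffs_strong_converges_everywhere) (rule summable_kummer[OF b])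
  moreover have "(\<lambda>x. \<Sum>n. ?c a b n * x^n) = kummer_M a b"
    by (simp add: kummer_M_powser fun_eq_iff)
  moreover have "(\<Sum>n. diffs (?c a b) n * z^n) = a / b * kummer_M (a + 1) (b + 1) z"
    unfolding kummer_M_powser * mult.assoc
    by (rule suminf_mult) (use summable_kummer[of "b+1" "a+1" z] b in auto)
  ultimately show ?thesis by simp
qed

lemma kummer_M_times_arg_sums:
  assumes b: "b > 0"
  shows "(\<lambda>k. real k * (pochhammer a k / (pochhammer b k * fact k)) * z ^ k)
           sums (a / b * z * kummer_M (a + 1) (b + 1) z)"
proof -
  have 2: "pochhammer a (Suc k) / (pochhammer b (Suc k) * fact (Suc k)) * real (Suc k)
          = a / b * (pochhammer (a + 1) k / (pochhammer (b + 1) k * fact k))" for k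
  proof -
    have "fact (Suc k) = real (Suc k) * fact k" by simp
    then have "pochhammer a (Suc k) / (pochhammer b (Suc k) * fact (Suc k)) * real (Suc k)
       = pochhammer a (Suc k) / (pochhammer b (Suc k) * fact k)"
      by (simp del: of_nat_Suc fact_Suc)
    then show ?thesis by (simp add: pochhammer_rec)
  qed
  have "(\<lambda>k. real (Suc k) * (pochhammer a (Suc k) / (pochhammer b (Suc k) * fact (Suc k))) * z ^ Suc k)
      = (\<lambda>k. (a / b * z) * (pochhammer (a + 1) k / (pochhammer (b+1) k * fact k) * z ^ k))"
    using 2 by (auto simp: fun_eq_iff mult_ac simp del: of_nat_Suc fact_Suc)
  then have "(\<lambda>k. real (Suc k) * (pochhammer a (Suc k) / (pochhammer b (Suc k) * fact (Suc k))) * z ^ Suc k)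
      sums (a / b * z * kummer_M (a + 1) (b + 1) z)"
    using sums_mult[OF kummer_M_sums[of "b+1" "a+1" z], of "a / b * z"] b by simp
  then show ?thesis
    by (subst (asm) sums_Suc_iff) simp
qed

text \<open>Coefficientwise this is \<open>(a + k) (a)\<^sub>k = a (a + 1)\<^sub>k\<close>.  Since
  \<open>(a / b) M(a + 1, b + 1)\<close> is the derivative of \<open>M(a, b)\<close>, it says that the Euler operator \<open>a + z d/dz\<close>
  maps \<open>M(a, b)\<close> to \<open>a M(a + 1, b)\<close>.  Together with the next two contiguous relations it replaces the
  second-order equation of Kummer in everything below.\<close>

lemma kummer_M_raise_both:
  assumes b: "b > 0"
  shows "a * kummer_M a b z + a / b * z * kummer_M (a + 1) (b + 1) z = a * kummer_M (a + 1) b z"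
proof -
  have "(a + real k) * pochhammer a k = a * pochhammer (a + 1) k" for k
    using pochhammer_Suc[of a k] pochhammer_rec[of a k] by (simp add: mult_ac)
  then have 1: "(a + real k) * pochhammer a k * (z ^ k / (pochhammer b k * fact k))
      = a * pochhammer (a + 1) k * (z ^ k / (pochhammer b k * fact k))" for k by simp
  have "a * (pochhammer a k / (pochhammer b k * fact k) * z ^ k)
      + real k * (pochhammer a k / (pochhammer b k * fact k)) * z ^ k
      = a * (pochhammer (a + 1) k / (pochhammer b k * fact k) * z ^ k)" for k
    using 1[of k] by (simp add: algebra_simps add_divide_distrib)
  with sums_add[OF sums_mult[OF kummer_M_sums[OF b, of a z], of a] kummer_M_times_arg_sums[OF b, of a z]]
       sums_mult[OF kummer_M_sums[OF b, of "a+1" z], of a]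
  show ?thesis by (simp add: sums_unique2)
qed

text \<open>For \<open>a \<noteq> 0\<close> this is the previous relation divided by \<open>a\<close>; for \<open>a = 0\<close> it is an index shift
  in the series \<open>\<Sum>k. z\<^sup>k / (b)\<^sub>k\<close> of \<open>M(1, b)\<close>.\<close>

lemma kummer_M_raise_a:
  assumes b: "b > 0"
  shows "kummer_M a b z = kummer_M (a + 1) b z - z / b * kummer_M (a + 1) (b + 1) z"
proof (cases "a = 0")
  case False
  have "a * kummer_M a b z = a * (kummer_M (a + 1) b z - z / b * kummer_M (a + 1) (b + 1) z)"
    using kummer_M_raise_both[OF b, of a z] by (simp add: algebra_simps)
  with False show ?thesis by simp
next
  case True
  have "(\<lambda>k. pochhammer (1::real) k / (pochhammer b k * fact k) * z ^ k) sums kummer_M 1 b z"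
    by (rule kummer_M_sums[OF b])
  then have "(\<lambda>k. z ^ k / pochhammer b k) sums kummer_M 1 b z"
    by (simp add: pochhammer_fact[symmetric])
  then have 1: "(\<lambda>k. z ^ Suc k / pochhammer b (Suc k)) sums (kummer_M 1 b z - 1)"
    by (subst sums_Suc_iff) simp
  have "(\<lambda>k. pochhammer (1::real) k / (pochhammer (b+1) k * fact k) * z ^ k) sums kummer_M 1 (b+1) z"
    using b by (intro kummer_M_sums) auto
  then have "(\<lambda>k. z ^ k / pochhammer (b+1) k) sums kummer_M 1 (b+1) z"
    by (simp add: pochhammer_fact[symmetric])
  from sums_mult[OF this, of "z / b"]
  have "(\<lambda>k. z ^ Suc k / pochhammer b (Suc k)) sums (z / b * kummer_M 1 (b + 1) z)"
    by (simp add: pochhammer_rec)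
  with 1 have "kummer_M 1 b z - 1 = z / b * kummer_M 1 (b + 1) z" by (rule sums_unique2)
  moreover have "kummer_M 0 b z = 1"
    unfolding kummer_M_powser by (subst suminf_finite[of "{0}"]) (auto simp: pochhammer_0_left)
  ultimately show ?thesis using True by simp
qed

lemma kummer_M_raise_b:
  assumes b: "b > 0"
  shows "kummer_M a b z = kummer_M a (b + 1) z + a / (b * (b + 1)) * z * kummer_M (a + 1) (b + 2) z"
proof -
  have b1: "b + 1 > 0" using b by simp
  have nz: "pochhammer (b + 1) k \<noteq> 0" "pochhammer b k \<noteq> 0" "b + real k \<noteq> 0" for k
    using b pochhammer_pos[of b k] pochhammer_pos[of "b+1" k] by auto
  have "b * pochhammer (b + 1) k = (b + real k) * pochhammer b k" for k
    using pochhammer_Suc[of b k] pochhammer_rec[of b k] by (simp add: mult_ac)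
  then have 1: "(1 + real k / b) / pochhammer (b + 1) k = 1 / pochhammer b k" for k
    using nz[of k] b by (simp add: divide_simps)
  have "pochhammer a k / (pochhammer (b+1) k * fact k) * z ^ k
      + 1 / b * (real k * (pochhammer a k / (pochhammer (b+1) k * fact k)) * z ^ k)
      = ((1 + real k / b) / pochhammer (b + 1) k) * (pochhammer a k / fact k * z ^ k)" for k
    using nz[of k] b by (simp add: divide_simps) (simp add: algebra_simps)
  then have 2: "pochhammer a k / (pochhammer (b+1) k * fact k) * z ^ k
      + 1 / b * (real k * (pochhammer a k / (pochhammer (b+1) k * fact k)) * z ^ k)
      = pochhammer a k / (pochhammer b k * fact k) * z ^ k" for k
    unfolding 1 by simp
  from sums_add[OF kummer_M_sums[OF b1, of a z] sums_mult[OF kummer_M_times_arg_sums[OF b1, of a z], of "1/b"]]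
  have "(\<lambda>k. pochhammer a k / (pochhammer b k * fact k) * z ^ k) sums
     (kummer_M a (b + 1) z + 1 / b * (a / (b + 1) * z * kummer_M (a + 1) (b + 1 + 1) z))"
    unfolding 2 .
  from sums_unique2[OF kummer_M_sums[OF b] this] show ?thesis by (simp add: add.assoc)
qed

section \<open>Decay of Kummer's function on the negative axis\<close>

text \<open>Transfers explicit gauge integrals, such as those of the Beta and Gamma functions, to the Lebesgue integral.\<close>

lemma nonneg_has_integral_lborel:
  fixes f :: "'a::euclidean_space \<Rightarrow> real"
  assumes I: "(f has_integral I) S" and nn: "\<And>x. x \<in> S \<Longrightarrow> f x \<ge> 0"
    and meas: "set_borel_measurable lborel S f"
  shows "set_integrable lborel S f" "(LINT x:S|lborel. f x) = I"
proof -
  have "f absolutely_integrable_on S"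
    using I nn by (intro nonnegative_absolutely_integrable_1) (auto simp: integrable_on_def)
  then have int: "set_integrable lebesgue S f" .
  show 1: "set_integrable lborel S f"
    using int meas unfolding set_integrable_def set_borel_measurable_def
    by (subst (asm) integrable_completion) auto
  have "(LINT x:S|lborel. f x) = (LINT x:S|lebesgue. f x)"
    using meas unfolding set_lebesgue_integral_def set_borel_measurable_def
    by (subst integral_completion) auto
  also have "\<dots> = I"
    using set_lebesgue_integral_eq_integral(2)[OF int] I by (simp add: integral_unique)
  finally show "(LINT x:S|lborel. f x) = I" .
qed

text \<open>Euler's integral.  The exponential series may be integrated term by term against the Beta density,
  because the sum of the absolute moments is again a Kummer series, at \<open>\<bar>z\<bar>\<close>.\<close>

lemma kummer_M_Beta_integral:
  assumes a: "a > 0" and c: "c > 0"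
  shows "set_integrable lborel {0..1} (\<lambda>t. exp (z * t) * (t powr (a - 1) * (1 - t) powr (c - 1)))"
    and "(LINT t:{0..1}|lborel. exp (z * t) * (t powr (a - 1) * (1 - t) powr (c - 1)))
           = Beta a c * kummer_M a (a + c) z"
proof -
  define w :: "real \<Rightarrow> real" where "w = (\<lambda>t. indicator {0..1} t * (t powr (a - 1) * (1 - t) powr (c - 1)))"
  have w0: "w t \<ge> 0" for t by (simp add: w_def indicator_def)
  have w1: "w t \<noteq> 0 \<Longrightarrow> 0 \<le> t \<and> t \<le> 1" for t by (auto simp: w_def indicator_def)
  have [measurable]: "w \<in> borel_measurable borel" unfolding w_def by measurable
  have pw: "integrable lborel (\<lambda>t. t ^ k * w t)" "(LINT t|lborel. t ^ k * w t) = Beta (a + real k) c" for k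
  proof -
    have eq: "indicator {0..1} t *\<^sub>R (t powr (a + real k - 1) * (1 - t) powr (c - 1)) = t ^ k * w t" for t :: real
    proof (cases "t > 0")
      case True
      then have "t powr (a + real k - 1) = t ^ k * t powr (a - 1)"
        by (simp add: powr_add[symmetric] powr_realpow[symmetric] algebra_simps)
      then show ?thesis by (simp add: w_def)
    next
      case False
      then show ?thesis by (cases "t = 0") (auto simp: w_def indicator_def)
    qed
    have I: "((\<lambda>t. t powr (a + real k - 1) * (1 - t) powr (c - 1)) has_integral Beta (a + real k) c) {0..1}"
      using a c by (intro has_integral_Beta_real) auto
    have m: "set_borel_measurable lborel {0..1} (\<lambda>t::real. t powr (a + real k - 1) * (1 - t) powr (c - 1))"
      unfolding set_borel_measurable_def by measurable
    note J = nonneg_has_integral_lborel[OF I _ m]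
    show "integrable lborel (\<lambda>t. t ^ k * w t)" "(LINT t|lborel. t ^ k * w t) = Beta (a + real k) c"
      using J unfolding set_integrable_def set_lebesgue_integral_def eq by auto
  qed
  have ab: "a + c > 0" using a c by simp
  have Bk: "Beta (a + real k) c = Beta a c * (pochhammer a k / pochhammer (a + c) k)" for k
  proof -
    have 1: "a \<notin> \<int>\<^sub>\<le>\<^sub>0" "a + c \<notin> \<int>\<^sub>\<le>\<^sub>0" using a ab by (auto elim!: nonpos_Ints_cases)
    have g: "Gamma a > 0" "Gamma (a + c) > 0" "Gamma c > 0" using a ab c by (auto intro: Gamma_real_pos)
    have 2: "Gamma (a + real k) = pochhammer a k * Gamma a"
            "Gamma (a + c + real k) = pochhammer (a + c) k * Gamma (a + c)"
      using pochhammer_Gamma[OF 1(1), of k] pochhammer_Gamma[OF 1(2), of k] g by auto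
    have "a + real k + c = a + c + real k" by simp
    then show ?thesis unfolding Beta_def using 2 by (simp add: field_simps)
  qed
  define F where "F = (\<lambda>k t. (z ^ k / fact k) * (t ^ k * w t))"
  have Fi: "integrable lborel (F k)" for k unfolding F_def using pw(1) by simp
  have nF: "norm (F k t) = (\<bar>z\<bar> ^ k / fact k) * (t ^ k * w t)" for k t
    using w0[of t] w1[of t] by (cases "w t = 0") (auto simp: F_def abs_mult power_abs)
  have s1: "AE t in lborel. summable (\<lambda>k. norm (F k t))"
  proof (rule AE_I2)
    fix t
    have "summable (\<lambda>k. (\<bar>z\<bar> * t) ^ k /\<^sub>R fact k)" by (rule summable_exp_generic)
    then have "summable (\<lambda>k. w t * ((\<bar>z\<bar> * t) ^ k /\<^sub>R fact k))" by (rule summable_mult)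
    then show "summable (\<lambda>k. norm (F k t))"
      unfolding nF by (simp add: field_simps power_mult_distrib)
  qed
  have s2: "summable (\<lambda>k. LINT t|lborel. norm (F k t))"
  proof -
    have "(LINT t|lborel. norm (F k t)) = Beta a c * (pochhammer a k / (pochhammer (a + c) k * fact k) * \<bar>z\<bar> ^ k)" for k
      unfolding nF using pw(2)[of k] Bk[of k] by simp
    then show ?thesis using summable_mult[OF summable_kummer[OF ab, of a "\<bar>z\<bar>"], of "Beta a c"] by simp
  qed
  have sF: "(\<Sum>k. F k t) = exp (z * t) * w t" for t
  proof -
    have "(\<lambda>k. (z * t) ^ k /\<^sub>R fact k) sums exp (z * t)" by (rule exp_converges)
    from sums_mult2[OF this, of "w t"]
    have "(\<lambda>k. F k t) sums (exp (z * t) * w t)"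
      by (simp add: F_def field_simps power_mult_distrib)
    then show ?thesis by (rule sums_unique[symmetric])
  qed
  have "integrable lborel (\<lambda>t. \<Sum>k. F k t)" by (rule integrable_suminf[OF Fi s1 s2])
  then show "set_integrable lborel {0..1} (\<lambda>t. exp (z * t) * (t powr (a - 1) * (1 - t) powr (c - 1)))"
    unfolding sF set_integrable_def w_def by (simp add: mult_ac)
  have "(LINT t|lborel. (\<Sum>k. F k t)) = (\<Sum>k. LINT t|lborel. F k t)" by (rule integral_suminf[OF Fi s1 s2])
  also have "\<dots> = (\<Sum>k. Beta a c * (pochhammer a k / (pochhammer (a + c) k * fact k) * z ^ k))"
  proof (rule arg_cong[of _ _ suminf], rule ext)
    fix k
    show "(LINT t|lborel. F k t) = Beta a c * (pochhammer a k / (pochhammer (a + c) k * fact k) * z ^ k)"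
      unfolding F_def integral_mult_right_zero pw(2) Bk by (simp add: mult_ac)
  qed
  also have "\<dots> = Beta a c * kummer_M a (a + c) z"
    unfolding kummer_M_powser using summable_kummer[OF ab, of a z] by (rule suminf_mult)
  finally show "(LINT t:{0..1}|lborel. exp (z * t) * (t powr (a - 1) * (1 - t) powr (c - 1)))
           = Beta a c * kummer_M a (a + c) z"
    unfolding sF set_lebesgue_integral_def w_def by (simp add: mult_ac)
qed

lemma Gamma_kernel:
  fixes a :: real
  assumes "a > 0"
  shows "set_integrable lborel {0<..} (\<lambda>t. exp (- t) * t powr (a - 1))"
    and "(LINT t:{0<..}|lborel. exp (- t) * t powr (a - 1)) = Gamma a"
proof -
  have "((\<lambda>t. t powr (a - 1) / exp t) has_integral Gamma a) {0..}"
    using Gamma_integral_real[OF assms] .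
  then have I: "((\<lambda>t. exp (- t) * t powr (a - 1)) has_integral Gamma a) {0<..}"
  proof (rule has_integral_spike_set_eq[THEN iffD1, rotated 2, OF has_integral_eq[rotated]])
    show "\<And>x. x \<in> {0..} \<Longrightarrow> x powr (a - 1) / exp x = exp (- x) * x powr (a - 1)"
      by (simp add: exp_minus field_simps)
  qed (auto intro: negligible_subset[of "{0}"])
  have m: "set_borel_measurable lborel {0<..} (\<lambda>t::real. exp (- t) * t powr (a - 1))"
    unfolding set_borel_measurable_def by measurable
  show "set_integrable lborel {0<..} (\<lambda>t. exp (- t) * t powr (a - 1))"
    and "(LINT t:{0<..}|lborel. exp (- t) * t powr (a - 1)) = Gamma a"
    using nonneg_has_integral_lborel[OF I _ m] by auto
qed

text \<open>Substituting \<open>u = r t\<close> in Euler's integral turns \<open>r\<^sup>a M(a, a + c, -r)\<close>, up to the Beta factor, into the integral of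
  \<open>e\<^sup>-\<^sup>u u\<^sup>a\<^sup>-\<^sup>1 (1 - u / r)\<^sup>c\<^sup>-\<^sup>1\<close> over \<open>(0, r)\<close>.  For \<open>c \<ge> 1\<close> the last factor is at most \<open>1\<close>, so the
  Gamma density dominates.\<close>

lemma kummer_M_asymptotic_base:
  assumes a: "a > 0" and c: "c \<ge> 1"
  shows "((\<lambda>r. r powr a * kummer_M a (a + c) (- r)) \<longlongrightarrow> Gamma (a + c) / Gamma c) at_top"
proof -
  have c0: "c > 0" using c by simp
  define g where "g = (\<lambda>(r::real) (u::real). indicator {0..r} u * (exp (- u) * u powr (a - 1) * (1 - u / r) powr (c - 1)))"
  have g: "(LINT u|lborel. g r u) = r powr a * (Beta a c * kummer_M a (a + c) (- r))" if r: "r > 0" for r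
  proof -
    have "Beta a c * kummer_M a (a + c) (- r)
      = (LINT t|lborel. indicator {0..1} t * (exp (- r * t) * (t powr (a - 1) * (1 - t) powr (c - 1))))"
      using kummer_M_Beta_integral(2)[OF a c0, of "- r"] by (simp add: set_lebesgue_integral_def)
    also have "\<dots> = (LINT t|lborel. r powr (1 - a) * g r (0 + r * t))"
    proof (rule Bochner_Integration.integral_cong[OF refl])
      fix t :: real
      show "indicator {0..1} t * (exp (- r * t) * (t powr (a - 1) * (1 - t) powr (c - 1)))
         = r powr (1 - a) * g r (0 + r * t)"
      proof (cases "0 \<le> t \<and> t \<le> 1")
        case True
        then have 1: "(r * t) powr (a - 1) = r powr (a - 1) * t powr (a - 1)"
          using r by (simp add: powr_mult)
        have 2: "r powr (1 - a) * r powr (a - 1) = 1" using r by (simp add: powr_add[symmetric])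
        have "r powr (1 - a) * g r (0 + r * t) = (r powr (1 - a) * r powr (a - 1)) * (exp (- r * t) * (t powr (a - 1) * (1 - t) powr (c - 1)))"
          using True r by (simp add: g_def 1)
        then show ?thesis using True 2 by simp
      next
        case False
        then have "r * t \<notin> {0..r}" using r by (auto simp: zero_le_mult_iff)
        with False show ?thesis by (auto simp: g_def)
      qed
    qed
    also have "\<dots> = r powr (1 - a) * (LINT t|lborel. g r (0 + r * t))" by simp
    also have "(LINT t|lborel. g r (0 + r * t)) = (LINT u|lborel. g r u) / r"
      using r lborel_integral_real_affine[of r "g r" 0] by (simp add: field_simps)
    finally have "r powr a * (Beta a c * kummer_M a (a + c) (- r)) = r powr a * r powr (1 - a) / r * (LINT u|lborel. g r u)"
      by simp
    moreover have "r powr a * r powr (1 - a) = r" using r by (simp add: powr_add[symmetric])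
    ultimately show ?thesis using r by simp
  qed
  have lim: "((\<lambda>r. LINT u|lborel. g r u) \<longlongrightarrow> (LINT u|lborel. indicator {0<..} u * (exp (- u) * u powr (a - 1)))) at_top"
  proof (rule integral_dominated_convergence_at_top[where w="\<lambda>u. indicator {0<..} u * (exp (- u) * u powr (a - 1))"])
    show "integrable lborel (\<lambda>u. indicator {0<..} u * (exp (- u) * u powr (a - 1)) :: real)"
      using Gamma_kernel(1)[OF a] by (simp add: set_integrable_def)
    show "\<forall>\<^sub>F r in at_top. AE u in lborel. norm (g r u) \<le> indicator {0<..} u * (exp (- u) * u powr (a - 1))"
      using eventually_gt_at_top[of 0]
    proof eventually_elim
      case (elim r)
      show ?case
      proof (rule AE_I2)
        fix u :: real
        show "norm (g r u) \<le> indicator {0<..} u * (exp (- u) * u powr (a - 1))"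
        proof (cases "0 < u \<and> u \<le> r")
          case True
          then have "(1 - u / r) powr (c - 1) \<le> 1" using elim c by (intro powr_le1) auto
          then have "exp (- u) * u powr (a - 1) * (1 - u / r) powr (c - 1) \<le> exp (- u) * u powr (a - 1) * 1"
            by (intro mult_left_mono) auto
          then show ?thesis using True by (auto simp: g_def abs_mult)
        next
          case False
          then show ?thesis by (auto simp: g_def indicator_def)
        qed
      qed
    qed
    show "AE u in lborel. ((\<lambda>r. g r u) \<longlongrightarrow> indicator {0<..} u * (exp (- u) * u powr (a - 1))) at_top"
    proof (rule AE_I2)
      fix u :: real
      show "((\<lambda>r. g r u) \<longlongrightarrow> indicator {0<..} u * (exp (- u) * u powr (a - 1))) at_top"
      proof (cases "u > 0")
        case True
        have "((\<lambda>r. 1 - u / r) \<longlongrightarrow> 1 - 0) at_top"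
          by (intro tendsto_intros tendsto_divide_0[OF tendsto_const] filterlim_at_top_imp_at_infinity filterlim_ident)
        then have "((\<lambda>r. exp (- u) * u powr (a - 1) * (1 - u / r) powr (c - 1)) \<longlongrightarrow> exp (- u) * u powr (a - 1) * 1 powr (c - 1)) at_top"
          by (intro tendsto_intros) auto
        moreover have "\<forall>\<^sub>F r in at_top. g r u = exp (- u) * u powr (a - 1) * (1 - u / r) powr (c - 1)"
          using eventually_ge_at_top[of u] by eventually_elim (use True in \<open>auto simp: g_def\<close>)
        ultimately show ?thesis using True by (auto dest: tendsto_cong)
      next
        case False
        then show ?thesis by (cases "u = 0") (auto simp: g_def)
      qed
    qed
  qed (auto simp: g_def)
  have L: "(LINT u|lborel. indicator {0<..} u * (exp (- u) * u powr (a - 1))) = Gamma a"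
    using Gamma_kernel(2)[OF a] by (simp add: set_lebesgue_integral_def)
  have B: "Beta a c > 0" using a c0 by (auto simp: Beta_def intro!: divide_pos_pos mult_pos_pos Gamma_real_pos)
  have "((\<lambda>r. (LINT u|lborel. g r u) / Beta a c) \<longlongrightarrow> Gamma a / Beta a c) at_top"
    using tendsto_divide[OF lim[unfolded L] tendsto_const, of "Beta a c"] B by simp
  moreover have "\<forall>\<^sub>F r in at_top. (LINT u|lborel. g r u) / Beta a c = r powr a * kummer_M a (a + c) (- r)"
    using eventually_gt_at_top[of 0] by eventually_elim (use B in \<open>simp add: g\<close>)
  moreover have "Gamma a / Beta a c = Gamma (a + c) / Gamma c"
    using Gamma_real_pos[OF a] Gamma_real_pos[OF c0] by (simp add: Beta_def)
  ultimately show ?thesis by (auto dest: Lim_transform_eventually)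
qed

text \<open>Raising \<open>b\<close> raises \<open>b - a\<close> by one in both terms of the contiguous relation, so the case \<open>b - a \<ge> 1\<close>
  propagates downwards.  The reciprocal Gamma function absorbs the cases where \<open>b - a\<close> is zero or negative.\<close>

lemma kummer_M_asymptotic_pos:
  assumes "a > 0" "b > 0" "b - a \<ge> 1 - real n"
  shows "((\<lambda>r. r powr a * kummer_M a b (- r)) \<longlongrightarrow> Gamma b * rGamma (b - a)) at_top"
  using assms
proof (induction n arbitrary: a b)
  case 0
  then show ?case using kummer_M_asymptotic_base[of a "b - a"] by (simp add: Gamma_def divide_inverse)
next
  case (Suc n)
  have 1: "((\<lambda>r. r powr a * kummer_M a (b+1) (- r)) \<longlongrightarrow> Gamma (b+1) * rGamma (b + 1 - a)) at_top"
    by (rule Suc.IH) (use Suc.prems in auto)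
  have 2: "((\<lambda>r. r powr (a+1) * kummer_M (a+1) (b+2) (- r)) \<longlongrightarrow> Gamma (b+2) * rGamma (b+2 - (a+1))) at_top"
    by (rule Suc.IH) (use Suc.prems in auto)
  have 3: "((\<lambda>r. r powr a * kummer_M a (b+1) (- r) - a / (b * (b + 1)) * (r powr (a+1) * kummer_M (a+1) (b+2) (- r)))
      \<longlongrightarrow> Gamma (b+1) * rGamma (b + 1 - a) - a / (b * (b + 1)) * (Gamma (b+2) * rGamma (b+2 - (a+1)))) at_top"
    by (intro tendsto_intros 1 2)
  have G: "Gamma (b + 1) = b * Gamma b" "Gamma (b + 2) = (b + 1) * Gamma (b + 1)"
    using Gamma_plus1[of b] Gamma_plus1[of "b+1"] Suc.prems(2) by (auto simp: nonpos_Ints_def add.assoc)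
  have g: "b + 2 - (a + 1) = b - a + 1" "b + 1 - a = b - a + 1" by simp_all
  have "b * G * g - a / (b * (b + 1)) * ((b + 1) * (b * G) * g) = G * ((b - a) * g)" for G g :: real
    using Suc.prems(2) by (simp add: divide_simps) (simp add: algebra_simps)
  then have "Gamma (b+1) * rGamma (b + 1 - a) - a / (b * (b + 1)) * (Gamma (b+2) * rGamma (b+2 - (a+1)))
      = Gamma b * rGamma (b - a)"
    unfolding G g rGamma_plus1[of "b - a", symmetric] .
  moreover have "\<forall>\<^sub>F r in at_top. r powr a * kummer_M a (b+1) (- r) - a / (b * (b + 1)) * (r powr (a+1) * kummer_M (a+1) (b+2) (- r))
     = r powr a * kummer_M a b (- r)"
    using eventually_gt_at_top[of 0]
  proof eventually_elim
    case (elim r)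
    then show ?case
      unfolding kummer_M_raise_b[OF Suc.prems(2), of a "-r"] by (simp add: powr_add algebra_simps)
  qed
  ultimately show ?case using Lim_transform_eventually[OF 3] by simp
qed

text \<open>Raising \<open>a\<close> reaches the parameters \<open>-1 < a \<le> 0\<close>: one of the two terms of the contiguous relation
  becomes negligible.  The profile needs \<open>a = -\<lambda> / 3\<close>, where the function grows.\<close>

lemma kummer_M_asymptotic:
  assumes "a > -1" "b > 0"
  shows "((\<lambda>r. r powr a * kummer_M a b (- r)) \<longlongrightarrow> Gamma b * rGamma (b - a)) at_top"
proof -
  obtain n where n: "1 - (b - (a + 1)) \<le> real n" using real_arch_simple by blast
  have 1: "((\<lambda>r. r powr (a+1) * kummer_M (a+1) b (- r)) \<longlongrightarrow> Gamma b * rGamma (b - (a+1))) at_top"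
    by (rule kummer_M_asymptotic_pos[of _ _ n]) (use assms n in auto)
  have 2: "((\<lambda>r. r powr (a+1) * kummer_M (a+1) (b+1) (- r)) \<longlongrightarrow> Gamma (b+1) * rGamma (b+1 - (a+1))) at_top"
    by (rule kummer_M_asymptotic_pos[of _ _ n]) (use assms n in auto)
  have "((\<lambda>r::real. inverse r) \<longlongrightarrow> 0) at_top"
    by (rule tendsto_inverse_0_at_top[OF filterlim_ident])
  then have 3: "((\<lambda>r. inverse r * (r powr (a+1) * kummer_M (a+1) b (- r)) + 1 / b * (r powr (a+1) * kummer_M (a+1) (b+1) (- r)))
      \<longlongrightarrow> 0 * (Gamma b * rGamma (b - (a+1))) + 1 / b * (Gamma (b+1) * rGamma (b+1 - (a+1)))) at_top"
    by (intro tendsto_intros 1 2)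
  have "Gamma (b + 1) = b * Gamma b" 
    using Gamma_plus1[of b] assms(2) by (auto simp: nonpos_Ints_def)
  then have "0 * (Gamma b * rGamma (b - (a+1))) + 1 / b * (Gamma (b+1) * rGamma (b+1 - (a+1))) = Gamma b * rGamma (b - a)"
    using assms(2) by simp
  moreover have "\<forall>\<^sub>F r in at_top. inverse r * (r powr (a+1) * kummer_M (a+1) b (- r)) + 1 / b * (r powr (a+1) * kummer_M (a+1) (b+1) (- r))
     = r powr a * kummer_M a b (- r)"
    using eventually_gt_at_top[of 0]
  proof eventually_elim
    case (elim r)
    then show ?case
      using assms(2) unfolding kummer_M_raise_a[OF assms(2), of a "-r"] by (simp add: powr_add field_simps)
  qed
  ultimately show ?thesis using Lim_transform_eventually[OF 3] by simp
qed

section \<open>Tricomi's integral\<close>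

text \<open>Dominated convergence for difference quotients, which the mean value theorem bounds by \<open>g\<close>.\<close>

lemma DERIV_under_integral:
  fixes f :: "real \<Rightarrow> 'a \<Rightarrow> real"
  assumes d: "d > 0"
    and int: "\<And>y. \<bar>y - z\<bar> < d \<Longrightarrow> integrable M (f y)"
    and der: "\<And>y s. \<bar>y - z\<bar> < d \<Longrightarrow> s \<in> space M \<Longrightarrow> ((\<lambda>y. f y s) has_field_derivative f' y s) (at y)"
    and bnd: "\<And>y s. \<bar>y - z\<bar> < d \<Longrightarrow> s \<in> space M \<Longrightarrow> \<bar>f' y s\<bar> \<le> g s"
    and g: "integrable M g" and meas: "f' z \<in> borel_measurable M"
  shows "((\<lambda>y. LINT s|M. f y s) has_field_derivative (LINT s|M. f' z s)) (at z)"
  unfolding DERIV_def tendsto_at_iff_sequentially comp_def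
proof (intro allI impI)
  fix X :: "nat \<Rightarrow> real"
  assume X: "\<forall>i. X i \<in> UNIV - {0}" and X0: "X \<longlonglongrightarrow> 0"
  from X0 d obtain N where N: "\<And>n. n \<ge> N \<Longrightarrow> \<bar>X n\<bar> < d"
    by (auto simp: lim_sequentially dist_real_def)
  define Y where "Y n = X (n + N)" for n
  have Y: "Y n \<noteq> 0" "\<bar>Y n\<bar> < d" for n using X N by (auto simp: Y_def)
  have Y0: "Y \<longlonglongrightarrow> 0" unfolding Y_def using X0 by (rule LIMSEQ_ignore_initial_segment)
  have "(\<lambda>n. LINT s|M. (f (z + Y n) s - f z s) / Y n) \<longlonglongrightarrow> (LINT s|M. f' z s)"
  proof (rule integral_dominated_convergence[where w=g])
    show "f' z \<in> borel_measurable M" by (rule meas)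
    show "(\<lambda>s. (f (z + Y n) s - f z s) / Y n) \<in> borel_measurable M" for n
    proof -
      have "f (z + Y n) \<in> borel_measurable M" "f z \<in> borel_measurable M"
        by (rule borel_measurable_integrable[OF int], use Y(2)[of n] d in simp)+
      then show ?thesis by simp
    qed
    show "integrable M g" by (rule g)
    show "AE s in M. (\<lambda>n. (f (z + Y n) s - f z s) / Y n) \<longlonglongrightarrow> f' z s"
    proof (rule AE_I2)
      fix s assume "s \<in> space M"
      then have "((\<lambda>y. f y s) has_field_derivative f' z s) (at z)" using der[of z s] d by simp
      then have "((\<lambda>h. (f (z + h) s - f z s) / h) \<longlongrightarrow> f' z s) (at 0)" by (simp add: DERIV_def)
      then show "(\<lambda>n. (f (z + Y n) s - f z s) / Y n) \<longlonglongrightarrow> f' z s"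
        unfolding tendsto_at_iff_sequentially comp_def using Y0 Y(1) by blast
    qed
    show "AE s in M. norm ((f (z + Y n) s - f z s) / Y n) \<le> g s" for n
    proof (rule AE_I2)
      fix s assume s: "s \<in> space M"
      have ineq: "\<bar>f (z + h) s - f z s\<bar> \<le> g s * \<bar>h\<bar>" if h: "\<bar>h\<bar> < d" for h
      proof -
        have "norm (f (z + h) s - f z s) \<le> g s * norm (z + h - z)"
        proof (rule field_differentiable_bound[of "{z - d<..<z + d}" _ "\<lambda>y. f' y s"])
          fix y assume "y \<in> {z - d<..<z + d}"
          then have y: "\<bar>y - z\<bar> < d" by (simp add: abs_less_iff)
          show "((\<lambda>y. f y s) has_field_derivative f' y s) (at y within {z - d<..<z + d})"
            by (rule has_field_derivative_at_within[OF der[OF y s]])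
          show "norm (f' y s) \<le> g s" using bnd[OF y s] by simp
        next
          show "z \<in> {z - d<..<z + d}" "z + h \<in> {z - d<..<z + d}" using d h by (auto simp: abs_less_iff)
        qed simp
        then show ?thesis by simp
      qed
      then show "norm ((f (z + Y n) s - f z s) / Y n) \<le> g s"
        using ineq[OF Y(2)[of n]] Y(1)[of n] by (simp add: field_simps)
    qed
  qed
  moreover have "(LINT s|M. (f (z + Y n) s - f z s) / Y n) = ((LINT s|M. f (z + Y n) s) - (LINT s|M. f z s)) / Y n" for n
  proof -
    have "integrable M (f (z + Y n))" "integrable M (f z)"
      by (rule int, use Y(2)[of n] d in simp)+
    then show ?thesis by simp
  qed
  ultimately have "(\<lambda>n. ((LINT s|M. f (z + X (n + N)) s) - (LINT s|M. f z s)) / X (n + N)) \<longlonglongrightarrow> (LINT s|M. f' z s)"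
    by (simp only: Y_def)
  then show "(\<lambda>n. ((LINT s|M. f (z + X n) s) - (LINT s|M. f z s)) / X n) \<longlonglongrightarrow> (LINT s|M. f' z s)"
    by (rule LIMSEQ_offset)
qed

text \<open>Up to the factor \<open>\<Gamma>(p + 1) z\<^sup>p\<^sup>+\<^sup>q\<^sup>+\<^sup>1\<close> this is Tricomi's function \<open>U(p + 1, p + q + 2, z)\<close>.  The power of
  \<open>z\<close> is built in, so that the limit at \<open>z = 0\<close> and the growth in \<open>z\<close> can be read off from the integrand.\<close>

definition tricomi :: "real \<Rightarrow> real \<Rightarrow> real \<Rightarrow> real" where
  "tricomi p q z = (LINT s|lborel. indicator {0<..} s * (exp (- s) * s powr p * (s + z) powr q))"

lemma Gamma_weight:
  fixes p :: real
  assumes "p > -1"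
  shows "integrable lborel (\<lambda>s. indicator {0<..} s * (exp (- s) * s powr p))"
    and "(LINT s|lborel. indicator {0<..} s * (exp (- s) * s powr p)) = Gamma (p + 1)"
  using Gamma_kernel[of "p + 1"] assms by (auto simp: set_integrable_def set_lebesgue_integral_def)

text \<open>For a fraction \<open>t \<in> [0, 1]\<close> one has \<open>t \<le> t\<^sup>q\<close>; apply this to \<open>s / (s + z)\<close> and \<open>z / (s + z)\<close>, which add up
  to one.\<close>

lemma powr_subadditive:
  fixes s z q :: real
  assumes "s > 0" "z > 0" "0 \<le> q" "q \<le> 1"
  shows "(s + z) powr q \<le> s powr q + z powr q"
proof -
  have pow: "t powr q \<ge> t" if "0 \<le> t" "t \<le> 1" for t :: real
    using powr_mono'[of q 1 t] that assms by (cases "t = 0") auto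
  have "1 = s / (s + z) + z / (s + z)" using assms by (simp add: add_divide_distrib[symmetric])
  also have "\<dots> \<le> (s / (s + z)) powr q + (z / (s + z)) powr q"
    by (intro add_mono pow) (use assms in auto)
  also have "\<dots> = (s powr q + z powr q) / (s + z) powr q"
    using assms by (simp add: powr_divide add_divide_distrib)
  finally show ?thesis using assms by (simp add: field_simps)
qed

lemma shifted_powr_le:
  fixes s z q :: real
  assumes "s > 0" "z > 0" "q \<le> 1"
  shows "(s + z) powr q \<le> (if q \<le> 0 then z powr q else s powr q + z powr q)"
  using assms powr_subadditive[of s z q] powr_mono2'[of q z "s + z"] by auto

lemma tricomi_integrable:
  fixes p z q :: real
  assumes p: "p > -1" and z: "z > 0" and q: "q \<le> 1"
  shows "integrable lborel (\<lambda>s. indicator {0<..} s * (exp (- s) * s powr p * (s + z) powr q))"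
proof (rule Bochner_Integration.integrable_bound)
  have e: "exp (- s) * s powr p * s powr q = exp (- s) * s powr (p + q)" for s :: real
    by (simp add: powr_add)
  have "integrable lborel (\<lambda>s. z powr q * (indicator {0<..} s * (exp (- s) * s powr p))
          + (if q \<le> 0 then 0 else indicator {0<..} s * (exp (- s) * s powr (p + q))))"
    using Gamma_weight(1)[OF p] Gamma_weight(1)[of "p + q"] p by (cases "q \<le> 0") auto
  then show "integrable lborel (\<lambda>s. z powr q * (indicator {0<..} s * (exp (- s) * s powr p))
          + (if q \<le> 0 then 0 else indicator {0<..} s * (exp (- s) * s powr p * s powr q)))"
    unfolding e .
  show "AE s in lborel. norm (indicator {0<..} s * (exp (- s) * s powr p * (s + z) powr q))
     \<le> norm (z powr q * (indicator {0<..} s * (exp (- s) * s powr p))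
          + (if q \<le> 0 then 0 else indicator {0<..} s * (exp (- s) * s powr p * s powr q)))"
  proof (rule AE_I2)
    fix s :: real
    show "norm (indicator {0<..} s * (exp (- s) * s powr p * (s + z) powr q))
     \<le> norm (z powr q * (indicator {0<..} s * (exp (- s) * s powr p))
          + (if q \<le> 0 then 0 else indicator {0<..} s * (exp (- s) * s powr p * s powr q)))"
    proof (cases "s > 0")
      case True
      have "exp (- s) * s powr p * (s + z) powr q \<le> exp (- s) * s powr p * (if q \<le> 0 then z powr q else s powr q + z powr q)"
        by (intro mult_left_mono shifted_powr_le[OF True z q]) auto
      then show ?thesis using True by (cases "q \<le> 0") (auto simp: abs_mult algebra_simps)
    qed auto
  qed
qed measurable

lemma DERIV_tricomi:
  assumes p: "p > -1" and z: "z > 0" and q: "q \<le> 1"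
  shows "(tricomi p q has_field_derivative q * tricomi p (q - 1) z) (at z)"
proof -
  have "((\<lambda>y. LINT s|lborel. indicator {0<..} s * (exp (- s) * s powr p * (s + y) powr q)) has_field_derivative
     (LINT s|lborel. indicator {0<..} s * (exp (- s) * s powr p * (q * (s + z) powr (q - 1))))) (at z)"
  proof (rule DERIV_under_integral[where d="z/2" and f'="\<lambda>y s. indicator {0<..} s * (exp (- s) * s powr p * (q * (s + y) powr (q - 1)))"
        and g="\<lambda>s. \<bar>q\<bar> * (z/2) powr (q - 1) * (indicator {0<..} s * (exp (- s) * s powr p))"])
    fix y s :: real assume "\<bar>y - z\<bar> < z / 2"
    then have y: "y > z/2" by (auto simp: abs_if split: if_splits)
    then have y0: "y > 0" using z by simp
    show "integrable lborel (\<lambda>s. indicator {0<..} s * (exp (- s) * s powr p * (s + y) powr q))"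
      by (rule tricomi_integrable[OF p y0 q])
    show "((\<lambda>y. indicator {0<..} s * (exp (- s) * s powr p * (s + y) powr q)) has_field_derivative
         indicator {0<..} s * (exp (- s) * s powr p * (q * (s + y) powr (q - 1)))) (at y)"
    proof (cases "s > 0")
      case True
      then show ?thesis using y0 by (auto intro!: derivative_eq_intros simp: field_simps)
    qed auto
    show "\<bar>indicator {0<..} s * (exp (- s) * s powr p * (q * (s + y) powr (q - 1)))\<bar>
       \<le> \<bar>q\<bar> * (z/2) powr (q - 1) * (indicator {0<..} s * (exp (- s) * s powr p))"
    proof (cases "s > 0")
      case True
      have "(s + y) powr (q - 1) \<le> (z/2) powr (q - 1)"
        using True y z q by (intro powr_mono2') auto
      then have "exp (- s) * s powr p * \<bar>q\<bar> * (s + y) powr (q - 1) \<le> exp (- s) * s powr p * \<bar>q\<bar> * (z/2) powr (q - 1)"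
        by (intro mult_left_mono) auto
      then show ?thesis using True by (simp add: abs_mult mult_ac)
    qed auto
  next
    show "integrable lborel (\<lambda>s. \<bar>q\<bar> * (z/2) powr (q - 1) * (indicator {0<..} s * (exp (- s) * s powr p)))"
      using Gamma_weight(1)[OF p] by simp
  qed (use z in auto)
  moreover have "(LINT s|lborel. indicator {0<..} s * (exp (- s) * s powr p * (q * (s + z) powr (q - 1)))) = q * tricomi p (q - 1) z"
    unfolding tricomi_def integral_mult_right_zero[symmetric] by (simp add: mult_ac)
  ultimately show ?thesis unfolding tricomi_def by simp
qed

lemma tricomi_raise_p:
  assumes "p > -1" "z > 0" "q \<le> 0"
  shows "tricomi (p + 1) q z = tricomi p (q + 1) z - z * tricomi p q z"
proof -
  let ?f = "\<lambda>p q s. indicator {0<..} s * (exp (- s) * s powr p * (s + z) powr q)"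
  have i1: "integrable lborel (?f p (q + 1))" and i2: "integrable lborel (?f p q)"
    by (rule tricomi_integrable[OF assms(1,2)], use assms(3) in simp)+
  have "?f (p + 1) q s = ?f p (q + 1) s - z * ?f p q s" for s
  proof (cases "s > 0")
    case True
    then have 1: "s powr (p + 1) = s powr p * s" "(s + z) powr (q + 1) = (s + z) powr q * (s + z)"
      using assms(2) powr_add[of s p 1] powr_add[of "s + z" q 1] by simp_all
    show ?thesis unfolding 1 by (simp add: algebra_simps)
  qed simp
  then have "tricomi (p + 1) q z = (LINT s|lborel. ?f p (q + 1) s - z * ?f p q s)"
    unfolding tricomi_def by (intro Bochner_Integration.integral_cong refl)
  also have "\<dots> = (LINT s|lborel. ?f p (q + 1) s) - (LINT s|lborel. z * ?f p q s)"
    using i1 i2 by (intro Bochner_Integration.integral_diff integrable_mult_right)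
  finally show ?thesis unfolding tricomi_def integral_mult_right_zero .
qed

text \<open>The function \<open>e\<^sup>-\<^sup>s s\<^sup>p\<^sup>+\<^sup>1 (s + z)\<^sup>q\<close> vanishes at both ends of \<open>(0, \<infinity>)\<close>.\<close>

lemma tricomi_by_parts:
  assumes p: "p > -1" and z: "z > 0" and q: "q \<le> 1"
  shows "tricomi (p + 1) q z = (p + 1) * tricomi p q z + q * tricomi (p + 1) (q - 1) z"
proof -
  define F where "F s = exp (- s) * s powr (p + 1) * (s + z) powr q" for s :: real
  define k where "k p q s = exp (- s) * s powr p * (s + z) powr q" for p q s :: real
  define f where "f s = - k (p+1) q s + (p + 1) * k p q s + q * k (p + 1) (q - 1) s" for s :: real
  have ki: "integrable lborel (\<lambda>s. indicator {0<..} s * k p' q' s)" if "p' > -1" "q' \<le> 1" for p' q'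
    using tricomi_integrable[OF that(1) z that(2)] by (simp add: k_def)
  have Jk: "tricomi p' q' z = (LINT s|lborel. indicator {0<..} s * k p' q' s)" for p' q'
    by (simp add: tricomi_def k_def)
  have eq: "(\<lambda>s. indicator {0<..} s * f s) = (\<lambda>s. - (indicator {0<..} s * k (p+1) q s) + (p + 1) * (indicator {0<..} s * k p q s) + q * (indicator {0<..} s * k (p + 1) (q - 1) s))"
    by (simp add: f_def fun_eq_iff algebra_simps)
  have k3: "integrable lborel (\<lambda>s. indicator {0<..} s * k (p+1) q s)"
    "integrable lborel (\<lambda>s. indicator {0<..} s * k p q s)"
    "integrable lborel (\<lambda>s. indicator {0<..} s * k (p+1) (q-1) s)"
    using p q by (auto intro!: ki)
  have fi: "integrable lborel (\<lambda>s. indicator {0<..} s * f s)"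
    unfolding eq by (intro Bochner_Integration.integrable_add Bochner_Integration.integrable_minus integrable_mult_right k3)
  have "(LINT s|lborel. indicator {0<..} s * f s) = - tricomi (p+1) q z + (p + 1) * tricomi p q z + q * tricomi (p + 1) (q - 1) z"
    unfolding Jk eq using k3 by simp
  moreover have "(LINT s|lborel. indicator {0<..} s * f s) = 0"
  proof -
    have "(LBINT s=0..\<infinity>. f s) = 0 - 0"
    proof (rule interval_integral_FTC_integrable[where F=F])
      fix s assume "0 < ereal s" "ereal s < \<infinity>"
      then have s: "s > 0" by simp
      have 1: "((\<lambda>s. s powr (p + 1)) has_real_derivative (p + 1) * s powr p) (at s)"
        using has_real_derivative_powr[of s "p + 1"] s by simp
      have 2: "((\<lambda>s. (s + z) powr q) has_real_derivative q * (s + z) powr (q - 1) * 1) (at s)"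
        by (rule DERIV_chain2[OF has_real_derivative_powr]) (use s z in \<open>auto intro!: derivative_eq_intros\<close>)
      have 3: "((\<lambda>s. exp (- s)) has_real_derivative - exp (- s)) (at s)"
        by (auto intro!: derivative_eq_intros)
      have "(F has_real_derivative f s) (at s)"
        unfolding F_def by (rule DERIV_cong[OF DERIV_mult[OF DERIV_mult[OF 3 1] 2]])
          (simp add: f_def k_def algebra_simps)
      then show "(F has_vector_derivative f s) (at s)"
        by (simp add: has_real_derivative_iff_has_vector_derivative)
      show "isCont f s" unfolding f_def k_def using s z by (intro continuous_intros) auto
    next
      have e: "einterval 0 \<infinity> = {0<..}" by (auto simp: einterval_def)
      show "set_integrable lborel (einterval 0 \<infinity>) f"
        unfolding e set_integrable_def using fi by simp
      have "((\<lambda>s. exp (- s) * s powr (p + 1) * (s + z) powr q) \<longlongrightarrow> exp (- 0) * 0 powr (p+1) * (0 + z) powr q) (at_right 0)"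
        using p z by (intro tendsto_intros) (auto intro: eventually_at_right_less[THEN eventually_mono])
      then have "(F \<longlongrightarrow> 0) (at_right 0)" unfolding F_def by simp
      then show "((F \<circ> real_of_ereal) \<longlongrightarrow> 0) (at_right 0)"
        using ereal_tendsto_simps1(2)[of F 0 0] by (simp add: zero_ereal_def)
      have "(F \<longlongrightarrow> 0) at_top" unfolding F_def using z by real_asymp
      then show "((F \<circ> real_of_ereal) \<longlongrightarrow> 0) (at_left \<infinity>)"
        by (simp add: ereal_tendsto_simps1)
    qed auto
    moreover have "(LBINT s=0..\<infinity>. f s) = (LINT s|lborel. indicator {0<..} s * f s)"
      by (simp add: interval_lebesgue_integral_def einterval_def set_lebesgue_integral_def greaterThan_def)
    ultimately show ?thesis by simp
  qed
  ultimately show ?thesis by simp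
qed

lemma tricomi_nonneg: "0 \<le> tricomi p q z"
  unfolding tricomi_def by (intro integral_nonneg_AE AE_I2) auto

lemma tricomi_le_neg:
  assumes p: "p > -1" and z: "z > 0" and q: "q \<le> 0"
  shows "tricomi p q z \<le> z powr q * Gamma (p + 1)"
proof -
  have "tricomi p q z \<le> (LINT s|lborel. z powr q * (indicator {0<..} s * (exp (- s) * s powr p)))"
    unfolding tricomi_def
  proof (rule integral_mono)
    fix s :: real
    show "indicator {0<..} s * (exp (- s) * s powr p * (s + z) powr q) \<le> z powr q * (indicator {0<..} s * (exp (- s) * s powr p))"
    proof (cases "s > 0")
      case True
      have "exp (- s) * s powr p * (s + z) powr q \<le> exp (- s) * s powr p * z powr q"
        using True z q by (intro mult_left_mono powr_mono2') auto
      then show ?thesis using True by (simp add: mult_ac)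
    qed simp
  qed (use tricomi_integrable[of p z q] Gamma_weight(1)[OF p] assms in auto)
  then show ?thesis using Gamma_weight(2)[OF p] by simp
qed

text \<open>For \<open>0 \<le> q \<le> 1\<close> the factor \<open>(s + z)\<^sup>q\<close> lies between each of \<open>s\<^sup>q\<close>, \<open>z\<^sup>q\<close> and their sum.  This one
  estimate gives the limit at \<open>0\<close>, the leading term at infinity and positivity.\<close>

lemma tricomi_bounds_pos:
  assumes p: "p > -1" and z: "z > 0" and q: "0 \<le> q" "q \<le> 1"
  shows "z powr q * Gamma (p + 1) \<le> tricomi p q z" "Gamma (p + q + 1) \<le> tricomi p q z"
    "tricomi p q z \<le> z powr q * Gamma (p + 1) + Gamma (p + q + 1)"
proof -
  have pq: "p + q > -1" using p q by simp
  note i = Gamma_weight(1)[OF p] Gamma_weight(1)[OF pq] tricomi_integrable[OF p z q(2)]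
  note v = Gamma_weight(2)[OF p] Gamma_weight(2)[OF pq]
  let ?w = "\<lambda>p s. indicator {0<..} s * (exp (- s) * s powr p) :: real"
  let ?f = "\<lambda>s. indicator {0<..} s * (exp (- s) * s powr p * (s + z) powr q) :: real"
  have e: "exp (- s) * s powr (p + q) = exp (- s) * s powr p * s powr q" for s :: real
    by (simp add: powr_add)
  have le: "a \<le> b \<Longrightarrow> exp (- s) * s powr p * a \<le> exp (- s) * s powr p * b" for a b s :: real
    by (intro mult_left_mono) auto
  have "(LINT s|lborel. z powr q * ?w p s) \<le> (LINT s|lborel. ?f s)"
  proof (rule integral_mono)
    fix s :: real
    show "z powr q * ?w p s \<le> ?f s"
      using le[of "z powr q" "(s + z) powr q" s] powr_mono2[of q z "s + z"] z q by (cases "s > 0") (auto simp: mult_ac)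
  qed (use i in auto)
  then show "z powr q * Gamma (p + 1) \<le> tricomi p q z" unfolding tricomi_def using v by simp
  have "(LINT s|lborel. ?w (p + q) s) \<le> (LINT s|lborel. ?f s)"
  proof (rule integral_mono)
    fix s :: real
    show "?w (p + q) s \<le> ?f s"
      unfolding e using le[of "s powr q" "(s + z) powr q" s] powr_mono2[of q s "s + z"] z q by (cases "s > 0") auto
  qed (use i in auto)
  then show "Gamma (p + q + 1) \<le> tricomi p q z" unfolding tricomi_def using v by simp
  have "(LINT s|lborel. ?f s) \<le> (LINT s|lborel. z powr q * ?w p s + ?w (p + q) s)"
  proof (rule integral_mono)
    fix s :: real
    show "?f s \<le> z powr q * ?w p s + ?w (p + q) s"
      unfolding e using le[OF powr_subadditive[of s z q]] z q by (cases "s > 0") (auto simp: algebra_simps)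
  qed (use i in auto)
  also have "\<dots> = (LINT s|lborel. z powr q * ?w p s) + (LINT s|lborel. ?w (p + q) s)"
    using i by (intro Bochner_Integration.integral_add integrable_mult_right)
  finally show "tricomi p q z \<le> z powr q * Gamma (p + 1) + Gamma (p + q + 1)"
    unfolding tricomi_def integral_mult_right_zero v .
qed

text \<open>The substitution \<open>x = t / (1 - t)\<close> carries the Beta integral over \<open>(0, 1)\<close> to the half-line.\<close>

lemma Beta_half_line:
  fixes p m :: real
  assumes p: "p > -1" and m: "m > 0"
  shows "integrable lborel (\<lambda>x. indicator {0<..} x * (x powr p * (1 + x) powr (- p - 1 - m)))"
    and "(LINT x|lborel. indicator {0<..} x * (x powr p * (1 + x) powr (- p - 1 - m))) = Beta (p + 1) m"
proof -
  define f :: "real \<Rightarrow> real" where "f x = x powr p * (1 + x) powr (- p - 1 - m)" for x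
  define g :: "real \<Rightarrow> real" where "g t = t / (1 - t)" for t
  define g' :: "real \<Rightarrow> real" where "g' t = 1 / (1 - t)^2" for t
  have fg: "f (g t) * g' t = t powr p * (1 - t) powr (m - 1)" if t: "0 < t" "t < 1" for t
  proof -
    have "1 + g t = (1 - t) powr (-1)" using t by (simp add: g_def powr_minus field_simps)
    then have 1: "(1 + g t) powr (- p - 1 - m) = (1 - t) powr (p + 1 + m)"
      by (simp only: powr_powr) (simp add: algebra_simps)
    have 2: "g t powr p = t powr p * (1 - t) powr (- p)"
      using t by (simp add: g_def powr_divide powr_minus_divide)
    have 3: "g' t = (1 - t) powr (-2)" using t by (simp add: g'_def powr_minus powr_numeral field_simps)
    have "(1 - t) powr (- p) * (1 - t) powr (p + 1 + m) * (1 - t) powr (-2) = (1 - t) powr (m - 1)"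
      by (simp add: powr_add[symmetric])
    then show ?thesis unfolding f_def 1 2 3 by (simp add: mult_ac)
  qed
  have e1: "einterval 0 1 = {0<..<1}" by (auto simp: einterval_def)
  have e2: "einterval 0 \<infinity> = {0<..}" by (auto simp: einterval_def)
  have hi: "((\<lambda>t. t powr p * (1 - t) powr (m - 1)) has_integral Beta (p + 1) m) {0<..<1}"
    using has_integral_Beta_real[of "p + 1" m] p m by (simp add: has_integral_Icc_iff_Ioo)
  have ms: "set_borel_measurable lborel {0<..<1} (\<lambda>t::real. t powr p * (1 - t) powr (m - 1))"
    unfolding set_borel_measurable_def by measurable
  note B = nonneg_has_integral_lborel[OF hi _ ms]
  have eq: "(\<lambda>t. indicator {0<..<1} t *\<^sub>R (f (g t) * g' t)) = (\<lambda>t. indicator {0<..<1} t *\<^sub>R (t powr p * (1 - t) powr (m - 1)))"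
    using fg by (auto simp: indicator_def fun_eq_iff)
  have int: "set_integrable lborel (einterval 0 1) (\<lambda>x. f (g x) * g' x)"
    using B(1) unfolding e1 set_integrable_def eq by auto
  have lim0: "((ereal \<circ> g \<circ> real_of_ereal) \<longlongrightarrow> 0) (at_right 0)"
  proof -
    have "(g \<longlongrightarrow> 0) (at_right 0)" unfolding g_def by real_asymp
    then show ?thesis using ereal_tendsto_simps1(2)[of "ereal \<circ> g" 0 0]
      by (simp add: zero_ereal_def comp_def)
  qed
  have lim1: "((ereal \<circ> g \<circ> real_of_ereal) \<longlongrightarrow> \<infinity>) (at_left 1)"
  proof -
    have "filterlim g at_top (at_left 1)" unfolding g_def by real_asymp
    then have "((\<lambda>x. ereal (g x)) \<longlongrightarrow> \<infinity>) (at_left 1)"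
      by (simp add: tendsto_PInfty_eq_at_top)
    then show ?thesis using ereal_tendsto_simps1(1)[of "ereal \<circ> g" \<infinity> 1]
      by (simp add: one_ereal_def comp_def)
  qed
  have sub: "set_integrable lborel (einterval 0 \<infinity>) f"
    "(LBINT x=0..\<infinity>. f x) = (LBINT x=0..1. (f (g x) * g' x))"
  proof -
    note S = interval_integral_substitution_nonneg[of 0 1 g g' f, OF _ _ _ _ _ _ lim0 lim1 int]
    have D: "DERIV g x :> g' x" if "0 < ereal x" "ereal x < 1" for x
      unfolding g_def g'_def using that
      by (auto intro!: derivative_eq_intros simp: power2_eq_square one_ereal_def field_simps)
    have C: "isCont f (g x)" if "0 < ereal x" "ereal x < 1" for x
    proof -
      have "g x > 0" using that by (simp add: g_def one_ereal_def)
      then show ?thesis unfolding f_def by (intro continuous_intros) auto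
    qed
    have C': "isCont g' x" if "0 < ereal x" "ereal x < 1" for x
      unfolding g'_def using that by (intro continuous_intros) (auto simp: one_ereal_def)
    show "set_integrable lborel (einterval 0 \<infinity>) f"
      by (rule S(1)) (use D C C' in \<open>auto simp: f_def g'_def\<close>)
    show "(LBINT x=0..\<infinity>. f x) = (LBINT x=0..1. (f (g x) * g' x))"
      by (rule S(2)) (use D C C' in \<open>auto simp: f_def g'_def\<close>)
  qed
  show "integrable lborel (\<lambda>x. indicator {0<..} x * (x powr p * (1 + x) powr (- p - 1 - m)))"
    using sub(1) unfolding e2 set_integrable_def f_def by simp
  have "(LINT x|lborel. indicator {0<..} x * (x powr p * (1 + x) powr (- p - 1 - m))) = (LBINT x=0..\<infinity>. f x)"
    unfolding interval_lebesgue_integral_def e2 set_lebesgue_integral_def f_def by simp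
  also have "\<dots> = Beta (p + 1) m"
    unfolding sub(2) using B(2) unfolding interval_lebesgue_integral_def e1 set_lebesgue_integral_def eq by simp
  finally show "(LINT x|lborel. indicator {0<..} x * (x powr p * (1 + x) powr (- p - 1 - m))) = Beta (p + 1) m" .
qed

text \<open>Scaling \<open>s = z x\<close> extracts the power of \<open>z\<close> and leaves \<open>x\<^sup>p (1 + x)\<^sup>q\<close> with the damping \<open>e\<^sup>-\<^sup>z\<^sup>x\<close>, which
  disappears as \<open>z\<close> tends to \<open>0\<close>.\<close>

lemma tricomi_small:
  fixes p m :: real
  assumes p: "p > -1" and m: "m > 0"
  shows "((\<lambda>z. z powr m * tricomi p (- p - 1 - m) z) \<longlongrightarrow> Beta (p + 1) m) (at_right 0)"
proof -
  let ?q = "- p - 1 - m"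
  define G where "G r = (LINT x|lborel. indicator {0<..} x * (exp (- (x / r)) * (x powr p * (1 + x) powr ?q)))" for r :: real
  have "(G \<longlongrightarrow> (LINT x|lborel. indicator {0<..} x * (x powr p * (1 + x) powr ?q))) at_top"
    unfolding G_def
  proof (rule integral_dominated_convergence_at_top[where w="\<lambda>x. indicator {0<..} x * (x powr p * (1 + x) powr ?q)"])
    show "integrable lborel (\<lambda>x. indicator {0<..} x * (x powr p * (1 + x) powr ?q))"
      by (rule Beta_half_line(1)[OF p m])
    show "\<forall>\<^sub>F r in at_top. AE x in lborel. norm (indicator {0<..} x * (exp (- (x / r)) * (x powr p * (1 + x) powr ?q)))
       \<le> indicator {0<..} x * (x powr p * (1 + x) powr ?q)"
      using eventually_gt_at_top[of 0]
    proof eventually_elim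
      case (elim r)
      show ?case
      proof (rule AE_I2)
        fix x :: real
        have "exp (- (x / r)) * (x powr p * (1 + x) powr ?q) \<le> 1 * (x powr p * (1 + x) powr ?q)" if "x > 0"
          using that elim by (intro mult_right_mono) auto
        then show "norm (indicator {0<..} x * (exp (- (x / r)) * (x powr p * (1 + x) powr ?q)))
           \<le> indicator {0<..} x * (x powr p * (1 + x) powr ?q)"
          by (cases "x > 0") (auto simp: abs_mult)
      qed
    qed
    show "AE x in lborel. ((\<lambda>r. indicator {0<..} x * (exp (- (x / r)) * (x powr p * (1 + x) powr ?q)))
       \<longlongrightarrow> indicator {0<..} x * (x powr p * (1 + x) powr ?q)) at_top"
    proof (rule AE_I2)
      fix x :: real
      have "((\<lambda>r. x / r) \<longlongrightarrow> 0) at_top" by real_asymp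
      then have "((\<lambda>r. exp (- (x / r))) \<longlongrightarrow> exp (- 0)) at_top" by (intro tendsto_intros)
      then have "((\<lambda>r. indicator {0<..} x * (exp (- (x / r)) * (x powr p * (1 + x) powr ?q)))
       \<longlongrightarrow> indicator {0<..} x * (exp (- 0) * (x powr p * (1 + x) powr ?q))) at_top"
        by (rule tendsto_mult[OF tendsto_const tendsto_mult[OF _ tendsto_const]])
      then show "((\<lambda>r. indicator {0<..} x * (exp (- (x / r)) * (x powr p * (1 + x) powr ?q)))
       \<longlongrightarrow> indicator {0<..} x * (x powr p * (1 + x) powr ?q)) at_top"
        by (simp only: minus_zero exp_zero mult_1)
    qed
  qed auto
  then have "(G \<longlongrightarrow> Beta (p + 1) m) at_top" unfolding Beta_half_line(2)[OF p m] .
  then have "((\<lambda>z. G (inverse z)) \<longlongrightarrow> Beta (p + 1) m) (at_right 0)"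
    by (rule filterlim_compose) (rule filterlim_inverse_at_top_right)
  moreover have "G (inverse z) = z powr m * tricomi p ?q z" if z: "z > 0" for z
  proof -
    have "tricomi p ?q z = \<bar>z\<bar> *\<^sub>R (LINT x|lborel. indicator {0<..} (0 + z * x) * (exp (- (0 + z * x)) * (0 + z * x) powr p * (0 + z * x + z) powr ?q))"
      unfolding tricomi_def using z by (intro lborel_integral_real_affine) auto
    also have "(\<lambda>x. indicator {0<..} (0 + z * x) * (exp (- (0 + z * x)) * (0 + z * x) powr p * (0 + z * x + z) powr ?q))
       = (\<lambda>x. z powr (- 1 - m) * (indicator {0<..} x * (exp (- (x / inverse z)) * (x powr p * (1 + x) powr ?q))))"
    proof
      fix x
      show "indicator {0<..} (0 + z * x) * (exp (- (0 + z * x)) * (0 + z * x) powr p * (0 + z * x + z) powr ?q)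
         = z powr (- 1 - m) * (indicator {0<..} x * (exp (- (x / inverse z)) * (x powr p * (1 + x) powr ?q)))"
      proof (cases "x > 0")
        case True
        have "0 + z * x + z = z * (1 + x)" by (simp add: algebra_simps)
        then have 1: "(0 + z * x + z) powr ?q = z powr ?q * (1 + x) powr ?q"
          using z True by (simp add: powr_mult)
        have 2: "(0 + z * x) powr p = z powr p * x powr p" using z True by (simp add: powr_mult)
        have 3: "z powr (- 1 - m) = z powr p * z powr ?q" using z by (simp add: powr_add[symmetric])
        show ?thesis unfolding 1 2 3 using z True by (simp add: divide_inverse mult_ac)
      next
        case False
        with z have "\<not> z * x > 0" by (simp add: zero_less_mult_iff)
        with False show ?thesis by simp
      qed
    qed
    finally have "tricomi p ?q z = z * (z powr (- 1 - m) * G (inverse z))"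
      unfolding G_def using z by simp
    moreover have "z powr m * (z * z powr (- 1 - m)) = 1"
    proof -
      have "z powr (- 1 - m) = inverse z * inverse (z powr m)" using z by (simp add: powr_diff powr_minus divide_inverse)
      moreover have "z powr m \<noteq> 0" using z by simp
      ultimately show ?thesis using z by (simp add: mult_ac)
    qed
    ultimately show ?thesis by simp
  qed
  then have "\<forall>\<^sub>F z in at_right 0. G (inverse z) = z powr m * tricomi p ?q z"
    by (auto intro: eventually_at_right_less[THEN eventually_mono])
  ultimately show ?thesis by (rule Lim_transform_eventually)
qed

section \<open>The profile of the self-similar solution\<close>

text \<open>Uniqueness for \<open>D'' = q x D - (x\<^sup>2 / 3) D'\<close> with zero data at the right end point.  The energy
  \<open>D\<^sup>2 + D'\<^sup>2\<close> changes at most at an exponential rate (Gronwall), so it is zero throughout if it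
  is zero at the end point.\<close>

lemma profile_ODE_unique:
  fixes D D' :: "real \<Rightarrow> real"
  assumes x: "x0 < x1"
    and D: "\<And>x. x0 < x \<Longrightarrow> x < x1 \<Longrightarrow> (D has_real_derivative D' x) (at x)"
    and D': "\<And>x. x0 < x \<Longrightarrow> x < x1 \<Longrightarrow> (D' has_real_derivative q * x * D x - x^2 / 3 * D' x) (at x)"
    and lim: "(D \<longlongrightarrow> 0) (at_left x1)" "(D' \<longlongrightarrow> 0) (at_left x1)"
    and y: "x0 < y" "y < x1"
  shows "D y = 0"
proof -
  define R where "R = \<bar>x0\<bar> + \<bar>x1\<bar>"
  define K where "K = 1 + \<bar>q\<bar> * R + 2 * R^2"
  define E where "E x = (D x)^2 + (D' x)^2" for x
  define E' where "E' x = 2 * D x * D' x + 2 * D' x * (q * x * D x - x^2 / 3 * D' x)" for x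
  have E': "(E has_real_derivative E' x) (at x)" if "x0 < x" "x < x1" for x
    unfolding E_def E'_def using D[OF that] D'[OF that]
    by (auto intro!: derivative_eq_intros simp: algebra_simps)
  have bound: "- (K * E x) \<le> E' x" if x: "x0 < x" "x < x1" for x
  proof -
    have R: "\<bar>x\<bar> \<le> R" "0 \<le> R" using x by (auto simp: R_def)
    have s1: "- (a^2 + b^2) \<le> 2 * a * b \<and> 2 * a * b \<le> a^2 + b^2" for a b :: real
      using zero_le_power2[of "a + b"] zero_le_power2[of "a - b"] by (simp add: power2_sum power2_diff)
    have 1: "- E x \<le> 2 * D x * D' x" unfolding E_def using s1[of "D x" "D' x"] by simp
    have "\<bar>q * x\<bar> \<le> \<bar>q\<bar> * R" unfolding abs_mult using R by (intro mult_left_mono) auto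
    moreover have "\<bar>2 * D x * D' x\<bar> \<le> E x" unfolding E_def using s1[of "D x" "D' x"] by (simp add: abs_le_iff)
    ultimately have "\<bar>q * x\<bar> * \<bar>2 * D x * D' x\<bar> \<le> (\<bar>q\<bar> * R) * E x" by (intro mult_mono) auto
    then have 2: "- (\<bar>q\<bar> * R * E x) \<le> q * x * (2 * D x * D' x)"
      unfolding abs_mult[symmetric] by simp
    have "x^2 \<le> R^2" using R by (simp add: abs_le_square_iff[symmetric])
    then have "2 * x^2 / 3 \<le> 2 * R^2" using zero_le_power2[of R] by linarith
    then have "2 * x^2 / 3 * (D' x)^2 \<le> 2 * R^2 * E x"
      unfolding E_def by (intro mult_mono) auto
    with 1 2 show ?thesis unfolding K_def E'_def by (simp add: algebra_simps power2_eq_square)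
  qed
  define g where "g x = E x * exp (K * x)" for x
  \<comment> \<open>the weight \<open>exp (K x)\<close> compensates the largest possible rate of decay of the energy\<close>
  have mono: "g y \<le> g z" if z: "y < z" "z < x1" for z
  proof (rule DERIV_nonneg_imp_nondecreasing[of y z g])
    fix x assume "y \<le> x" "x \<le> z"
    then have x: "x0 < x" "x < x1" using z y by auto
    have "(g has_real_derivative (E' x + K * E x) * exp (K * x)) (at x)"
      unfolding g_def using E'[OF x] by (auto intro!: derivative_eq_intros simp: algebra_simps)
    moreover have "(E' x + K * E x) * exp (K * x) \<ge> 0" using bound[OF x] by (intro mult_nonneg_nonneg) auto
    ultimately show "\<exists>d. (g has_real_derivative d) (at x) \<and> 0 \<le> d" by blast
  qed (use z in auto)
  have "(g \<longlongrightarrow> (0^2 + 0^2) * exp (K * x1)) (at_left x1)"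
    unfolding g_def E_def by (intro tendsto_intros lim)
  then have "g y \<le> (0^2 + 0^2) * exp (K * x1)"
  proof (rule tendsto_lowerbound)
    show "\<forall>\<^sub>F z in at_left x1. g y \<le> g z"
      using eventually_at_left_real[OF y(2)] by eventually_elim (use mono in auto)
  qed simp
  then have "E y \<le> 0" by (simp add: g_def mult_le_0_iff)
  then show "D y = 0" unfolding E_def by (smt (verit) zero_le_power2 power2_eq_square power_zero_numeral zero_eq_power2)
qed

text \<open>The power \<open>9\<^sup>1\<^sup>/\<^sup>3\<close> is absorbed here, so that \<open>profile_coeff q\<close> is the slope of the profile at \<open>0\<close>.\<close>

definition profile_coeff :: "real \<Rightarrow> real" where
  "profile_coeff q = Gamma (2/3) * Gamma (1/3 - q) / (Gamma (- q) * Gamma (4/3)) / 9 powr (1/3)"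

text \<open>With \<open>q = \<lambda> / 3\<close>, the function of the theorem is \<open>x\<^sup>q profile q (v / x\<^sup>1\<^sup>/\<^sup>3)\<close>.\<close>

definition profile :: "real \<Rightarrow> real \<Rightarrow> real" where
  "profile q y = kummer_M (- q) (2/3) (- (y^3) / 9) + profile_coeff q * (y * kummer_M (1/3 - q) (4/3) (- (y^3) / 9))"

text \<open>The derivative of the profile, with the terms rewritten by contiguous relations so that every Kummer
  function in it decays algebraically as \<open>y\<close> tends to \<open>+\<infinity>\<close>.\<close>

definition profile' :: "real \<Rightarrow> real \<Rightarrow> real" where
  "profile' q y = q / 2 * (y^2 * kummer_M (1 - q) (5/3) (- (y^3) / 9))
     + profile_coeff q * (3 * q * kummer_M (1/3 - q) (4/3) (- (y^3) / 9) + (1 - 3 * q) * kummer_M (4/3 - q) (4/3) (- (y^3) / 9))"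

text \<open>The profile of the derivative in \<open>x\<close>: it equals both \<open>q w - y w' / 3\<close> and \<open>w'' / y\<close> for the profile \<open>w\<close>
  (lemmas \<open>profile_Euler\<close> and \<open>DERIV_profile'\<close>).  The equality of the two is the differential equation, and this
  form shows that the quotient by \<open>y\<close> is harmless at \<open>y = 0\<close>.\<close>

definition profile_dx :: "real \<Rightarrow> real \<Rightarrow> real" where
  "profile_dx q y = q * kummer_M (1 - q) (2/3) (- (y^3) / 9)
     - profile_coeff q * ((1/3 - q) * (y * kummer_M (4/3 - q) (4/3) (- (y^3) / 9)))"

lemma DERIV_kummer_M_cubic:
  assumes "b > 0"
  shows "((\<lambda>y. kummer_M a b (- (y^3) / 9)) has_real_derivative
     a / b * kummer_M (a + 1) (b + 1) (- (y^3) / 9) * (- (y^2) / 3)) (at y)"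
  by (rule DERIV_chain2[OF DERIV_kummer_M[OF assms]]) (auto intro!: derivative_eq_intros)

lemma continuous_on_kummer_M_cubic:
  assumes "b > 0"
  shows "continuous_on S (\<lambda>y. kummer_M a b (- (y^3) / 9))"
  by (rule continuous_at_imp_continuous_on) (blast intro: DERIV_isCont DERIV_kummer_M_cubic[OF assms])

lemma DERIV_profile: "(profile q has_real_derivative profile' q y) (at y)"
proof -
  let ?z = "- (y^3) / 9"
  have 1: "(1/3 - q) * kummer_M (1/3 - q) (4/3) ?z + (1/3 - q) / (4/3) * ?z * kummer_M (4/3 - q) (7/3) ?z = (1/3 - q) * kummer_M (4/3 - q) (4/3) ?z"
    using kummer_M_raise_both[of "4/3" "1/3 - q" ?z] by simp
  have "((\<lambda>y. y * kummer_M (1/3 - q) (4/3) (- (y^3) / 9)) has_real_derivative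
     1 * kummer_M (1/3 - q) (4/3) ?z + (1/3 - q) / (4/3) * kummer_M (1/3 - q + 1) (4/3 + 1) ?z * (- (y^2) / 3) * y) (at y)"
    by (rule DERIV_mult[OF DERIV_ident DERIV_kummer_M_cubic]) simp
  also have "1 * kummer_M (1/3 - q) (4/3) ?z + (1/3 - q) / (4/3) * kummer_M (1/3 - q + 1) (4/3 + 1) ?z * (- (y^2) / 3) * y
      = kummer_M (1/3 - q) (4/3) ?z + 3 * ((1/3 - q) / (4/3) * ?z * kummer_M (4/3 - q) (7/3) ?z)"
    by (simp add: power2_eq_square power3_eq_cube)
  also have "\<dots> = 3 * q * kummer_M (1/3 - q) (4/3) ?z + (1 - 3 * q) * kummer_M (4/3 - q) (4/3) ?z"
    using 1 by (simp add: algebra_simps)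
  finally have 2: "((\<lambda>y. y * kummer_M (1/3 - q) (4/3) (- (y^3) / 9)) has_real_derivative
     3 * q * kummer_M (1/3 - q) (4/3) ?z + (1 - 3 * q) * kummer_M (4/3 - q) (4/3) ?z) (at y)" .
  have "((\<lambda>y. kummer_M (- q) (2/3) (- (y^3) / 9)) has_real_derivative
     (- q) / (2/3) * kummer_M (- q + 1) (2/3 + 1) ?z * (- (y^2) / 3)) (at y)"
    by (rule DERIV_kummer_M_cubic) simp
  also have "(- q) / (2/3) * kummer_M (- q + 1) (2/3 + 1) ?z * (- (y^2) / 3) = q / 2 * (y^2 * kummer_M (1 - q) (5/3) ?z)"
    by simp
  finally show ?thesis unfolding profile_def[abs_def] profile'_def
    by (intro DERIV_add DERIV_cmult 2)
qed

lemma DERIV_profile': "(profile' q has_real_derivative y * profile_dx q y) (at y)"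
proof -
  let ?z = "- (y^3) / 9"
  have D: "((\<lambda>y. q / 2 * (y^2 * kummer_M (1 - q) (5/3) (- (y^3) / 9))) has_real_derivative
     q / 2 * (2 * y * kummer_M (1 - q) (5/3) ?z + (1 - q) / (5/3) * kummer_M (1 - q + 1) (5/3 + 1) ?z * (- (y^2) / 3) * y^2)) (at y)"
    by (intro DERIV_cmult DERIV_mult DERIV_kummer_M_cubic) (auto intro!: derivative_eq_intros)
  have M: "kummer_M (1 - q) (2/3) ?z = kummer_M (1 - q) (5/3) ?z + (1 - q) / (10/9) * ?z * kummer_M (2 - q) (8/3) ?z"
    using kummer_M_raise_b[of "2/3" "1 - q" ?z] by simp
  have s: "1 - q + 1 = 2 - q" "5/3 + 1 = (8/3::real)" by simp_all
  have 1: "((\<lambda>y. q / 2 * (y^2 * kummer_M (1 - q) (5/3) (- (y^3) / 9))) has_real_derivative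
     y * (q * kummer_M (1 - q) (2/3) ?z)) (at y)"
    by (rule DERIV_cong[OF D], unfold M s) (simp add: field_simps power2_eq_square power3_eq_cube)
  define A where "A = 4/3 - q"
  define X where "X = A * (?z * kummer_M (A + 1) (10/3) ?z)"
  have "A * kummer_M (A + 1) (7/3) ?z = A * kummer_M A (7/3) ?z + 3/7 * X"
    using kummer_M_raise_both[of "7/3" A ?z] by (simp add: X_def)
  moreover have "kummer_M A (4/3) ?z = kummer_M A (7/3) ?z + 9/28 * X"
    using kummer_M_raise_b[of "4/3" A ?z] by (simp add: X_def)
  moreover have "q * kummer_M A (7/3) ?z = 4/3 * kummer_M A (7/3) ?z - A * kummer_M A (7/3) ?z"
    unfolding left_diff_distrib[symmetric] by (simp add: A_def)
  ultimately have c: "4/3 * kummer_M A (4/3) ?z = q * kummer_M A (7/3) ?z + A * kummer_M (A + 1) (7/3) ?z"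
    by linarith
  have "((\<lambda>y. 3 * q * kummer_M (1/3 - q) (4/3) (- (y^3) / 9) + (1 - 3 * q) * kummer_M (4/3 - q) (4/3) (- (y^3) / 9)) has_real_derivative
     3 * q * ((1/3 - q) / (4/3) * kummer_M (1/3 - q + 1) (4/3 + 1) ?z * (- (y^2) / 3))
      + (1 - 3 * q) * ((4/3 - q) / (4/3) * kummer_M (4/3 - q + 1) (4/3 + 1) ?z * (- (y^2) / 3))) (at y)"
    by (intro DERIV_add DERIV_cmult DERIV_kummer_M_cubic) auto
  moreover have "3 * q * ((1/3 - q) / (4/3) * kummer_M (1/3 - q + 1) (4/3 + 1) ?z * (- (y^2) / 3))
      + (1 - 3 * q) * ((4/3 - q) / (4/3) * kummer_M (4/3 - q + 1) (4/3 + 1) ?z * (- (y^2) / 3))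
      = - (3/4 * (1/3 - q) * y^2 * (q * kummer_M A (7/3) ?z + A * kummer_M (A + 1) (7/3) ?z))"
  proof -
    have alg: "3 * q * ((1/3 - q) / (4/3) * S * (- (y^2) / 3)) + (1 - 3 * q) * (B / (4/3) * T * (- (y^2) / 3))
      = - (3/4 * (1/3 - q) * y^2 * (q * S + B * T))" for S T B :: real
      by (simp add: field_simps)
    have s: "1/3 - q + 1 = A" "4/3 + 1 = (7/3::real)" "4/3 - q = A" by (simp_all add: A_def)
    show ?thesis unfolding s by (rule alg)
  qed
  moreover have "\<dots> = - (y * ((1/3 - q) * (y * kummer_M (4/3 - q) (4/3) ?z)))"
    unfolding c[symmetric] by (simp add: A_def power2_eq_square)
  ultimately have "((\<lambda>y. 3 * q * kummer_M (1/3 - q) (4/3) (- (y^3) / 9) + (1 - 3 * q) * kummer_M (4/3 - q) (4/3) (- (y^3) / 9)) has_real_derivative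
     - (y * ((1/3 - q) * (y * kummer_M (4/3 - q) (4/3) ?z)))) (at y)" by simp
  from DERIV_add[OF 1 DERIV_cmult[OF this, of "profile_coeff q"]]
  show ?thesis unfolding profile'_def[abs_def] profile_dx_def by (simp add: algebra_simps)
qed

text \<open>Differentiating \<open>x\<^sup>q w (v / x\<^sup>1\<^sup>/\<^sup>3)\<close> in \<open>x\<close> gives \<open>x\<^sup>q\<^sup>-\<^sup>1 (q w - y w' / 3)\<close>.\<close>

lemma profile_Euler: "profile_dx q y = q * profile q y - y / 3 * profile' q y"
proof -
  let ?z = "- (y^3) / 9"
  have "- q * kummer_M (- q) (2/3) ?z + (- q) / (2/3) * ?z * kummer_M (1 - q) (5/3) ?z = - q * kummer_M (1 - q) (2/3) ?z"
    using kummer_M_raise_both[of "2/3" "- q" ?z] by (simp add: add.commute)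
  then have "q * kummer_M (1 - q) (2/3) ?z = q * kummer_M (- q) (2/3) ?z - y / 3 * (q / 2 * (y^2 * kummer_M (1 - q) (5/3) ?z))"
    by (simp add: algebra_simps power2_eq_square power3_eq_cube)
  then show ?thesis
    unfolding profile_def profile'_def profile_dx_def by (simp add: algebra_simps)
qed

lemma DERIV_profile'_ODE: "(profile' q has_real_derivative q * y * profile q y - y^2 / 3 * profile' q y) (at y)"
  by (rule DERIV_cong[OF DERIV_profile']) (simp add: profile_Euler algebra_simps power2_eq_square)

lemma profile_0: "profile q 0 = 1" and profile'_0: "profile' q 0 = profile_coeff q"
  by (auto simp: profile_def profile'_def)

lemma DERIV_tendsto_at_left:
  fixes f :: "real \<Rightarrow> real"
  assumes "(f has_real_derivative d) (at x)"
  shows "(f \<longlongrightarrow> f x) (at_left x)"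
  using DERIV_isCont[OF assms] by (simp add: isCont_def filterlim_at_split)

lemma continuous_on_profile:
  "continuous_on S (profile q)" "continuous_on S (profile' q)" "continuous_on S (profile_dx q)"
  unfolding profile_def[abs_def] profile'_def[abs_def] profile_dx_def[abs_def]
  by (intro continuous_intros continuous_on_kummer_M_cubic; simp)+

lemma kummer_M_cubic_at_top:
  assumes "a > -1" "b > 0"
  shows "((\<lambda>y. y powr (3 * a) * kummer_M a b (- (y^3) / 9)) \<longlongrightarrow> 9 powr a * (Gamma b * rGamma (b - a))) at_top"
proof -
  have "filterlim (\<lambda>y::real. y^3 / 9) at_top at_top" by real_asymp
  from tendsto_mult[OF tendsto_const filterlim_compose[OF kummer_M_asymptotic[OF assms] this]]
  have "((\<lambda>y. 9 powr a * ((y^3 / 9) powr a * kummer_M a b (- (y^3 / 9)))) \<longlongrightarrow> 9 powr a * (Gamma b * rGamma (b - a))) at_top"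
    .
  moreover have "\<forall>\<^sub>F y in at_top. 9 powr a * ((y^3 / 9) powr a * kummer_M a b (- (y^3 / 9))) = y powr (3 * a) * kummer_M a b (- (y^3) / 9)"
    using eventually_gt_at_top[of 0]
  proof eventually_elim
    case (elim y)
    then have "(y^3 / 9) powr a = y powr (3 * a) / 9 powr a"
      by (simp add: powr_divide powr_powr[symmetric] powr_numeral)
    then show ?case by simp
  qed
  ultimately show ?thesis by (rule Lim_transform_eventually)
qed

text \<open>The coefficient of \<open>y\<^sup>3\<^sup>q\<close> in the profile at \<open>+\<infinity>\<close>.\<close>

definition profile_Ap :: "real \<Rightarrow> real" where
  "profile_Ap q = 9 powr (- q) * (Gamma (2/3) * rGamma (2/3 + q))
     + profile_coeff q * (9 powr (1/3 - q) * (Gamma (4/3) * rGamma (1 + q)))"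

lemma profile_at_top:
  assumes q: "0 < q" "q < 1/3"
  shows "((\<lambda>y. profile q y / y powr (3 * q)) \<longlongrightarrow> profile_Ap q) at_top"
proof -
  have "((\<lambda>y. y powr (3 * (- q)) * kummer_M (- q) (2/3) (- (y^3) / 9)
        + profile_coeff q * (y powr (3 * (1/3 - q)) * kummer_M (1/3 - q) (4/3) (- (y^3) / 9)))
     \<longlongrightarrow> 9 powr (- q) * (Gamma (2/3) * rGamma (2/3 - (- q)))
     + profile_coeff q * (9 powr (1/3 - q) * (Gamma (4/3) * rGamma (4/3 - (1/3 - q))))) at_top"
    by (intro tendsto_intros kummer_M_cubic_at_top) (use q in auto)
  then have "((\<lambda>y. y powr (3 * (- q)) * kummer_M (- q) (2/3) (- (y^3) / 9)
        + profile_coeff q * (y powr (3 * (1/3 - q)) * kummer_M (1/3 - q) (4/3) (- (y^3) / 9)))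
     \<longlongrightarrow> profile_Ap q) at_top"
    by (simp add: profile_Ap_def)
  moreover have "\<forall>\<^sub>F y in at_top. y powr (3 * (- q)) * kummer_M (- q) (2/3) (- (y^3) / 9)
        + profile_coeff q * (y powr (3 * (1/3 - q)) * kummer_M (1/3 - q) (4/3) (- (y^3) / 9)) = profile q y / y powr (3 * q)"
    using eventually_gt_at_top[of 0]
  proof eventually_elim
    case (elim y)
    have 1: "y powr (3 * (1/3 - q)) = y * y powr (3 * (- q))"
      using elim by (simp add: algebra_simps powr_diff powr_minus_divide)
    show ?case unfolding 1 profile_def using elim by (simp add: powr_minus_divide field_simps)
  qed
  ultimately show ?thesis by (rule Lim_transform_eventually)
qed

lemma profile'_at_top:
  assumes q: "0 < q" "q < 1/3"
  shows "\<exists>L. ((\<lambda>y. y powr (1 - 3 * q) * profile' q y) \<longlongrightarrow> L) at_top"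
proof -
  have inv: "((\<lambda>y::real. inverse (y^3)) \<longlongrightarrow> 0) at_top" by real_asymp
  have "((\<lambda>y. q / 2 * (y powr (3 * (1 - q)) * kummer_M (1 - q) (5/3) (- (y^3) / 9))
     + profile_coeff q * (3 * q * (y powr (3 * (1/3 - q)) * kummer_M (1/3 - q) (4/3) (- (y^3) / 9))
        + (1 - 3 * q) * (inverse (y^3) * (y powr (3 * (4/3 - q)) * kummer_M (4/3 - q) (4/3) (- (y^3) / 9)))))
     \<longlongrightarrow> q / 2 * (9 powr (1 - q) * (Gamma (5/3) * rGamma (5/3 - (1 - q))))
     + profile_coeff q * (3 * q * (9 powr (1/3 - q) * (Gamma (4/3) * rGamma (4/3 - (1/3 - q))))
        + (1 - 3 * q) * (0 * (9 powr (4/3 - q) * (Gamma (4/3) * rGamma (4/3 - (4/3 - q))))))) at_top"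
    by (intro tendsto_intros kummer_M_cubic_at_top inv) (use q in auto)
  moreover have "\<forall>\<^sub>F y in at_top. q / 2 * (y powr (3 * (1 - q)) * kummer_M (1 - q) (5/3) (- (y^3) / 9))
     + profile_coeff q * (3 * q * (y powr (3 * (1/3 - q)) * kummer_M (1/3 - q) (4/3) (- (y^3) / 9))
        + (1 - 3 * q) * (inverse (y^3) * (y powr (3 * (4/3 - q)) * kummer_M (4/3 - q) (4/3) (- (y^3) / 9))))
     = y powr (1 - 3 * q) * profile' q y"
    using eventually_gt_at_top[of 0]
  proof eventually_elim
    case (elim y)
    have "y powr (3 * (1 - q)) = y powr (2 + (1 - 3 * q))" by (simp add: algebra_simps)
    also have "\<dots> = y^2 * y powr (1 - 3 * q)" using elim by (simp only: powr_add powr_numeral)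
    finally have 1: "y powr (3 * (1 - q)) = y^2 * y powr (1 - 3 * q)" .
    have 2: "y powr (3 * (1/3 - q)) = y powr (1 - 3 * q)" by (simp add: algebra_simps)
    have "y powr (3 * (4/3 - q)) = y powr (3 + (1 - 3 * q))" by (simp add: algebra_simps)
    also have "\<dots> = y^3 * y powr (1 - 3 * q)" using elim by (simp only: powr_add powr_numeral)
    finally have 3: "inverse (y^3) * (y powr (3 * (4/3 - q)) * x) = y powr (1 - 3 * q) * x" for x
      using elim by simp
    show ?case unfolding 1 2 3 profile'_def by (simp add: algebra_simps)
  qed
  ultimately show ?thesis by (blast intro: Lim_transform_eventually)
qed

lemma profile_dx_at_top:
  assumes q: "0 < q" "q < 1/3"
  shows "\<exists>L. ((\<lambda>y. y powr (3 - 3 * q) * profile_dx q y) \<longlongrightarrow> L) at_top"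
proof -
  have "((\<lambda>y. q * (y powr (3 * (1 - q)) * kummer_M (1 - q) (2/3) (- (y^3) / 9))
     - profile_coeff q * ((1/3 - q) * (y powr (3 * (4/3 - q)) * kummer_M (4/3 - q) (4/3) (- (y^3) / 9))))
     \<longlongrightarrow> q * (9 powr (1 - q) * (Gamma (2/3) * rGamma (2/3 - (1 - q))))
     - profile_coeff q * ((1/3 - q) * (9 powr (4/3 - q) * (Gamma (4/3) * rGamma (4/3 - (4/3 - q)))))) at_top"
    by (intro tendsto_intros kummer_M_cubic_at_top) (use q in auto)
  moreover have "\<forall>\<^sub>F y in at_top. q * (y powr (3 * (1 - q)) * kummer_M (1 - q) (2/3) (- (y^3) / 9))
     - profile_coeff q * ((1/3 - q) * (y powr (3 * (4/3 - q)) * kummer_M (4/3 - q) (4/3) (- (y^3) / 9)))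
     = y powr (3 - 3 * q) * profile_dx q y"
    using eventually_gt_at_top[of 0]
  proof eventually_elim
    case (elim y)
    have 1: "y powr (3 * (1 - q)) = y powr (3 - 3 * q)" by (simp add: algebra_simps)
    have "y powr (3 * (4/3 - q)) = y powr (1 + (3 - 3 * q))" by (simp add: algebra_simps)
    also have "\<dots> = y * y powr (3 - 3 * q)" using elim by (simp only: powr_add) simp
    finally have 2: "y powr (3 * (4/3 - q)) = y * y powr (3 - 3 * q)" .
    show ?case unfolding 1 2 profile_dx_def by (simp add: algebra_simps)
  qed
  ultimately show ?thesis by (blast intro: Lim_transform_eventually)
qed

lemma DERIV_tricomi_cubic:
  assumes "p > -1" "q \<le> 1" "y < 0"
  shows "((\<lambda>y. tricomi p q (- (y^3) / 9)) has_real_derivative q * tricomi p (q - 1) (- (y^3) / 9) * (- (y^2) / 3)) (at y)"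
proof -
  have "- (y^3) / 9 > 0" using assms(3) by simp
  then show ?thesis
    by (intro DERIV_chain2[OF DERIV_tricomi] assms) (auto intro!: derivative_eq_intros)
qed

lemma cubic_at_left_0: "filterlim (\<lambda>y::real. - (y^3) / 9) (at_right 0) (at_left 0)"
  by real_asymp

text \<open>For \<open>y < 0\<close> the Kummer functions have positive arguments and grow exponentially.  The coefficient of
  the second one is exactly the one for which the growth cancels: the combination is Tricomi's function.  The
  integral solves the same equation as the profile, by parts, and has the same value and the same slope at
  \<open>0\<close>, so the two agree by uniqueness.\<close>

lemma profile_neg:
  assumes q: "0 < q" "q < 1/3" and y: "y < 0"
  shows "profile q y = tricomi (- 2/3 - q) q (- (y^3) / 9) / Gamma (1/3)"
    and "profile' q y = - (y^2) / 3 * q * tricomi (- 2/3 - q) (q - 1) (- (y^3) / 9) / Gamma (1/3)"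
    and "profile_dx q y = q * tricomi (1/3 - q) (q - 1) (- (y^3) / 9) / Gamma (1/3)"
proof -
  let ?p = "- 2/3 - q"
  have p: "?p > -1" using q by simp
  define G where "G = Gamma (1/3 :: real)"
  have G: "G > 0" unfolding G_def by (rule Gamma_real_pos) simp
  define V where "V y = tricomi ?p q (- (y^3) / 9) / G" for y
  define V' where "V' y = - (y^2) / 3 * q * tricomi ?p (q - 1) (- (y^3) / 9) / G" for y
  have zpos: "- (y^3) / 9 > 0" if "y < 0" for y :: real
    using that by simp
  have V: "(V has_real_derivative V' y) (at y)" if "y < 0" for y
    unfolding V_def V'_def
    by (rule DERIV_cong[OF DERIV_cdivide[OF DERIV_tricomi_cubic]]) (use p q that in auto)
  have V': "(V' has_real_derivative q * y * V y - y^2 / 3 * V' y) (at y)" if y: "y < 0" for y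
  proof -
    let ?z = "- (y^3) / 9"
    have D: "(V' has_real_derivative ((- 2 * y / 3 * q) * tricomi ?p (q - 1) ?z
        + (q - 1) * tricomi ?p (q - 1 - 1) ?z * (- (y^2) / 3) * (- (y^2) / 3 * q)) / G) (at y)"
      unfolding V'_def
      by (rule DERIV_cdivide[OF DERIV_mult[OF _ DERIV_tricomi_cubic]])
        (use p q y in \<open>auto intro!: derivative_eq_intros\<close>)
    have 1: "tricomi (?p + 1) (q - 1) ?z = (?p + 1) * tricomi ?p (q - 1) ?z + (q - 1) * tricomi (?p + 1) (q - 1 - 1) ?z"
      by (rule tricomi_by_parts) (use p q zpos[OF y] in auto)
    have 2: "tricomi (?p + 1) (q - 1) ?z = tricomi ?p (q - 1 + 1) ?z - ?z * tricomi ?p (q - 1) ?z"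
      by (rule tricomi_raise_p) (use p q zpos[OF y] in auto)
    have 3: "tricomi (?p + 1) (q - 1 - 1) ?z = tricomi ?p (q - 1 - 1 + 1) ?z - ?z * tricomi ?p (q - 1 - 1) ?z"
      by (rule tricomi_raise_p) (use p q zpos[OF y] in auto)
    define a where "a = tricomi ?p q ?z"
    define b where "b = tricomi ?p (q - 1) ?z"
    define c where "c = tricomi ?p (q - 2) ?z"
    have s: "q - 1 + 1 = q" "q - 1 - 1 + 1 = q - 1" "q - 1 - 1 = q - 2" "?p + 1 = 1/3 - q" by simp_all
    have "a - ?z * b = (1/3 - q) * b + (q - 1) * (b - ?z * c)"
      using 1 2 3 unfolding s a_def b_def c_def by simp
    then have e: "(q - 1) * ?z * c = (?z - 2/3) * b - a" by (simp add: algebra_simps)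
    have "(- 2 * y / 3 * q) * b + (q - 1) * c * (- (y^2) / 3) * (- (y^2) / 3 * q)
       = (- 2 * y / 3 * q) * b - y * q * ((q - 1) * ?z * c)"
      by (simp add: power2_eq_square power3_eq_cube)
    also have "\<dots> = q * y * a - y^2 / 3 * (- (y^2) / 3 * q * b)"
      unfolding e by (simp add: power2_eq_square power3_eq_cube algebra_simps)
    finally have E: "(- 2 * y / 3 * q) * b + (q - 1) * c * (- (y^2) / 3) * (- (y^2) / 3 * q) = q * y * a - y^2 / 3 * (- (y^2) / 3 * q * b)" .
    have "((- 2 * y / 3 * q) * b + (q - 1) * c * (- (y^2) / 3) * (- (y^2) / 3 * q)) / G
       = q * y * (a / G) - y^2 / 3 * (- (y^2) / 3 * q * b / G)"
      unfolding E by (simp only: diff_divide_distrib times_divide_eq_right)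
    then show ?thesis
      using D unfolding V_def V'_def s a_def b_def c_def by simp
  qed
  \<comment> \<open>the value at \<open>0\<close>, squeezed between \<open>\<Gamma>(1/3)\<close> and \<open>\<Gamma>(1/3) + O(z\<^sup>q)\<close>\<close>
  have lim0: "(V \<longlongrightarrow> 1) (at_left 0)"
  proof -
    have "((\<lambda>z. tricomi ?p q z) \<longlongrightarrow> G) (at_right 0)"
    proof (rule tendsto_sandwich)
      have e: "?p + q + 1 = 1/3" by simp
      show "\<forall>\<^sub>F z in at_right 0. G \<le> tricomi ?p q z" "\<forall>\<^sub>F z in at_right 0. tricomi ?p q z \<le> z powr q * Gamma (?p + 1) + G"
        using tricomi_bounds_pos(2,3)[OF p, of _ q] q unfolding e G_def
        by (auto intro: eventually_at_right_less[THEN eventually_mono])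
      have "((\<lambda>z. z powr q) \<longlongrightarrow> 0) (at_right 0)" using q by real_asymp
      then have "((\<lambda>z. z powr q * Gamma (?p + 1) + G) \<longlongrightarrow> 0 * Gamma (?p + 1) + G) (at_right 0)"
        by (intro tendsto_intros)
      then show "((\<lambda>z. z powr q * Gamma (?p + 1) + G) \<longlongrightarrow> G) (at_right 0)" by simp
    qed simp
    from tendsto_divide[OF filterlim_compose[OF this cubic_at_left_0] tendsto_const, of G]
    show ?thesis unfolding V_def using G by simp
  qed
  \<comment> \<open>the slope at \<open>0\<close>: here \<open>y\<^sup>2 = (9 z)\<^sup>2\<^sup>/\<^sup>3\<close> meets the singularity \<open>z\<^sup>-\<^sup>2\<^sup>/\<^sup>3\<close> of the derivative in \<open>z\<close>\<close>
  have lim1: "(V' \<longlongrightarrow> profile_coeff q) (at_left 0)"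
  proof -
    have e: "- ?p - 1 - 2/3 = q - 1" by simp
    have "((\<lambda>z. z powr (2/3) * tricomi ?p (q - 1) z) \<longlongrightarrow> Beta (?p + 1) (2/3)) (at_right 0)"
      using tricomi_small[OF p, of "2/3"] unfolding e by simp
    from filterlim_compose[OF this cubic_at_left_0]
    have "((\<lambda>y. - (9 powr (2/3) * q / 3 / G) * ((- (y^3) / 9) powr (2/3) * tricomi ?p (q - 1) (- (y^3) / 9))) \<longlongrightarrow>
       - (9 powr (2/3) * q / 3 / G) * Beta (?p + 1) (2/3)) (at_left 0)"
      by (intro tendsto_intros)
    moreover have "\<forall>\<^sub>F y in at_left 0. - (9 powr (2/3) * q / 3 / G) * ((- (y^3) / 9) powr (2/3) * tricomi ?p (q - 1) (- (y^3) / 9)) = V' y"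
    proof -
      have "- (9 powr (2/3) * q / 3 / G) * ((- (y^3) / 9) powr (2/3) * tricomi ?p (q - 1) (- (y^3) / 9)) = V' y" if y: "y < 0" for y
      proof -
        have "(- (y^3)) powr (2/3) = ((- y) powr 3) powr (2/3)" using y by (simp add: powr_numeral)
        also have "\<dots> = (- y) powr 2" by (simp only: powr_powr) simp
        also have "\<dots> = y^2" using y by (simp add: powr_numeral)
        finally have r: "(- (y^3)) powr (2/3) = y^2" .
        have "(- (y^3) / 9) powr (2/3) = (- (y^3)) powr (2/3) / 9 powr (2/3)"
          by (rule powr_divide)
        then have "(- (y^3) / 9) powr (2/3) = y^2 / 9 powr (2/3)" unfolding r .
        then show ?thesis unfolding V'_def by simp
      qed
      then show ?thesis by (auto simp: eventually_at_left_field intro!: exI[of _ "-1"])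
    qed
    moreover have "- (9 powr (2/3) * q / 3 / G) * Beta (?p + 1) (2/3) = profile_coeff q"
    proof -
      have 1: "Gamma (1 - q) = - q * Gamma (- q)"
      proof -
        have "- q \<notin> \<int>\<^sub>\<le>\<^sub>0"
        proof
          assume "- q \<in> \<int>\<^sub>\<le>\<^sub>0"
          then obtain n where "- q = of_int n" by (auto elim: nonpos_Ints_cases)
          then have "-1 < real_of_int n" "real_of_int n < 0" using q by linarith+
          then show False by simp
        qed
        then show ?thesis using Gamma_plus1[of "- q"] by (simp add: add.commute)
      qed
      have g: "Gamma (- q) \<noteq> 0"
      proof -
        have "Gamma (1 - q) > 0" using q by (intro Gamma_real_pos) auto
        then show ?thesis using 1 by auto
      qed
      have 2: "Gamma (4/3 :: real) = 1/3 * G"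
        using Gamma_plus1[of "1/3 :: real"] nonpos_Ints_nonpos[of "1/3 :: real"] by (auto simp: G_def)
      have 3: "(9::real) powr (2/3) * 9 powr (1/3) = 9" by (simp add: powr_add[symmetric])
      then have t: "(9::real) powr (2/3) = 9 / 9 powr (1/3)" by (simp add: field_simps)
      have B: "Beta (?p + 1) (2/3) = Gamma (1/3 - q) * Gamma (2/3) / (- q * Gamma (- q))"
        unfolding Beta_def 1[symmetric] by simp
      show ?thesis
        unfolding profile_coeff_def 2 B t using g G q by (simp add: mult_ac)
    qed
    ultimately show ?thesis using Lim_transform_eventually by fastforce
  qed
  have eqV: "profile q y = V y" if y: "y < 0" for y
  proof -
    have "(profile q \<longlongrightarrow> 1) (at_left 0)" "(profile' q \<longlongrightarrow> profile_coeff q) (at_left 0)"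
      using DERIV_tendsto_at_left[OF DERIV_profile, of q 0] DERIV_tendsto_at_left[OF DERIV_profile', of q 0]
      by (simp_all add: profile_0 profile'_0)
    note lims = tendsto_diff[OF this(1) lim0] tendsto_diff[OF this(2) lim1]
    have "profile q y - V y = 0"
    proof (rule profile_ODE_unique[where ?x0.0="y - 1" and ?x1.0=0 and q=q and D="\<lambda>y. profile q y - V y" and D'="\<lambda>y. profile' q y - V' y"])
      show "((\<lambda>y. profile q y - V y) has_real_derivative profile' q x - V' x) (at x)" if "x < 0" for x
        by (intro DERIV_diff DERIV_profile V that)
      show "((\<lambda>y. profile' q y - V' y) has_real_derivative q * x * (profile q x - V x) - x^2 / 3 * (profile' q x - V' x)) (at x)" if "x < 0" for x
        by (rule DERIV_cong[OF DERIV_diff[OF DERIV_profile'_ODE V'[OF that]]]) (simp add: field_simps)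
    qed (use y lims in auto)
    then show ?thesis by simp
  qed
  show 1: "profile q y = tricomi ?p q (- (y^3) / 9) / Gamma (1/3)" using eqV[OF y] by (simp add: V_def G_def)
  have "(profile q has_real_derivative V' y) (at y)"
  proof (rule has_field_derivative_transform_within_open[OF V[OF y]])
    show "V x = profile q x" if "x \<in> {..<0}" for x using eqV that by simp
  qed (use y in auto)
  from DERIV_unique[OF DERIV_profile this]
  show 2: "profile' q y = - (y^2) / 3 * q * tricomi ?p (q - 1) (- (y^3) / 9) / Gamma (1/3)"
    by (simp add: V'_def G_def)
  have "tricomi (?p + 1) (q - 1) (- (y^3) / 9) = tricomi ?p (q - 1 + 1) (- (y^3) / 9) - (- (y^3) / 9) * tricomi ?p (q - 1) (- (y^3) / 9)"
    by (rule tricomi_raise_p) (use p q zpos[OF y] in auto)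
  then have 3: "tricomi (1/3 - q) (q - 1) (- (y^3) / 9) = tricomi ?p q (- (y^3) / 9) + y^3 / 9 * tricomi ?p (q - 1) (- (y^3) / 9)"
    by simp
  show "profile_dx q y = q * tricomi (1/3 - q) (q - 1) (- (y^3) / 9) / Gamma (1/3)"
  proof -
    have "q * (a / g) - y / 3 * (- (y^2) / 3 * q * b / g) = q * (a + y^3 / 9 * b) / g" if "g > 0" for a b g :: real
      using that by (simp add: field_simps power2_eq_square power3_eq_cube)
    from this[OF G] show ?thesis unfolding profile_Euler 1 2 3 G_def .
  qed
qed

section \<open>Growth and positivity of the profile\<close>

text \<open>A continuous function with controlled behaviour at both ends is controlled everywhere, by compactness of
  the middle part.  The control is a limit at \<open>+\<infinity>\<close>, where Kummer asymptotics apply, and a bound at \<open>-\<infinity>\<close>,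
  where the integral does.\<close>

lemma power_bound_of_limits:
  fixes f :: "real \<Rightarrow> real"
  assumes cont: "continuous_on UNIV f"
    and top: "((\<lambda>y. y powr (- e) * f y) \<longlongrightarrow> L) at_top"
    and bot: "\<forall>\<^sub>F y in at_top. \<bar>f (- y)\<bar> \<le> B * y powr e"
  shows "\<exists>C>0. \<forall>y. \<bar>f y\<bar> \<le> C * max 1 \<bar>y\<bar> powr e"
proof -
  have "\<forall>\<^sub>F y in at_top. \<bar>y powr (- e) * f y\<bar> < \<bar>L\<bar> + 1"
    using order_tendstoD(2)[OF tendsto_rabs[OF top], of "\<bar>L\<bar> + 1"] by simp
  with bot have "\<forall>\<^sub>F y in at_top. 1 \<le> y \<and> \<bar>y powr (- e) * f y\<bar> < \<bar>L\<bar> + 1 \<and> \<bar>f (- y)\<bar> \<le> B * y powr e"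
    using eventually_ge_at_top[of 1] by eventually_elim auto
  then obtain N where N: "\<And>y. y \<ge> N \<Longrightarrow> 1 \<le> y \<and> \<bar>y powr (- e) * f y\<bar> < \<bar>L\<bar> + 1 \<and> \<bar>f (- y)\<bar> \<le> B * y powr e"
    by (auto simp: eventually_at_top_linorder)
  have N1: "N \<ge> 1" using N[of N] by simp
  have "compact ((\<lambda>y. f y / max 1 \<bar>y\<bar> powr e) ` {- N..N})"
    by (intro compact_continuous_image continuous_intros continuous_on_subset[OF cont])
       (auto simp: max_def)
  from compact_imp_bounded[OF this] obtain K
    where K0: "\<And>x. x \<in> (\<lambda>y. f y / max 1 \<bar>y\<bar> powr e) ` {- N..N} \<Longrightarrow> norm x \<le> K"
    unfolding bounded_iff by blast
  have K: "\<bar>f y / max 1 \<bar>y\<bar> powr e\<bar> \<le> K" if "\<bar>y\<bar> \<le> N" for y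
  proof -
    have "y \<in> {- N..N}" using that by auto
    from K0[OF imageI[OF this]] show ?thesis by simp
  qed
  define C where "C = max 1 (max K (max (\<bar>L\<bar> + 1) B))"
  have C: "C \<ge> K" "C \<ge> \<bar>L\<bar> + 1" "C \<ge> B" "C > 0" by (auto simp: C_def)
  have "\<bar>f y\<bar> \<le> C * max 1 \<bar>y\<bar> powr e" for y
  proof -
    consider "\<bar>y\<bar> \<le> N" | "y > N" | "- y > N" by linarith
    then show ?thesis
    proof cases
      case 1
      have m: "max 1 \<bar>y\<bar> powr e > 0" by (auto simp: max_def)
      have "\<bar>f y\<bar> / max 1 \<bar>y\<bar> powr e \<le> C"
        using K[OF 1] C(1) m by (simp add: abs_divide)
      then show ?thesis using m by (simp add: field_simps)
    next
      case 2
      then have y: "1 \<le> y" "\<bar>y powr (- e) * f y\<bar> \<le> C" using N[of y] C(2) by auto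
      then have "\<bar>f y\<bar> = y powr e * \<bar>y powr (- e) * f y\<bar>"
        by (simp add: abs_mult powr_minus field_simps)
      also have "\<dots> \<le> y powr e * C" using y by (intro mult_left_mono) auto
      finally show ?thesis using y by (simp add: max_def mult.commute)
    next
      case 3
      then have y: "1 \<le> - y" "\<bar>f y\<bar> \<le> B * (- y) powr e" using N[of "- y"] by auto
      have "B * (- y) powr e \<le> C * (- y) powr e" using C by (intro mult_right_mono) auto
      moreover have m: "max 1 \<bar>y\<bar> = - y" using y by (auto simp: max_def)
      ultimately show ?thesis unfolding m using y(2) by linarith
    qed
  qed
  with C show ?thesis by blast
qed

lemma rGamma_reflection_real: "rGamma x * rGamma (1 - x) = sin (pi * x) / (pi :: real)"
proof -
  have 1: "1 - complex_of_real x = complex_of_real (1 - x)" by simp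
  have 2: "complex_of_real pi * complex_of_real x = complex_of_real (pi * x)" by simp
  have "rGamma (complex_of_real x) * rGamma (1 - complex_of_real x)
      = sin (complex_of_real pi * complex_of_real x) / complex_of_real pi"
    by (rule rGamma_reflection_complex)
  then have "complex_of_real (rGamma x * rGamma (1 - x)) = complex_of_real (sin (pi * x) / pi)"
    unfolding 1 2 rGamma_complex_of_real sin_of_real by (simp only: of_real_mult of_real_divide)
  then show ?thesis by (simp only: of_real_eq_iff)
qed

text \<open>The coefficient of \<open>\<bar>y\<bar>\<^sup>3\<^sup>q\<close> in the profile at \<open>-\<infinity>\<close>.\<close>

definition profile_Am :: "real \<Rightarrow> real" where
  "profile_Am q = 9 powr (- q) * (Gamma (1/3 - q) / Gamma (1/3))"

lemma profile_Am_pos: "q < 1/3 \<Longrightarrow> profile_Am q > 0"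
  unfolding profile_Am_def by (intro mult_pos_pos divide_pos_pos Gamma_real_pos) auto

text \<open>The reason for the equation that defines the exponent.  By the reflection formula for \<open>\<Gamma>\<close>, the ratio of the
  two coefficients is the quotient of \<open>sin (\<pi>/3 - \<pi> q) - sin (\<pi> q)\<close> by \<open>sin (\<pi>/3)\<close>, which is
  \<open>2 cos (\<pi> (q + 1/3))\<close>.  The boundary condition asks for this ratio to be \<open>\<alpha> b\<^sup>3\<^sup>q\<close>.\<close>

lemma profile_Ap_eq:
  assumes q: "0 < q" "q < 1/3"
  shows "profile_Ap q = 2 * cos (pi * (q + 1/3)) * profile_Am q"
proof -
  define g where "g = Gamma (1/3 - q)"
  define h where "h = Gamma (2/3 :: real)"
  have g: "g > 0" unfolding g_def using q by (intro Gamma_real_pos) auto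
  have G: "Gamma (1/3 :: real) > 0" "Gamma (4/3 :: real) > 0" by (auto intro: Gamma_real_pos)
  have 1: "rGamma (2/3 + q) = g * (sin (pi * (1/3 - q)) / pi)"
  proof -
    have "1 - (1/3 - q) = 2/3 + q" by simp
    then have "sin (pi * (1/3 - q)) / pi = rGamma (1/3 - q) * rGamma (2/3 + q)"
      using rGamma_reflection_real[of "1/3 - q"] by simp
    then show ?thesis using g unfolding g_def Gamma_def by (simp add: field_simps)
  qed
  have 2: "rGamma (1 + q) / Gamma (- q) = - (sin (pi * q) / pi)"
    using rGamma_reflection_real[of "- q"] by (simp add: Gamma_def field_simps)
  have 3: "1 / Gamma (1/3) = h * (sin (pi / 3) / pi)"
    using rGamma_reflection_real[of "1/3"] Gamma_real_pos[of "2/3"] unfolding h_def Gamma_def by (simp add: field_simps)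
  have c: "profile_coeff q * (9 powr (1/3 - q) * (Gamma (4/3) * rGamma (1 + q)))
     = 9 powr (- q) * (h * g * (rGamma (1 + q) / Gamma (- q)))"
  proof -
    have "9 powr (1/3 - q) = 9 powr (- q) * 9 powr (1/3 :: real)"
      by (simp add: powr_add[symmetric])
    then show ?thesis unfolding profile_coeff_def g_def[symmetric] h_def[symmetric] using less_imp_neq[OF G(2)]
      by (simp add: field_simps)
  qed
  have trig: "sin (pi * (1/3 - q)) - sin (pi * q) = 2 * cos (pi * (q + 1/3)) * sin (pi / 3)"
  proof -
    have a: "pi * (1/3 - q) = pi / 3 - pi * q" "pi * (q + 1/3) = pi * q + pi / 3" by (simp_all add: algebra_simps)
    have "r / 2 * c - 1 / 2 * s - s = 2 * (c * (1 / 2) - s * (r / 2)) * (r / 2)" if "r * r = 3" for r c s :: real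
    proof -
      have "s * (r * r) = s * 3" using that by simp
      then show ?thesis by (simp add: field_simps)
    qed
    from this[of "sqrt 3" "cos (pi * q)" "sin (pi * q)"]
    show ?thesis unfolding a sin_diff cos_add sin_60 cos_60 by simp
  qed
  have "profile_Ap q = 9 powr (- q) * (h * g * ((sin (pi * (1/3 - q)) - sin (pi * q)) / pi))"
    unfolding profile_Ap_def c 1 2 h_def[symmetric] by (simp add: diff_divide_distrib algebra_simps)
  also have "\<dots> = 2 * cos (pi * (q + 1/3)) * (9 powr (- q) * (g * (1 / Gamma (1/3))))"
    unfolding trig 3 by (simp add: field_simps)
  finally show ?thesis unfolding profile_Am_def g_def by simp
qed

lemma cube_div_9_powr:
  fixes y a :: real
  assumes "y > 0"
  shows "(y^3 / 9) powr a = y powr (3 * a) * 9 powr (- a)"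
proof -
  have "(y^3 / 9) powr a = (y^3) powr a / 9 powr a" by (rule powr_divide)
  also have "(y^3) powr a = y powr (3 * a)" using powr_powr[of y 3 a] assms by (simp add: powr_numeral)
  finally show ?thesis by (simp add: powr_minus_divide)
qed

lemma profile_at_bot:
  assumes q: "0 < q" "q < 1/3"
  shows "((\<lambda>y. profile q (- y) / y powr (3 * q)) \<longlongrightarrow> profile_Am q) at_top"
proof (rule tendsto_sandwich)
  have p: "- 2/3 - q > -1" using q by simp
  define g where "g = Gamma (1/3 :: real)"
  have G: "g > 0" unfolding g_def by (intro Gamma_real_pos) auto
  have b: "profile_Am q \<le> profile q (- y) / y powr (3 * q) \<and> profile q (- y) / y powr (3 * q) \<le> profile_Am q + y powr (- (3 * q))"
    if y: "y > 0" for y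
  proof -
    have z: "y^3 / 9 > 0" using y by simp
    have e: "(y^3 / 9) powr q = y powr (3 * q) * 9 powr (- q)"
      by (rule cube_div_9_powr[OF y])
    have s: "- 2/3 - q + q + 1 = 1/3" "- 2/3 - q + 1 = 1/3 - q" by simp_all
    have P: "profile q (- y) = tricomi (- 2/3 - q) q (y^3 / 9) / g"
      using profile_neg(1)[OF q, of "- y"] y by (simp add: g_def)
    have m: "y powr (3 * q) > 0" using y by simp
    have "y powr (3 * q) * profile_Am q \<le> profile q (- y)"
      using tricomi_bounds_pos(1)[OF p z, of q] q G unfolding e s P profile_Am_def g_def[symmetric] by (simp add: field_simps)
    moreover have "profile q (- y) \<le> y powr (3 * q) * profile_Am q + 1"
      using tricomi_bounds_pos(3)[OF p z, of q] q G unfolding e s P profile_Am_def g_def[symmetric] by (simp add: field_simps)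
    ultimately show ?thesis using m by (simp add: powr_minus field_simps)
  qed
  show "\<forall>\<^sub>F y in at_top. profile_Am q \<le> profile q (- y) / y powr (3 * q)"
    "\<forall>\<^sub>F y in at_top. profile q (- y) / y powr (3 * q) \<le> profile_Am q + y powr (- (3 * q))"
    using b by (auto intro: eventually_mono[OF eventually_gt_at_top[of 0]])
  have "((\<lambda>y. y powr (- (3 * q))) \<longlongrightarrow> 0) at_top" using q by real_asymp
  from tendsto_add[OF tendsto_const this] show "((\<lambda>y. profile_Am q + y powr (- (3 * q))) \<longlongrightarrow> profile_Am q) at_top"
    by simp
qed simp

text \<open>For \<open>y < 0\<close> the integrand is positive.  For \<open>y \<ge> 0\<close> the profile starts at \<open>1\<close> and is positive near
  \<open>+\<infinity>\<close>, so a nonpositive value forces an interior minimum with \<open>w \<le> 0\<close> and \<open>w' = 0\<close>.  If \<open>w < 0\<close> there, then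
  \<open>w'' = q y w < 0\<close>, which is impossible at a minimum; if \<open>w = 0\<close> there, uniqueness carries \<open>w = 0\<close> back to
  \<open>y = 0\<close>.\<close>

lemma profile_pos:
  assumes q: "0 < q" "q < 1/3" and cos: "cos (pi * (q + 1/3)) > 0"
  shows "profile q y > 0"
proof (cases "y < 0")
  case True
  have z: "- (y^3) / 9 > 0" using True by simp
  have G: "Gamma (1/3 :: real) > 0" by (intro Gamma_real_pos) auto
  have "Gamma (- 2/3 - q + q + 1) \<le> tricomi (- 2/3 - q) q (- (y^3) / 9)"
    by (rule tricomi_bounds_pos(2)[OF _ z]) (use q in auto)
  moreover have "- 2/3 - q + q + 1 = 1/3" by simp
  ultimately have "tricomi (- 2/3 - q) q (- (y^3) / 9) > 0" using less_le_trans[OF G] by metis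
  with G show ?thesis using profile_neg(1)[OF q True] by simp
next
  case False
  show ?thesis
  proof (rule ccontr)
    assume neg: "\<not> profile q y > 0"
    have "profile_Ap q > 0" unfolding profile_Ap_eq[OF q] using cos profile_Am_pos[OF q(2)] by simp
    then have "\<forall>\<^sub>F y in at_top. profile q y / y powr (3 * q) > 0"
      using order_tendstoD(1)[OF profile_at_top[OF q]] by simp
    then have "\<forall>\<^sub>F y in at_top. profile q y > 0"
      by eventually_elim (simp add: zero_less_divide_iff)
    then obtain N0 where N0: "\<And>x. x \<ge> N0 \<Longrightarrow> profile q x > 0"
      by (auto simp: eventually_at_top_linorder)
    define N where "N = max N0 0"
    have N: "N \<ge> 0" "\<And>x. x \<ge> N \<Longrightarrow> profile q x > 0" using N0 by (auto simp: N_def)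
    have yN: "y < N" using N(2)[of y] neg by linarith
    have "\<exists>m\<in>{0..N}. \<forall>x\<in>{0..N}. profile q m \<le> profile q x"
      by (rule continuous_attains_inf) (use N continuous_on_profile(1) in auto)
    then obtain m where m: "0 \<le> m" "m \<le> N" and min: "\<And>x. 0 \<le> x \<Longrightarrow> x \<le> N \<Longrightarrow> profile q m \<le> profile q x"
      by auto
    have m0: "profile q m \<le> 0" using min[of y] False yN neg by simp
    then have "m \<noteq> 0" "m \<noteq> N" using profile_0[of q] N(2)[of N] by auto
    with m have m: "0 < m" "m < N" by auto
    have d0: "profile' q m = 0"
    proof (rule DERIV_local_min[OF DERIV_profile])
      show "0 < min m (N - m)" using m by simp
      show "\<forall>x. \<bar>m - x\<bar> < min m (N - m) \<longrightarrow> profile q m \<le> profile q x"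
        using min by (auto simp: abs_less_iff)
    qed
    show False
    proof (cases "profile q m = 0")
      case True
      have "(profile q \<longlongrightarrow> 0) (at_left m)" "(profile' q \<longlongrightarrow> 0) (at_left m)"
        using DERIV_tendsto_at_left[OF DERIV_profile, of q m] DERIV_tendsto_at_left[OF DERIV_profile', of q m] True d0
        by simp_all
      then have "profile q 0 = 0"
        using m by (intro profile_ODE_unique[OF _ DERIV_profile DERIV_profile'_ODE, of "-1" m]) auto
      then show False by (simp add: profile_0)
    next
      case False
      have "q * m * profile q m - m^2 / 3 * profile' q m < 0"
        unfolding d0 using False m0 m q by (simp add: mult_pos_neg)
      from DERIV_neg_dec_right[OF DERIV_profile'_ODE this]
      obtain d where d: "d > 0" "\<And>h. h > 0 \<Longrightarrow> h < d \<Longrightarrow> profile' q (m + h) < 0" using d0 by auto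
      define h where "h = min (d / 2) (N - m)"
      have h: "h > 0" "h < d" "m + h \<le> N" using d m by (auto simp: h_def)
      have "profile q (m + h) < profile q m"
      proof (rule DERIV_neg_imp_decreasing_open[where a=m and b="m + h" and f="profile q"])
        fix x assume "m < x" "x < m + h"
        then show "\<exists>y. (profile q has_real_derivative y) (at x) \<and> y < 0"
          using d(2)[of "x - m"] h DERIV_profile[of q x] by auto
      qed (use h continuous_on_profile(1) in auto)
      with min[of "m + h"] h m show False by simp
    qed
  qed
qed

text \<open>What the rest of the argument uses about the profile \<open>w\<close> of the self-similar function
  \<open>x\<^sup>l\<^sup>/\<^sup>3 w (v / x\<^sup>1\<^sup>/\<^sup>3)\<close>: the equation, split as \<open>w'' = y u\<close> with \<open>3 u = l w - y w'\<close>, and the size of \<open>w\<close>,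
  \<open>w'\<close>, \<open>u\<close> at infinity, which drops by one power with a derivative in \<open>v\<close> and by three powers with one in \<open>x\<close>.\<close>

locale kinetic_profile =
  fixes l Ap Am :: real and w w' u :: "real \<Rightarrow> real"
  assumes l: "0 < l" "l < 1"
    and deriv_w: "\<And>y. (w has_real_derivative w' y) (at y)"
    and deriv_w': "\<And>y. (w' has_real_derivative y * u y) (at y)"
    and cont_u: "continuous_on UNIV u"
    and Euler: "\<And>y. 3 * u y = l * w y - y * w' y"
    and w_lower: "\<exists>c>0. \<forall>y. c * max 1 \<bar>y\<bar> powr l \<le> w y"
    and w_upper: "\<exists>c>0. \<forall>y. w y \<le> c * max 1 \<bar>y\<bar> powr l"
    and w'_bound: "\<exists>c>0. \<forall>y. \<bar>w' y\<bar> \<le> c * max 1 \<bar>y\<bar> powr (l - 1)"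
    and u_bound: "\<exists>c>0. \<forall>y. \<bar>u y\<bar> \<le> c * max 1 \<bar>y\<bar> powr (l - 3)"
    and w_at_top: "((\<lambda>y. w y / y powr l) \<longlongrightarrow> Ap) at_top"
    and w_at_bot: "((\<lambda>y. w (- y) / y powr l) \<longlongrightarrow> Am) at_top"

lemma kinetic_profile_Kummer:
  assumes q: "0 < q" "q < 1/3" and cos: "cos (pi * (q + 1/3)) > 0"
  shows "kinetic_profile (3 * q) (profile_Ap q) (profile_Am q) (profile q) (profile' q) (profile_dx q)"
proof
  have p: "- 2/3 - q > -1" "1/3 - q > -1" using q by auto
  have G: "Gamma (1/3 :: real) > 0" by (intro Gamma_real_pos) auto
  have Ap: "profile_Ap q > 0" unfolding profile_Ap_eq[OF q] using cos profile_Am_pos[OF q(2)] by simp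
  note pos = profile_pos[OF q cos]
  show "0 < 3 * q" "3 * q < 1" using q by auto
  show "(profile q has_real_derivative profile' q y) (at y)" for y by (rule DERIV_profile)
  show "(profile' q has_real_derivative y * profile_dx q y) (at y)" for y by (rule DERIV_profile')
  show "continuous_on UNIV (profile_dx q)" by (rule continuous_on_profile(3))
  show "3 * profile_dx q y = 3 * q * profile q y - y * profile' q y" for y by (simp add: profile_Euler)
  show lt: "((\<lambda>y. profile q y / y powr (3 * q)) \<longlongrightarrow> profile_Ap q) at_top" by (rule profile_at_top[OF q])
  show lb: "((\<lambda>y. profile q (- y) / y powr (3 * q)) \<longlongrightarrow> profile_Am q) at_top" by (rule profile_at_bot[OF q])
  have "\<exists>c>0. \<forall>y. \<bar>profile q y\<bar> \<le> c * max 1 \<bar>y\<bar> powr (3 * q)"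
  proof (rule power_bound_of_limits[OF continuous_on_profile(1)])
    show "((\<lambda>y. y powr (- (3 * q)) * profile q y) \<longlongrightarrow> profile_Ap q) at_top"
      using lt by (simp add: powr_minus field_simps)
    have "\<forall>\<^sub>F y in at_top. profile q (- y) / y powr (3 * q) < profile_Am q + 1"
      using order_tendstoD(2)[OF lb] by simp
    then show "\<forall>\<^sub>F y in at_top. \<bar>profile q (- y)\<bar> \<le> (profile_Am q + 1) * y powr (3 * q)"
      using eventually_gt_at_top[of 0]
      by eventually_elim (use pos in \<open>simp add: field_simps abs_of_pos\<close>)
  qed
  then show "\<exists>c>0. \<forall>y. profile q y \<le> c * max 1 \<bar>y\<bar> powr (3 * q)"
    using pos by (simp add: abs_of_pos)
  have "\<exists>c>0. \<forall>y. \<bar>1 / profile q y\<bar> \<le> c * max 1 \<bar>y\<bar> powr (- (3 * q))"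
  proof (rule power_bound_of_limits)
    show "continuous_on UNIV (\<lambda>y. 1 / profile q y)"
      using pos by (intro continuous_intros continuous_on_profile(1)) (metis less_irrefl)
    have "((\<lambda>y. 1 / (profile q y / y powr (3 * q))) \<longlongrightarrow> 1 / profile_Ap q) at_top"
      using Ap by (intro tendsto_intros lt) auto
    then show "((\<lambda>y. y powr (- (- (3 * q))) * (1 / profile q y)) \<longlongrightarrow> 1 / profile_Ap q) at_top" by simp
    have "\<forall>\<^sub>F y in at_top. profile_Am q / 2 < profile q (- y) / y powr (3 * q)"
      by (rule order_tendstoD(1)[OF lb]) (use profile_Am_pos[OF q(2)] in simp)
    then show "\<forall>\<^sub>F y in at_top. \<bar>1 / profile q (- y)\<bar> \<le> (2 / profile_Am q) * y powr (- (3 * q))"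
      using eventually_gt_at_top[of 0]
      by eventually_elim
        (use pos profile_Am_pos[OF q(2)] in \<open>simp add: field_simps abs_of_pos powr_minus\<close>)
  qed
  then obtain c where c: "c > 0" "\<And>y. \<bar>1 / profile q y\<bar> \<le> c * max 1 \<bar>y\<bar> powr (- (3 * q))" by blast
  have "1 / c * max 1 \<bar>y\<bar> powr (3 * q) \<le> profile q y" for y
  proof -
    have m: "max 1 \<bar>y\<bar> powr (3 * q) > 0" by (auto simp: max_def)
    show ?thesis using c(2)[of y] c(1) pos[of y] m by (simp add: powr_minus field_simps abs_of_pos)
  qed
  then show "\<exists>c>0. \<forall>y. c * max 1 \<bar>y\<bar> powr (3 * q) \<le> profile q y"
    using c(1) by (intro exI[of _ "1 / c"]) auto
  obtain L where L: "((\<lambda>y. y powr (1 - 3 * q) * profile' q y) \<longlongrightarrow> L) at_top"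
    using profile'_at_top[OF q] by blast
  show "\<exists>c>0. \<forall>y. \<bar>profile' q y\<bar> \<le> c * max 1 \<bar>y\<bar> powr (3 * q - 1)"
  proof (rule power_bound_of_limits[OF continuous_on_profile(2)])
    show "((\<lambda>y. y powr (- (3 * q - 1)) * profile' q y) \<longlongrightarrow> L) at_top" using L by simp
    show "\<forall>\<^sub>F y in at_top. \<bar>profile' q (- y)\<bar> \<le> (q / 3 * 9 powr (1 - q) * Gamma (1/3 - q) / Gamma (1/3)) * y powr (3 * q - 1)"
      using eventually_gt_at_top[of 0]
    proof eventually_elim
      case (elim y)
      have z: "y^3 / 9 > 0" using elim by simp
      have e: "(y^3 / 9) powr (q - 1) * y^2 = y powr (3 * q - 1) * 9 powr (1 - q)"
      proof -
        have "(y^3 / 9) powr (q - 1) = y powr (3 * (q - 1)) * 9 powr (1 - q)"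
          using cube_div_9_powr[OF elim, of "q - 1"] by simp
        moreover have "y powr (3 * (q - 1)) * y^2 = y powr (3 * (q - 1) + 2)"
          using elim by (simp only: powr_add powr_numeral)
        moreover have "3 * (q - 1) + 2 = 3 * q - 1" by simp
        ultimately show ?thesis by (simp add: mult_ac)
      qed
      have J: "tricomi (- 2/3 - q) (q - 1) (y^3 / 9) \<le> (y^3 / 9) powr (q - 1) * Gamma (1/3 - q)"
        using tricomi_le_neg[OF p(1) z, of "q - 1"] q by simp
      have "\<bar>profile' q (- y)\<bar> = y^2 / 3 * q * tricomi (- 2/3 - q) (q - 1) (y^3 / 9) / Gamma (1/3)"
        using profile_neg(2)[OF q, of "- y"] elim q G tricomi_nonneg by (simp add: abs_mult)
      also have "\<dots> \<le> y^2 / 3 * q * ((y^3 / 9) powr (q - 1) * Gamma (1/3 - q)) / Gamma (1/3)"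
        using q G J by (intro divide_right_mono mult_left_mono) auto
      also have "\<dots> = (q / 3 * Gamma (1/3 - q) / Gamma (1/3)) * ((y^3 / 9) powr (q - 1) * y^2)" by simp
      finally show ?case unfolding e by (simp add: mult_ac)
    qed
  qed
  obtain L where L: "((\<lambda>y. y powr (3 - 3 * q) * profile_dx q y) \<longlongrightarrow> L) at_top"
    using profile_dx_at_top[OF q] by blast
  show "\<exists>c>0. \<forall>y. \<bar>profile_dx q y\<bar> \<le> c * max 1 \<bar>y\<bar> powr (3 * q - 3)"
  proof (rule power_bound_of_limits[OF continuous_on_profile(3)])
    show "((\<lambda>y. y powr (- (3 * q - 3)) * profile_dx q y) \<longlongrightarrow> L) at_top" using L by simp
    show "\<forall>\<^sub>F y in at_top. \<bar>profile_dx q (- y)\<bar> \<le> (q * Gamma (4/3 - q) / Gamma (1/3) * 9 powr (1 - q)) * y powr (3 * q - 3)"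
      using eventually_gt_at_top[of 0]
    proof eventually_elim
      case (elim y)
      have z: "y^3 / 9 > 0" using elim by simp
      have e: "(y^3 / 9) powr (q - 1) = y powr (3 * q - 3) * 9 powr (1 - q)"
        using cube_div_9_powr[OF elim, of "q - 1"] by (simp add: algebra_simps)
      have J: "tricomi (1/3 - q) (q - 1) (y^3 / 9) \<le> (y^3 / 9) powr (q - 1) * Gamma (4/3 - q)"
        using tricomi_le_neg[OF p(2) z, of "q - 1"] q by simp
      have "\<bar>profile_dx q (- y)\<bar> = q * tricomi (1/3 - q) (q - 1) (y^3 / 9) / Gamma (1/3)"
        using profile_neg(3)[OF q, of "- y"] elim q G tricomi_nonneg by (simp add: abs_mult)
      also have "\<dots> \<le> q * ((y^3 / 9) powr (q - 1) * Gamma (4/3 - q)) / Gamma (1/3)"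
        using q G J by (intro divide_right_mono mult_left_mono) auto
      finally show ?case unfolding e by (simp add: mult_ac)
    qed
  qed
qed

section \<open>The homogeneous solution\<close>

text \<open>Comparable to the kinetic distance to the origin at time zero, and homogeneous of degree one under
  \<open>(x, v) \<mapsto> (r\<^sup>3 x, r v)\<close>.\<close>

definition kin_norm :: "real \<times> real \<Rightarrow> real" where
  "kin_norm z = max (\<bar>fst z\<bar> powr (1/3)) \<bar>snd z\<bar>"

lemma kin_norm_scaling:
  assumes "x > 0"
  shows "kin_norm (x, v) = x powr (1/3) * max 1 \<bar>v / x powr (1/3)\<bar>"
proof -
  have "x powr (1/3) * max 1 \<bar>v / x powr (1/3)\<bar> = max (x powr (1/3) * 1) (x powr (1/3) * \<bar>v / x powr (1/3)\<bar>)"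
    using assms by (simp add: max_mult_distrib_left)
  also have "\<dots> = kin_norm (x, v)"
    using assms by (simp add: kin_norm_def abs_divide)
  finally show ?thesis by simp
qed

lemma kin_norm_powr:
  assumes "x > 0"
  shows "kin_norm (x, v) powr e = x powr (e / 3) * max 1 \<bar>v / x powr (1/3)\<bar> powr e"
  unfolding kin_norm_scaling[OF assms] using assms by (simp add: powr_mult powr_powr)

text \<open>Power bounds for a profile are bounds by the kinetic norm for the homogeneous function that it generates.\<close>

lemma scaled_le_kin_norm:
  assumes x: "x > 0" and g: "\<And>y. g y \<le> c * max 1 \<bar>y\<bar> powr e"
  shows "x powr (e / 3) * g (v / x powr (1/3)) \<le> c * kin_norm (x, v) powr e"
proof -
  have "x powr (e / 3) * g (v / x powr (1/3)) \<le> x powr (e / 3) * (c * max 1 \<bar>v / x powr (1/3)\<bar> powr e)"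
    by (rule mult_left_mono[OF g]) simp
  then show ?thesis unfolding kin_norm_powr[OF x] by (simp add: mult_ac)
qed

context kinetic_profile
begin

text \<open>The boundary values on \<open>x = 0\<close> are the limits of the profile at \<open>\<plusminus>\<infinity>\<close>; the half-plane
  \<open>x < 0\<close> lies outside the problem.\<close>

definition sol :: "real \<times> real \<Rightarrow> real" where
  "sol z = (if fst z > 0 then fst z powr (l / 3) * w (snd z / fst z powr (1/3))
     else if snd z > 0 then Ap * snd z powr l else Am * (- snd z) powr l)"

definition sol_v :: "real \<times> real \<Rightarrow> real" where
  "sol_v z = fst z powr ((l - 1) / 3) * w' (snd z / fst z powr (1/3))"

definition sol_x :: "real \<times> real \<Rightarrow> real" where
  "sol_x z = fst z powr (l / 3 - 1) * u (snd z / fst z powr (1/3))"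

lemma cont_w: "continuous_on S w" and cont_w': "continuous_on S w'"
  by (auto intro!: continuous_at_imp_continuous_on DERIV_isCont deriv_w deriv_w')

lemma sol_v_bound:
  obtains c where "c > 0" "\<And>x v. x > 0 \<Longrightarrow> \<bar>sol_v (x, v)\<bar> \<le> c * kin_norm (x, v) powr (l - 1)"
proof -
  obtain c where c: "c > 0" "\<And>y. \<bar>w' y\<bar> \<le> c * max 1 \<bar>y\<bar> powr (l - 1)" using w'_bound by auto
  show ?thesis
  proof (rule that[OF c(1)])
    fix x v :: real assume "x > 0"
    from scaled_le_kin_norm[OF this c(2), of v] show "\<bar>sol_v (x, v)\<bar> \<le> c * kin_norm (x, v) powr (l - 1)"
      by (simp add: sol_v_def abs_mult)
  qed
qed

lemma sol_x_bound:
  obtains c where "c > 0" "\<And>x v. x > 0 \<Longrightarrow> \<bar>sol_x (x, v)\<bar> \<le> c * kin_norm (x, v) powr (l - 3)"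
proof -
  obtain c where c: "c > 0" "\<And>y. \<bar>u y\<bar> \<le> c * max 1 \<bar>y\<bar> powr (l - 3)" using u_bound by auto
  have e: "(l - 3) / 3 = l / 3 - 1" by simp
  show ?thesis
  proof (rule that[OF c(1)])
    fix x v :: real assume "x > 0"
    from scaled_le_kin_norm[OF this c(2), of v] show "\<bar>sol_x (x, v)\<bar> \<le> c * kin_norm (x, v) powr (l - 3)"
      unfolding e by (simp add: sol_x_def abs_mult)
  qed
qed

lemma Ap_bounds:
  assumes "\<And>y. c * max 1 \<bar>y\<bar> powr l \<le> w y" "\<And>y. w y \<le> d * max 1 \<bar>y\<bar> powr l"
  shows "c \<le> Ap" "Ap \<le> d" "c \<le> Am" "Am \<le> d"
proof -
  have *: "\<forall>\<^sub>F y in at_top. c \<le> w y / y powr l" "\<forall>\<^sub>F y in at_top. w y / y powr l \<le> d"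
    "\<forall>\<^sub>F y in at_top. c \<le> w (- y) / y powr l" "\<forall>\<^sub>F y in at_top. w (- y) / y powr l \<le> d"
  proof -
    have "c \<le> w y / y powr l \<and> w y / y powr l \<le> d \<and> c \<le> w (- y) / y powr l \<and> w (- y) / y powr l \<le> d" if y: "y \<ge> 1" for y
      using assms[of y] assms[of "- y"] y by (simp add: max_def field_simps)
    then show "\<forall>\<^sub>F y in at_top. c \<le> w y / y powr l" "\<forall>\<^sub>F y in at_top. w y / y powr l \<le> d"
      "\<forall>\<^sub>F y in at_top. c \<le> w (- y) / y powr l" "\<forall>\<^sub>F y in at_top. w (- y) / y powr l \<le> d"
      by (auto intro: eventually_mono[OF eventually_ge_at_top[of 1]])
  qed
  show "c \<le> Ap" "Ap \<le> d" "c \<le> Am" "Am \<le> d"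
    using tendsto_lowerbound[OF w_at_top *(1)] tendsto_upperbound[OF w_at_top *(2)]
      tendsto_lowerbound[OF w_at_bot *(3)] tendsto_upperbound[OF w_at_bot *(4)] by auto
qed

lemma sol_comparable:
  obtains c1 c2 where "c1 > 0" "c2 > 0"
    "\<And>x v. x \<ge> 0 \<Longrightarrow> c1 * kin_norm (x, v) powr l \<le> sol (x, v)"
    "\<And>x v. x \<ge> 0 \<Longrightarrow> sol (x, v) \<le> c2 * kin_norm (x, v) powr l"
proof -
  obtain c where c: "c > 0" "\<And>y. c * max 1 \<bar>y\<bar> powr l \<le> w y" using w_lower by auto
  obtain d where d: "d > 0" "\<And>y. w y \<le> d * max 1 \<bar>y\<bar> powr l" using w_upper by auto
  have "c * kin_norm (x, v) powr l \<le> sol (x, v) \<and> sol (x, v) \<le> d * kin_norm (x, v) powr l" if "x \<ge> 0" for x v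
  proof (cases "x = 0")
    case True
    have "sol (0, v) = (if v > 0 then Ap else Am) * \<bar>v\<bar> powr l" by (auto simp: sol_def)
    moreover have "c * \<bar>v\<bar> powr l \<le> (if v > 0 then Ap else Am) * \<bar>v\<bar> powr l"
      "(if v > 0 then Ap else Am) * \<bar>v\<bar> powr l \<le> d * \<bar>v\<bar> powr l"
      using Ap_bounds[OF c(2) d(2)] by (intro mult_right_mono; auto)+
    ultimately show ?thesis using True by (simp add: kin_norm_def)
  next
    case False
    then have x: "x > 0" using that by simp
    have "- w y \<le> - c * max 1 \<bar>y\<bar> powr l" for y using c(2)[of y] by simp
    from scaled_le_kin_norm[where g="\<lambda>y. - w y", OF x this, of v] scaled_le_kin_norm[OF x d(2), of v]
    show ?thesis using x by (simp add: sol_def)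
  qed
  with c(1) d(1) show ?thesis using that by blast
qed

lemma DERIV_sol_v:
  assumes x: "x > 0"
  shows "((\<lambda>v. sol (x, v)) has_real_derivative sol_v (x, v)) (at v)"
proof -
  have "((\<lambda>v. x powr (l / 3) * w (v / x powr (1/3))) has_real_derivative
      x powr (l / 3) * (w' (v / x powr (1/3)) * (1 / x powr (1/3)))) (at v)"
    by (intro DERIV_cmult DERIV_chain2[OF deriv_w] DERIV_cdivide DERIV_ident)
  moreover have "x powr (l / 3) / x powr (1/3) = x powr ((l - 1) / 3)"
    by (simp add: powr_diff[symmetric] diff_divide_distrib)
  then have "x powr (l / 3) * (w' (v / x powr (1/3)) * (1 / x powr (1/3))) = sol_v (x, v)"
    unfolding sol_v_def fst_conv snd_conv by (metis divide_inverse inverse_eq_divide mult.assoc mult.commute)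
  ultimately show ?thesis using x by (simp add: sol_def)
qed

text \<open>Read together with \<open>DERIV_sol_x\<close>, this is the equation \<open>v \<partial>\<^sub>x f = \<partial>\<^sub>v\<^sub>v f\<close>.\<close>

lemma DERIV_sol_vv:
  assumes x: "x > 0"
  shows "((\<lambda>v. sol_v (x, v)) has_real_derivative v * sol_x (x, v)) (at v)"
proof -
  let ?y = "v / x powr (1/3)"
  have "((\<lambda>v. x powr ((l - 1) / 3) * w' (v / x powr (1/3))) has_real_derivative
      x powr ((l - 1) / 3) * (?y * u ?y * (1 / x powr (1/3)))) (at v)"
    by (intro DERIV_cmult DERIV_chain2[OF deriv_w'] DERIV_cdivide DERIV_ident)
  moreover have "x powr ((l - 1) / 3) / x powr (1/3) / x powr (1/3) = x powr (l / 3 - 1)"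
    by (simp add: powr_diff[symmetric] diff_divide_distrib)
  then have "x powr ((l - 1) / 3) * (?y * u ?y * (1 / x powr (1/3))) = v * sol_x (x, v)"
    unfolding sol_x_def by (simp add: mult_ac) (metis (no_types, lifting) divide_divide_eq_left mult.commute times_divide_eq_right)
  ultimately show ?thesis by (simp add: sol_v_def)
qed

lemma DERIV_sol_x:
  assumes x: "x > 0"
  shows "((\<lambda>x. sol (x, v)) has_real_derivative sol_x (x, v)) (at x)"
proof -
  let ?y = "v / x powr (1/3)"
  have p: "((\<lambda>x. x powr r) has_real_derivative r * x powr (r - 1)) (at x)" for r
    by (rule has_real_derivative_powr[OF x])
  have y: "((\<lambda>x. v / x powr (1/3)) has_real_derivative - (1/3) * ?y / x) (at x)"
  proof -
    have "((\<lambda>x. v * x powr (- (1/3))) has_real_derivative v * (- (1/3) * x powr (- (1/3) - 1))) (at x)"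
      by (intro DERIV_cmult p)
    moreover have "x powr (- (1/3) - 1) = 1 / x powr (1/3) / x" 
      using x by (simp only: powr_diff powr_minus_divide powr_one)
    ultimately show ?thesis by (simp add: powr_minus_divide mult_ac)
  qed
  have "((\<lambda>x. x powr (l / 3) * w (v / x powr (1/3))) has_real_derivative
      (l / 3 * x powr (l / 3 - 1)) * w ?y + (w' ?y * (- (1/3) * ?y / x)) * x powr (l / 3)) (at x)"
    by (intro DERIV_mult p DERIV_chain2[OF deriv_w] y)
  moreover have "(l / 3 * x powr (l / 3 - 1)) * w ?y + (w' ?y * (- (1/3) * ?y / x)) * x powr (l / 3) = sol_x (x, v)"
  proof -
    have "x powr (l / 3) = x * x powr (l / 3 - 1)" using x by (simp add: powr_diff)
    then have "(l / 3 * x powr (l / 3 - 1)) * w ?y + (w' ?y * (- (1/3) * ?y / x)) * x powr (l / 3)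
       = x powr (l / 3 - 1) * ((l * w ?y - ?y * w' ?y) / 3)"
      using x by (simp add: field_simps)
    then show ?thesis unfolding Euler[symmetric] by (simp add: sol_x_def)
  qed
  ultimately have "((\<lambda>x. x powr (l / 3) * w (v / x powr (1/3))) has_real_derivative sol_x (x, v)) (at x)"
    by simp
  then show ?thesis
    by (rule has_field_derivative_transform_within_open[of _ _ _ "{0<..}"]) (use x in \<open>auto simp: sol_def\<close>)
qed

lemma continuous_on_interior:
  assumes "S \<subseteq> {0<..} \<times> UNIV"
  shows "continuous_on S sol" "continuous_on S sol_v" "continuous_on S sol_x"
proof -
  have pos: "fst z > 0" if "z \<in> S" for z using assms that by auto
  have y: "continuous_on S (\<lambda>z. snd z / fst z powr (1/3))"
    by (intro continuous_intros) (use pos in force)+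
  have c: "continuous_on S (\<lambda>z. g (snd z / fst z powr (1/3)))" if "continuous_on UNIV g" for g :: "real \<Rightarrow> real"
    by (rule continuous_on_compose2[OF that y]) auto
  have "continuous_on S (\<lambda>z. fst z powr (l / 3) * w (snd z / fst z powr (1/3)))"
    by (intro continuous_intros c cont_w) (use pos in force)+
  then show "continuous_on S sol"
    by (subst continuous_on_cong[OF refl]) (use pos in \<open>auto simp: sol_def\<close>)
  show "continuous_on S sol_v" unfolding sol_v_def[abs_def]
    by (intro continuous_intros c cont_w') (use pos in force)+
  show "continuous_on S sol_x" unfolding sol_x_def[abs_def]
    by (intro continuous_intros c cont_u) (use pos in force)+
qed

text \<open>In the half-planes \<open>\<plusminus>v > 0\<close> the function is \<open>\<bar>v\<bar>\<^sup>l\<close> times a function of \<open>x\<^sup>1\<^sup>/\<^sup>3 / \<bar>v\<bar> \<ge> 0\<close> that is continuous up to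
  \<open>0\<close> because of the limits of the profile; the origin is reached by comparison with the kinetic norm.\<close>

lemma sol_continuous: "continuous_on ({0..} \<times> UNIV) sol"
proof -
  have edge: "continuous_on {0..} (\<lambda>s. if s > 0 then g (1 / s) * s powr l else L)"
    if g: "continuous_on UNIV g" and L: "((\<lambda>y. g y / y powr l) \<longlongrightarrow> L) at_top" for g :: "real \<Rightarrow> real" and L
    unfolding continuous_on_def
  proof
    fix s :: real assume "s \<in> {0..}"
    then consider "s = 0" | "s > 0" by force
    then show "((\<lambda>s. if s > 0 then g (1 / s) * s powr l else L) \<longlongrightarrow> (if s > 0 then g (1 / s) * s powr l else L)) (at s within {0..})"
    proof cases
      case 1
      have "((\<lambda>s. g (inverse s) / inverse s powr l) \<longlongrightarrow> L) (at_right 0)"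
        by (rule filterlim_compose[OF L filterlim_inverse_at_top_right])
      then have "((\<lambda>s. if s > 0 then g (1 / s) * s powr l else L) \<longlongrightarrow> L) (at_right 0)"
      proof (rule Lim_transform_eventually)
        show "\<forall>\<^sub>F s in at_right 0. g (inverse s) / inverse s powr l = (if s > 0 then g (1 / s) * s powr l else L)"
          using eventually_at_right_less[of 0]
          by eventually_elim (simp add: inverse_eq_divide powr_divide)
      qed
      then show ?thesis using 1 by (simp add: at_within_Ici_at_right)
    next
      case 2
      have "continuous_on {0<..} (\<lambda>s. g (1 / s) * s powr l)"
        by (intro continuous_intros continuous_on_compose2[OF g]) auto
      then have "continuous_on {0<..} (\<lambda>s. if s > 0 then g (1 / s) * s powr l else L)"
        by (subst continuous_on_cong[OF refl]) auto
      then have "isCont (\<lambda>s. if s > 0 then g (1 / s) * s powr l else L) s"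
        using 2 by (subst (asm) continuous_on_eq_continuous_at) auto
      then show ?thesis unfolding isCont_def by (rule tendsto_within_subset) auto
    qed
  qed
  define mp where "mp = (\<lambda>s. if s > 0 then w (1 / s) * s powr l else Ap)"
  define mm where "mm = (\<lambda>s. if s > 0 then w (- (1 / s)) * s powr l else Am)"
  have mp: "continuous_on {0..} mp" unfolding mp_def by (rule edge[OF cont_w w_at_top])
  have mm: "continuous_on {0..} mm" unfolding mm_def
    by (rule edge[OF _ w_at_bot]) (intro continuous_on_compose2[OF cont_w[of UNIV]] continuous_intros; simp)
  have pw: "(x powr (1/3) / v) powr l = x powr (l / 3) / v powr l" if "x > 0" "v > 0" for x v :: real
    using that by (simp add: powr_divide powr_powr)
  have sp: "sol (x, v) = v powr l * mp (x powr (1/3) / v)" if "x \<ge> 0" "v > 0" for x v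
    using that pw[of x v] by (cases "x = 0") (auto simp: sol_def mp_def)
  have sm: "sol (x, v) = (- v) powr l * mm (x powr (1/3) / - v)" if "x \<ge> 0" "v < 0" for x v
    using that pw[of x "- v"] divide_pos_neg[of "x powr (1/3)" v] by (cases "x = 0") (auto simp: sol_def mm_def)
  have xc: "continuous_on S (\<lambda>z::real \<times> real. fst z powr (1/3))" if "S \<subseteq> {0..} \<times> UNIV" for S
    by (rule continuous_on_powr') (use that in \<open>auto intro!: continuous_intros\<close>)
  have cp: "continuous_on ({0..} \<times> {0<..}) sol"
  proof -
    have "continuous_on ({0..} \<times> {0<..}) (\<lambda>z. snd z powr l * mp (fst z powr (1/3) / snd z))"
      by (intro continuous_intros continuous_on_compose2[OF mp] xc) (auto intro!: divide_nonneg_pos)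
    then show ?thesis by (subst continuous_on_cong[OF refl]) (auto simp: sp)
  qed
  have cm: "continuous_on ({0..} \<times> {..<0}) sol"
  proof -
    have "continuous_on ({0..} \<times> {..<0}) (\<lambda>z. (- snd z) powr l * mm (fst z powr (1/3) / (- snd z)))"
      by (intro continuous_intros continuous_on_compose2[OF mm] xc) (auto intro!: divide_nonneg_neg)
    then show ?thesis by (subst continuous_on_cong[OF refl]) (auto simp: sm)
  qed
  have ci: "continuous_on ({0<..} \<times> UNIV) sol" by (rule continuous_on_interior) auto
  have open_part: "(sol \<longlongrightarrow> sol z) (at z within {0..} \<times> UNIV)"
    if c: "continuous_on (({0..} \<times> UNIV) \<inter> T) sol" and T: "open T" "z \<in> T" "z \<in> {0..} \<times> UNIV" for z T
  proof -
    have "(sol \<longlongrightarrow> sol z) (at z within (({0..} \<times> UNIV) \<inter> T))"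
      using c T by (auto simp: continuous_on_def)
    then show ?thesis using at_within_nhd[of z T "{0..} \<times> UNIV" "({0..} \<times> UNIV) \<inter> T"] T by auto
  qed
  show ?thesis
    unfolding continuous_on_def
  proof
    fix z :: "real \<times> real" assume z: "z \<in> {0..} \<times> UNIV"
    then consider "fst z > 0" | "snd z > 0" | "snd z < 0" | "z = (0, 0)" by (cases z) force
    then show "(sol \<longlongrightarrow> sol z) (at z within {0..} \<times> UNIV)"
    proof cases
      case 1
      have "({0..} \<times> UNIV) \<inter> ({0<..} \<times> UNIV) = ({0<..} :: real set) \<times> (UNIV :: real set)" by auto
      then show ?thesis using open_part[of "{0<..} \<times> UNIV" z] ci 1 z by (cases z) (auto simp: open_Times)
    next
      case 2
      have "({0..} \<times> UNIV) \<inter> (UNIV \<times> {0<..}) = ({0..} :: real set) \<times> ({0<..} :: real set)" by auto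
      then show ?thesis using open_part[of "UNIV \<times> {0<..}" z] cp 2 z by (cases z) (auto simp: open_Times)
    next
      case 3
      have "({0..} \<times> UNIV) \<inter> (UNIV \<times> {..<0}) = ({0..} :: real set) \<times> ({..<0} :: real set)" by auto
      then show ?thesis using open_part[of "UNIV \<times> {..<0}" z] cm 3 z by (cases z) (auto simp: open_Times)
    next
      case 4
      obtain c1 c2 where c: "c1 > 0" "c2 > 0"
        "\<And>x v. x \<ge> 0 \<Longrightarrow> c1 * kin_norm (x, v) powr l \<le> sol (x, v)"
        "\<And>x v. x \<ge> 0 \<Longrightarrow> sol (x, v) \<le> c2 * kin_norm (x, v) powr l"
        using sol_comparable by blast
      have "continuous_on ({0..} \<times> UNIV) (\<lambda>z. c2 * kin_norm z powr l)"
        unfolding kin_norm_def[abs_def]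
        by (intro continuous_intros continuous_on_powr') (use l in auto)
      then have "((\<lambda>z. c2 * kin_norm z powr l) \<longlongrightarrow> c2 * kin_norm (0, 0) powr l) (at (0,0) within {0..} \<times> UNIV)"
        by (auto simp: continuous_on_def)
      then have up: "((\<lambda>z. c2 * kin_norm z powr l) \<longlongrightarrow> 0) (at (0,0) within {0..} \<times> UNIV)"
        by (simp add: kin_norm_def)
      have "(sol \<longlongrightarrow> 0) (at (0,0) within {0..} \<times> UNIV)"
      proof (rule tendsto_sandwich[OF _ _ tendsto_const up])
        have b: "0 \<le> sol z" if "z \<in> {0..} \<times> UNIV" for z
        proof -
          have "0 \<le> c1 * kin_norm z powr l" using c by simp
          then show ?thesis using c(3)[of "fst z" "snd z"] that by auto
        qed
        show "\<forall>\<^sub>F z in at (0,0) within {0..} \<times> UNIV. 0 \<le> sol z"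
          "\<forall>\<^sub>F z in at (0,0) within {0..} \<times> UNIV. sol z \<le> c2 * kin_norm z powr l"
          using b c(4) by (auto simp: eventually_at_filter intro!: always_eventually)
      qed
      then show ?thesis using 4 by (simp add: sol_def)
    qed
  qed
qed

end

context kinetic_profile
begin

section \<open>Kinetic Hoelder regularity\<close>

lemma sol_nonneg: "x \<ge> 0 \<Longrightarrow> 0 \<le> sol (x, v)"
proof -
  assume x: "x \<ge> 0"
  obtain c1 c2 where c: "c1 > 0" "c2 > 0"
    "\<And>x v. x \<ge> 0 \<Longrightarrow> c1 * kin_norm (x, v) powr l \<le> sol (x, v)"
    "\<And>x v. x \<ge> 0 \<Longrightarrow> sol (x, v) \<le> c2 * kin_norm (x, v) powr l"
    using sol_comparable by blast
  have "0 \<le> c1 * kin_norm (x, v) powr l" using c by simp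
  with c(3)[OF x, of v] show ?thesis by simp
qed

text \<open>The Hoelder estimate for two points whose kinetic distance is at most \<open>d\<close>, witnessed by the velocity \<open>y\<close>.
  If \<open>d\<close> is comparable to the distance \<open>r\<close> of the points from the origin, both values are \<open>O(d\<^sup>l)\<close>.  Otherwise the
  coordinate path between them stays at distance \<open>r / 2\<close> from the origin.  Up to constants, the increment along it is at
  most \<open>r\<^sup>l\<^sup>-\<^sup>1 d\<close> in \<open>v\<close> and, since time shifts allow a displacement of order \<open>d\<^sup>2 r\<close> in \<open>x\<close>, at most
  \<open>r\<^sup>l\<^sup>-\<^sup>3 d\<^sup>2 r\<close> in \<open>x\<close>; both are \<open>O(d\<^sup>l)\<close> because \<open>d \<le> r\<close>.\<close>

lemma sol_increment:
  obtains C where "C > 0" "\<And>x1 v1 x2 v2 d y. 0 < x1 \<Longrightarrow> 0 < x2 \<Longrightarrow> 0 \<le> d \<Longrightarrow> \<bar>x1 - x2\<bar> \<le> d^3 + d^2 * \<bar>y\<bar> \<Longrightarrow>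
     \<bar>v1 - y\<bar> \<le> d \<Longrightarrow> \<bar>v2 - y\<bar> \<le> d \<Longrightarrow> \<bar>sol (x1, v1) - sol (x2, v2)\<bar> \<le> C * d powr l"
proof -
  obtain c0 c where "c0 > 0" and c1: "c > 0"
    and "\<And>x v. x \<ge> 0 \<Longrightarrow> c0 * kin_norm (x, v) powr l \<le> sol (x, v)"
    and c2: "\<And>x v. x \<ge> 0 \<Longrightarrow> sol (x, v) \<le> c * kin_norm (x, v) powr l"
    using sol_comparable by blast
  note c = c1 c2[OF less_imp_le]
  obtain cv where cv: "cv > 0" "\<And>x v. x > 0 \<Longrightarrow> \<bar>sol_v (x, v)\<bar> \<le> cv * kin_norm (x, v) powr (l - 1)"
    using sol_v_bound by blast
  obtain cx where cx: "cx > 0" "\<And>x v. x > 0 \<Longrightarrow> \<bar>sol_x (x, v)\<bar> \<le> cx * kin_norm (x, v) powr (l - 3)"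
    using sol_x_bound by blast
  define C where "C = c * 6 powr l + 3 * cx + 2 * cv"
  have "\<bar>sol (x1, v1) - sol (x2, v2)\<bar> \<le> C * d powr l"
    if x: "0 < x1" "0 < x2" and d: "0 \<le> d" and dx: "\<bar>x1 - x2\<bar> \<le> d^3 + d^2 * \<bar>y\<bar>"
      and dv: "\<bar>v1 - y\<bar> \<le> d" "\<bar>v2 - y\<bar> \<le> d" for x1 v1 x2 v2 d y
  proof -
    define r where "r = kin_norm (x1, v1)"
    have rv: "\<bar>v1\<bar> \<le> r" by (simp add: r_def kin_norm_def)
    have cube: "(a powr (1/3))^3 = a" if "a > 0" for a :: real
      using that powr_powr[of a "1/3" 3] by (simp add: powr_numeral)
    have r0: "r > 0" using x by (simp add: r_def kin_norm_def less_max_iff_disj)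
    have rx: "x1 \<le> r^3"
    proof -
      have "(x1 powr (1/3))^3 \<le> r^3" using x by (intro power_mono) (auto simp: r_def kin_norm_def)
      then show ?thesis using cube[OF x(1)] by simp
    qed
    consider "d = 0" | "d > 0" "r \<le> 4 * d" | "d > 0" "4 * d < r" using d by linarith
    then show ?thesis
    proof cases
      case 1
      then show ?thesis using dx dv by simp
    next
      case 2
      have yb: "\<bar>y\<bar> \<le> 5 * d" using rv dv 2 by linarith
      have "r^3 \<le> (4 * d)^3" using 2 r0 by (intro power_mono) auto
      moreover have "d^2 * \<bar>y\<bar> \<le> d^2 * (5 * d)" using yb by (intro mult_left_mono) auto
      \<comment> \<open>\<open>70 = 4\<^sup>3 + 1 + 5\<close>: the bounds for \<open>x1\<close>, \<open>d\<^sup>3\<close> and \<open>d\<^sup>2 \<bar>y\<bar>\<close>\<close>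
      ultimately have "x2 \<le> 70 * d^3" using rx dx by (simp add: power2_eq_square power3_eq_cube abs_le_iff)
      also have "\<dots> \<le> (6 * d)^3" using d by (simp add: power_mult_distrib)
      finally have "x2 powr (1/3) \<le> ((6 * d)^3) powr (1/3)" using x by (intro powr_mono2) auto
      also have "((6 * d)^3) powr (1/3) = 6 * d"
        using powr_powr[of "6 * d" 3 "1/3"] 2 by (simp add: powr_numeral)
      finally have "kin_norm (x2, v2) \<le> 6 * d" using x rv dv 2 by (auto simp: kin_norm_def)
      then have k2: "kin_norm (x2, v2) powr l \<le> (6 * d) powr l"
        using l by (intro powr_mono2) (auto simp: kin_norm_def)
      have k1: "kin_norm (x1, v1) powr l \<le> (6 * d) powr l"
        using l 2 r0 unfolding r_def[symmetric] by (intro powr_mono2) auto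
      have m: "(6 * d) powr l = 6 powr l * d powr l" using 2 by (simp add: powr_mult)
      have "sol (x1, v1) \<le> c * (6 * d) powr l" "sol (x2, v2) \<le> c * (6 * d) powr l"
        using c(2)[OF x(1), of v1] c(2)[OF x(2), of v2] mult_left_mono[OF k1, of c] mult_left_mono[OF k2, of c] c(1) by linarith+
      then have "\<bar>sol (x1, v1) - sol (x2, v2)\<bar> \<le> c * (6 * d) powr l"
        using sol_nonneg[of x1 v1] sol_nonneg[of x2 v2] x by (simp add: abs_le_iff)
      also have "\<dots> \<le> C * d powr l"
        unfolding m C_def using cx(1) cv(1) by (simp add: algebra_simps)
      finally show ?thesis .
    next
      case 3
      have yb: "\<bar>y\<bar> \<le> 5/4 * r" using rv dv 3 by linarith
      have "d^3 \<le> d^2 * (1/4 * r)" unfolding power3_eq_cube power2_eq_square using 3 by (intro mult_left_mono) auto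
      moreover have "d^2 * \<bar>y\<bar> \<le> d^2 * (5/4 * r)" using yb by (intro mult_left_mono) auto
      ultimately have dx2: "\<bar>x1 - x2\<bar> \<le> 3/2 * d^2 * r" using dx by simp
      have "d^2 \<le> (1/4 * r)^2" using 3 by (intro power_mono) auto
      then have "d^2 * r \<le> (1/4 * r)^2 * r" using r0 by (intro mult_right_mono) auto
      then have dx3: "\<bar>x1 - x2\<bar> \<le> 3/32 * r^3" using dx2 by (simp add: power2_eq_square power3_eq_cube)
      \<comment> \<open>one coordinate of \<open>(x1, v1)\<close> realises the norm, and that coordinate changes little along the path\<close>
      have far: "r / 2 \<le> kin_norm (x', v')"
        if x': "0 < x'" "\<bar>x' - x1\<bar> \<le> \<bar>x1 - x2\<bar>" and v': "\<bar>v' - v1\<bar> \<le> 2 * d" for x' v'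
      proof -
        have "r = x1 powr (1/3) \<or> r = \<bar>v1\<bar>" using x by (auto simp: r_def kin_norm_def max_def)
        then show ?thesis
        proof
          assume r: "r = x1 powr (1/3)"
          then have "x1 = r^3" using cube[OF x(1)] by simp
          then have "(r / 2)^3 \<le> x'" using dx3 x' r0 by (simp add: power_divide abs_le_iff)
          then have "((r / 2)^3) powr (1/3) \<le> x' powr (1/3)" using r0 by (intro powr_mono2) auto
          moreover have "((r / 2)^3) powr (1/3) = r / 2"
            using powr_powr[of "r / 2" 3 "1/3"] r0 by (simp add: powr_numeral)
          ultimately show ?thesis using x' by (simp add: kin_norm_def le_max_iff_disj)
        next
          assume "r = \<bar>v1\<bar>"
          then have "r / 2 \<le> \<bar>v'\<bar>" using v' 3 by linarith
          then show ?thesis by (simp add: kin_norm_def le_max_iff_disj)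
        qed
      qed
      have rd: "d \<le> r / 2" using 3 by simp
      have "norm (sol (x2, v1) - sol (x1, v1)) \<le> cx * (r / 2) powr (l - 3) * norm (x2 - x1)"
      proof (rule field_differentiable_bound[of "closed_segment x1 x2" _ "\<lambda>x. sol_x (x, v1)"])
        fix x assume "x \<in> closed_segment x1 x2"
        then have X: "0 < x" "\<bar>x - x1\<bar> \<le> \<bar>x1 - x2\<bar>"
          using x by (auto simp: closed_segment_eq_real_ivl split: if_splits)
        show "((\<lambda>x. sol (x, v1)) has_field_derivative sol_x (x, v1)) (at x within closed_segment x1 x2)"
          by (rule has_field_derivative_at_within[OF DERIV_sol_x[OF X(1)]])
        have "kin_norm (x, v1) powr (l - 3) \<le> (r / 2) powr (l - 3)"
          using far[OF X, of v1] r0 l d by (intro powr_mono2') auto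
        then have "cx * kin_norm (x, v1) powr (l - 3) \<le> cx * (r / 2) powr (l - 3)"
          using cx(1) by (intro mult_left_mono) auto
        with cx(2)[OF X(1), of v1] show "norm (sol_x (x, v1)) \<le> cx * (r / 2) powr (l - 3)" by simp
      qed auto
      also have "\<dots> \<le> cx * (r / 2) powr (l - 3) * (3/2 * d^2 * r)"
        using dx2 cx(1) by (intro mult_left_mono) (auto simp: abs_minus_commute)
      also have "\<dots> = 3 * cx * d^2 * ((r / 2) powr (l - 3) * (r / 2))" by simp
      also have "(r / 2) powr (l - 3) * (r / 2) = (r / 2) powr (l - 2)"
      proof -
        have "(r / 2) powr (l - 3 + 1) = (r / 2) powr (l - 3) * (r / 2) powr 1" by (rule powr_add)
        moreover have "l - 3 + 1 = l - 2" by simp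
        ultimately show ?thesis using r0 by simp
      qed
      also have "3 * cx * d^2 * (r / 2) powr (l - 2) \<le> 3 * cx * d^2 * d powr (l - 2)"
        using cx(1) rd 3 l by (intro mult_left_mono powr_mono2') auto
      also have "\<dots> = 3 * cx * d powr l"
      proof -
        have "d powr (2 + (l - 2)) = d powr 2 * d powr (l - 2)" by (rule powr_add)
        then show ?thesis using 3 by (simp add: powr_numeral)
      qed
      finally have X: "\<bar>sol (x2, v1) - sol (x1, v1)\<bar> \<le> 3 * cx * d powr l" by simp
      have "norm (sol (x2, v2) - sol (x2, v1)) \<le> cv * (r / 2) powr (l - 1) * norm (v2 - v1)"
      proof (rule field_differentiable_bound[of "closed_segment v1 v2" _ "\<lambda>v. sol_v (x2, v)"])
        fix v assume "v \<in> closed_segment v1 v2"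
        then have V: "\<bar>v - v1\<bar> \<le> 2 * d"
          using dv by (auto simp: closed_segment_eq_real_ivl split: if_splits)
        show "((\<lambda>v. sol (x2, v)) has_field_derivative sol_v (x2, v)) (at v within closed_segment v1 v2)"
          by (rule has_field_derivative_at_within[OF DERIV_sol_v[OF x(2)]])
        have "r / 2 \<le> kin_norm (x2, v)" by (rule far) (use V x in auto)
        then have "kin_norm (x2, v) powr (l - 1) \<le> (r / 2) powr (l - 1)"
          using r0 l by (intro powr_mono2') auto
        then have "cv * kin_norm (x2, v) powr (l - 1) \<le> cv * (r / 2) powr (l - 1)"
          using cv(1) by (intro mult_left_mono) auto
        with cv(2)[OF x(2), of v] show "norm (sol_v (x2, v)) \<le> cv * (r / 2) powr (l - 1)" by simp
      qed auto
      also have "\<dots> \<le> cv * d powr (l - 1) * (2 * d)"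
        using cv(1) rd 3 l dv by (intro mult_mono mult_left_mono powr_mono2') auto
      also have "\<dots> = 2 * cv * d powr l"
        using 3 by (simp add: powr_diff)
      finally have V: "\<bar>sol (x2, v2) - sol (x2, v1)\<bar> \<le> 2 * cv * d powr l" by simp
      have "3 * cx * d powr l + 2 * cv * d powr l \<le> C * d powr l"
        unfolding C_def using c(1) by (simp add: algebra_simps)
      with X V show ?thesis by linarith
    qed
  qed
  moreover have "C > 0" unfolding C_def using c(1) cx(1) cv(1) by (intro add_pos_pos mult_pos_pos) auto
  ultimately show ?thesis using that by blast
qed

end

definition kin_gauge :: "real \<Rightarrow> real \<times> real \<times> real \<Rightarrow> real \<times> real \<times> real \<Rightarrow> real" where
  "kin_gauge y z1 z2 = Max {\<bar>fst z1 - fst z2\<bar> powr (1/2),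
     \<bar>fst (snd z1) - (fst (snd z2) + (fst z1 - fst z2) * y)\<bar> powr (1/3), \<bar>snd (snd z1) - y\<bar>, \<bar>snd (snd z2) - y\<bar>}"

lemma dist_kin_eq: "dist_kin z1 z2 = (INF y. kin_gauge y z1 z2)"
  by (cases z1; cases z2) (simp add: dist_kin_def kin_gauge_def)

lemma kin_gauge_nonneg: "0 \<le> kin_gauge y z1 z2"
  by (simp add: kin_gauge_def le_max_iff_disj)

lemma dist_kin_le: "dist_kin z1 z2 \<le> kin_gauge y z1 z2"
  unfolding dist_kin_eq by (rule cINF_lower) (auto intro!: bdd_belowI[of _ 0] kin_gauge_nonneg)

lemma le_dist_kin: "(\<And>y. a \<le> kin_gauge y z1 z2) \<Longrightarrow> a \<le> dist_kin z1 z2"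
  unfolding dist_kin_eq by (rule cINF_greatest) auto

lemma dist_kin_nonneg: "0 \<le> dist_kin z1 z2"
  by (rule le_dist_kin) (rule kin_gauge_nonneg)

lemma dist_kin_x: "dist_kin (t, x1, 0) (t, x2, 0) = \<bar>x1 - x2\<bar> powr (1/3)"
proof (rule antisym)
  have "kin_gauge 0 (t, x1, 0) (t, x2, 0) = \<bar>x1 - x2\<bar> powr (1/3)"
    by (simp add: kin_gauge_def max_def)
  then show "dist_kin (t, x1, 0) (t, x2, 0) \<le> \<bar>x1 - x2\<bar> powr (1/3)"
    using dist_kin_le[of "(t, x1, 0)" "(t, x2, 0)" 0] by simp
  show "\<bar>x1 - x2\<bar> powr (1/3) \<le> dist_kin (t, x1, 0) (t, x2, 0)"
    by (rule le_dist_kin) (simp add: kin_gauge_def le_max_iff_disj)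
qed

text \<open>Eliminates the time variable: a time shift of size \<open>d\<^sup>2\<close> costs a displacement \<open>d\<^sup>2 \<bar>y\<bar>\<close> in \<open>x\<close>.\<close>

lemma kin_gauge_bounds:
  fixes y t1 x1 v1 t2 x2 v2 :: real
  defines "d \<equiv> kin_gauge y (t1, x1, v1) (t2, x2, v2)"
  shows "\<bar>x1 - x2\<bar> \<le> d^3 + d^2 * \<bar>y\<bar>" "\<bar>v1 - y\<bar> \<le> d" "\<bar>v2 - y\<bar> \<le> d"
proof -
  have d: "\<bar>t1 - t2\<bar> powr (1/2) \<le> d" "\<bar>x1 - (x2 + (t1 - t2) * y)\<bar> powr (1/3) \<le> d" "\<bar>v1 - y\<bar> \<le> d" "\<bar>v2 - y\<bar> \<le> d"
    by (auto simp: d_def kin_gauge_def le_max_iff_disj)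
  then show "\<bar>v1 - y\<bar> \<le> d" "\<bar>v2 - y\<bar> \<le> d" by auto
  have "(\<bar>t1 - t2\<bar> powr (1/2))^2 \<le> d^2" using d(1) by (intro power_mono) auto
  moreover have "(\<bar>t1 - t2\<bar> powr (1/2))^2 = \<bar>t1 - t2\<bar>"
    by (cases "t1 = t2") (use powr_powr[of "\<bar>t1 - t2\<bar>" "1/2" 2] in \<open>auto simp: powr_numeral\<close>)
  ultimately have t: "\<bar>t1 - t2\<bar> \<le> d^2" by simp
  let ?X = "\<bar>x1 - (x2 + (t1 - t2) * y)\<bar>"
  have "(?X powr (1/3))^3 \<le> d^3" using d(2) by (intro power_mono) auto
  moreover have "(?X powr (1/3))^3 = ?X"
    by (cases "?X = 0") (use powr_powr[of ?X "1/3" 3] in \<open>auto simp: powr_numeral\<close>)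
  ultimately have X: "?X \<le> d^3" by simp
  have "\<bar>(t1 - t2) * y\<bar> \<le> d^2 * \<bar>y\<bar>" unfolding abs_mult using t by (intro mult_right_mono) auto
  with X show "\<bar>x1 - x2\<bar> \<le> d^3 + d^2 * \<bar>y\<bar>" by linarith
qed

lemma const_kin_poly: "(\<lambda>z. c) \<in> kin_poly 0"
proof -
  have "{(i, j, l). 2 * i + 3 * j + l \<le> (0::nat)} = {(0, 0, 0)}" by auto
  then show ?thesis unfolding kin_poly_def by (auto intro!: exI[of _ "\<lambda>_ _ _. c"])
qed

context kinetic_profile
begin

text \<open>For an exponent below one the polynomials are constants, and the best constant at a point is the value there.\<close>

lemma sol_kin_holder:
  assumes f: "\<And>x v. x > 0 \<Longrightarrow> f (x, v) = sol (x, v)" and R: "R > 0"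
  shows "f \<in> kin_holder l (H R)"
proof -
  obtain C where C: "C > 0" "\<And>x1 v1 x2 v2 d y. 0 < x1 \<Longrightarrow> 0 < x2 \<Longrightarrow> 0 \<le> d \<Longrightarrow> \<bar>x1 - x2\<bar> \<le> d^3 + d^2 * \<bar>y\<bar> \<Longrightarrow>
     \<bar>v1 - y\<bar> \<le> d \<Longrightarrow> \<bar>v2 - y\<bar> \<le> d \<Longrightarrow> \<bar>sol (x1, v1) - sol (x2, v2)\<bar> \<le> C * d powr l"
    using sol_increment by blast
  define F where "F = (\<lambda>(t::real, x, v). f (x, v))"
  have inc: "\<bar>F z2 - F z1\<bar> / dist_kin z1 z2 powr (real 0 + l) \<le> C"
    if z: "z1 \<in> UNIV \<times> H R" "z2 \<in> UNIV \<times> H R" for z1 z2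
  proof -
    obtain t1 x1 v1 t2 x2 v2 where e: "z1 = (t1, x1, v1)" "z2 = (t2, x2, v2)" by (cases z1; cases z2) auto
    have x: "x1 > 0" "x2 > 0" using z by (auto simp: e H_def)
    define D where "D = \<bar>sol (x1, v1) - sol (x2, v2)\<bar>"
    have "(D / C) powr (1 / l) \<le> kin_gauge y z1 z2" for y
    proof -
      have "D \<le> C * kin_gauge y z1 z2 powr l" unfolding D_def
        using C(2)[OF x kin_gauge_nonneg kin_gauge_bounds] unfolding e .
      then have "D / C \<le> kin_gauge y z1 z2 powr l" using C(1) by (simp add: field_simps)
      then have "(D / C) powr (1 / l) \<le> (kin_gauge y z1 z2 powr l) powr (1 / l)"
        using l C(1) by (intro powr_mono2) (auto simp: D_def)
      then show ?thesis using l kin_gauge_nonneg[of y z1 z2] by (simp add: powr_powr)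
    qed
    then have "(D / C) powr (1 / l) \<le> dist_kin z1 z2" by (rule le_dist_kin)
    then have "((D / C) powr (1 / l)) powr l \<le> dist_kin z1 z2 powr l" using l by (intro powr_mono2) auto
    then have "D / C \<le> dist_kin z1 z2 powr l" using l C(1) by (simp add: powr_powr D_def)
    then have "D \<le> C * dist_kin z1 z2 powr l" using C(1) by (simp add: field_simps)
    moreover have "\<bar>F z2 - F z1\<bar> = D" unfolding D_def e F_def using f x by (simp add: abs_minus_commute)
    ultimately show ?thesis using C(1) dist_kin_nonneg[of z1 z2]
      by (cases "dist_kin z1 z2 = 0") (auto simp: field_simps)
  qed
  have "kin_seminorm 0 l (UNIV \<times> H R) F \<le> ennreal C"
    unfolding kin_seminorm_def
  proof (rule SUP_least)
    fix z1 :: "real \<times> real \<times> real" assume z1: "z1 \<in> UNIV \<times> H R"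
    show "(INF p\<in>kin_poly 0. SUP z2\<in>UNIV \<times> H R - {z1}. ennreal (\<bar>F z2 - p z2\<bar> / dist_kin z1 z2 powr (real 0 + l))) \<le> ennreal C"
      by (rule INF_lower2[OF const_kin_poly[of "F z1"]], rule SUP_least, rule ennreal_leI, rule inc) (use z1 in auto)
  qed
  then have sn: "kin_seminorm 0 l (UNIV \<times> H R) F < \<infinity>"
    by (rule le_less_trans) (simp add: ennreal_less_top)
  obtain c0 c where "c0 > 0" and c1: "c > 0"
    and "\<And>x v. x \<ge> 0 \<Longrightarrow> c0 * kin_norm (x, v) powr l \<le> sol (x, v)"
    and c2: "\<And>x v. x \<ge> 0 \<Longrightarrow> sol (x, v) \<le> c * kin_norm (x, v) powr l"
    using sol_comparable by blast
  note c = c1 c2[OF less_imp_le]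
  have "\<bar>F z\<bar> \<le> c * R powr l" if z: "z \<in> UNIV \<times> H R" for z
  proof -
    obtain t x v where e: "z = (t, x, v)" by (cases z) auto
    have x: "0 < x" "x < R^3" "\<bar>v\<bar> < R" using z by (auto simp: e H_def)
    have "x powr (1/3) \<le> (R^3) powr (1/3)" using x by (intro powr_mono2) auto
    also have "\<dots> = R" using powr_powr[of R 3 "1/3"] R by (simp add: powr_numeral)
    finally have "kin_norm (x, v) \<le> R" using x by (simp add: kin_norm_def)
    then have "kin_norm (x, v) powr l \<le> R powr l" using l by (intro powr_mono2) (auto simp: kin_norm_def)
    then have "c * kin_norm (x, v) powr l \<le> c * R powr l" using c(1) by (intro mult_left_mono) auto
    then show ?thesis using c(2)[OF x(1), of v] sol_nonneg[of x v] x f by (simp add: e F_def)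
  qed
  then have "\<exists>B. AE z in lborel. z \<in> UNIV \<times> H R \<longrightarrow> \<bar>F z\<bar> \<le> B"
    by (intro exI[of _ "c * R powr l"]) auto
  with sn have "F \<in> kin_C 0 l (UNIV \<times> H R)" by (simp add: kin_C_def)
  moreover have "\<lfloor>l\<rfloor> = 0" using l by (simp add: floor_eq_iff)
  ultimately show ?thesis by (simp add: kin_holder_def F_def)
qed

end

section \<open>Optimality of the Hoelder exponent\<close>

text \<open>The operator \<open>(T - 1) (T - 2) \<cdots> (T - 2\<^sup>n\<^sup>-\<^sup>1)\<close>, where \<open>T\<close> is the dilation \<open>g(x) \<mapsto> g(2 x)\<close>.  It annihilates
  the monomials \<open>1, x, \<dots>, x\<^sup>n\<^sup>-\<^sup>1\<close> and multiplies a power with a non-integral exponent by a nonzero constant.\<close>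

primrec dyadic_diff :: "nat \<Rightarrow> (real \<Rightarrow> real) \<Rightarrow> real \<Rightarrow> real" where
  "dyadic_diff 0 g x = g x"
| "dyadic_diff (Suc n) g x = dyadic_diff n g (2 * x) - 2 ^ n * dyadic_diff n g x"

lemma dyadic_diff_sum: "dyadic_diff n (\<lambda>x. \<Sum>a\<in>A. g a x) x = (\<Sum>a\<in>A. dyadic_diff n (g a) x)"
  by (induction n arbitrary: x) (simp_all add: sum_subtractf sum_distrib_left)

lemma dyadic_diff_cmult: "dyadic_diff n (\<lambda>x. c * g x) x = c * dyadic_diff n g x"
  by (induction n arbitrary: x) (simp_all add: algebra_simps)

lemma dyadic_diff_diff: "dyadic_diff n (\<lambda>x. f x - g x) x = dyadic_diff n f x - dyadic_diff n g x"
  by (induction n arbitrary: x) (simp_all add: right_diff_distrib)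

lemma dyadic_diff_homogeneous:
  assumes "\<And>x. x > 0 \<Longrightarrow> g (2 * x) = r * g x" "x > 0"
  shows "dyadic_diff n g x = (\<Prod>i<n. r - 2 ^ i) * g x"
  using assms(2)
proof (induction n arbitrary: x)
  case (Suc n)
  have "dyadic_diff (Suc n) g x = (\<Prod>i<n. r - 2 ^ i) * g (2 * x) - 2 ^ n * ((\<Prod>i<n. r - 2 ^ i) * g x)"
    using Suc.IH[of "2 * x"] Suc.IH[of x] Suc.prems by simp
  also have "\<dots> = (\<Prod>i<Suc n. r - 2 ^ i) * g x"
    using assms(1)[OF Suc.prems] by (simp add: algebra_simps)
  finally show ?case .
qed simp

lemma dyadic_diff_monomial:
  assumes "j < n" "x > 0"
  shows "dyadic_diff n (\<lambda>x. x ^ j) x = 0"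
proof -
  have "dyadic_diff n (\<lambda>x. x ^ j) x = (\<Prod>i<n. 2 ^ j - 2 ^ i) * x ^ j"
    by (rule dyadic_diff_homogeneous) (use assms in \<open>auto simp: power_mult_distrib\<close>)
  also have "(\<Prod>i<n. (2::real) ^ j - 2 ^ i) = 0"
    using assms by (intro prod_zero) auto
  finally show ?thesis by simp
qed

lemma dyadic_diff_bound:
  "\<exists>K\<ge>0. \<forall>g x B. (\<forall>i\<le>n. \<bar>g (2 ^ i * x)\<bar> \<le> B) \<longrightarrow> \<bar>dyadic_diff n g x\<bar> \<le> K * B"
  proof (induction n)
    case 0
    then show ?case by (intro exI[of _ 1]) auto
  next
    case (Suc n)
    then obtain K where K: "K \<ge> 0" "\<And>g x B. (\<forall>i\<le>n. \<bar>g (2 ^ i * x)\<bar> \<le> B) \<Longrightarrow> \<bar>dyadic_diff n g x\<bar> \<le> K * B" by auto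
    have "\<bar>dyadic_diff (Suc n) g x\<bar> \<le> (K + 2 ^ n * K) * B" if b: "\<forall>i\<le>Suc n. \<bar>g (2 ^ i * x)\<bar> \<le> B" for g x B
    proof -
      have "\<forall>i\<le>n. \<bar>g (2 ^ i * (2 * x))\<bar> \<le> B"
      proof (intro allI impI)
        fix i assume "i \<le> n"
        then show "\<bar>g (2 ^ i * (2 * x))\<bar> \<le> B" using b[rule_format, of "Suc i"] by (simp add: mult_ac)
      qed
      then have 1: "\<bar>dyadic_diff n g (2 * x)\<bar> \<le> K * B" by (rule K(2))
      have "\<bar>dyadic_diff n g x\<bar> \<le> K * B" using b by (intro K(2)) auto
      then have "\<bar>2 ^ n * dyadic_diff n g x\<bar> \<le> 2 ^ n * (K * B)" unfolding abs_mult by (intro mult_mono) auto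
      with 1 show ?thesis by (simp add: algebra_simps)
    qed
    then show ?case using K(1) by (intro exI[of _ "K + 2 ^ n * K"]) auto
qed

lemma dyadic_diff_kin_poly:
  assumes p: "p \<in> kin_poly k" and x: "x > 0"
  shows "dyadic_diff (Suc k) (\<lambda>x. p (0, x, 0)) x = 0"
proof -
  obtain c where c: "p = (\<lambda>(t, x, v). \<Sum>(i, j, m)\<in>{(i, j, m). 2 * i + 3 * j + m \<le> k}. c i j m * (t ^ i * x ^ j * v ^ m))"
    using p by (auto simp: kin_poly_def)
  have "(\<lambda>x. p (0, x, 0)) = (\<lambda>x. \<Sum>a\<in>{(i, j, m). 2 * i + 3 * j + m \<le> k}. (c (fst a) (fst (snd a)) (snd (snd a)) * (0 ^ fst a * 0 ^ snd (snd a))) * x ^ fst (snd a))"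
    unfolding c by (auto simp: fun_eq_iff case_prod_beta mult_ac)
  then have "dyadic_diff (Suc k) (\<lambda>x. p (0, x, 0)) x
     = (\<Sum>a\<in>{(i, j, m). 2 * i + 3 * j + m \<le> k}. (c (fst a) (fst (snd a)) (snd (snd a)) * (0 ^ fst a * 0 ^ snd (snd a))) * dyadic_diff (Suc k) (\<lambda>x. x ^ fst (snd a)) x)"
    by (simp only: dyadic_diff_sum dyadic_diff_cmult)
  also have "\<dots> = 0"
  proof (rule sum.neutral, safe)
    fix i j m :: nat assume "2 * i + 3 * j + m \<le> k"
    then have "dyadic_diff (Suc k) (\<lambda>x. x ^ j) x = 0" using x by (intro dyadic_diff_monomial) auto
    then show "c (fst (i, j, m)) (fst (snd (i, j, m))) (snd (snd (i, j, m))) * (0 ^ fst (i, j, m) * 0 ^ snd (snd (i, j, m))) *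
        dyadic_diff (Suc k) (\<lambda>x. x ^ fst (snd (i, j, m))) x = 0" by simp
  qed
  finally show ?thesis .
qed

text \<open>The division by the distance is a division by zero where the distance vanishes, so nothing can be
  concluded at such points.\<close>

lemma kin_C_imp_local_poly:
  assumes "f \<in> kin_C k a D"
  obtains M where "M \<ge> 0" "\<And>z1. z1 \<in> D \<Longrightarrow> \<exists>p\<in>kin_poly k. \<forall>z2\<in>D. dist_kin z1 z2 > 0 \<longrightarrow> z2 \<noteq> z1 \<longrightarrow>
      \<bar>f z2 - p z2\<bar> \<le> M * dist_kin z1 z2 powr (real k + a)"
proof -
  define S where "S = kin_seminorm k a D f"
  have "S < \<infinity>" using assms by (simp add: kin_C_def S_def)
  then obtain M0 where M0: "M0 \<ge> 0" "S = ennreal M0" by (cases S) auto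
  show ?thesis
  proof (rule that[of "M0 + 1"])
    fix z1 assume z1: "z1 \<in> D"
    let ?Q = "\<lambda>p. SUP z2\<in>D - {z1}. ennreal (\<bar>f z2 - p z2\<bar> / dist_kin z1 z2 powr (real k + a))"
    have "(INF p\<in>kin_poly k. ?Q p) \<le> S" unfolding S_def kin_seminorm_def by (rule SUP_upper[OF z1])
    also have "S < ennreal (M0 + 1)" using M0 by (simp add: ennreal_less_iff)
    finally obtain p where p: "p \<in> kin_poly k" "?Q p < ennreal (M0 + 1)" by (auto simp: INF_less_iff)
    have "\<bar>f z2 - p z2\<bar> \<le> (M0 + 1) * dist_kin z1 z2 powr (real k + a)"
      if z2: "z2 \<in> D" "dist_kin z1 z2 > 0" "z2 \<noteq> z1" for z2
    proof -
      have "ennreal (\<bar>f z2 - p z2\<bar> / dist_kin z1 z2 powr (real k + a)) \<le> ?Q p"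
        using z2 by (intro SUP_upper) auto
      with p(2) have "ennreal (\<bar>f z2 - p z2\<bar> / dist_kin z1 z2 powr (real k + a)) \<le> ennreal (M0 + 1)"
        using less_imp_le order_trans by blast
      then have "\<bar>f z2 - p z2\<bar> / dist_kin z1 z2 powr (real k + a) \<le> M0 + 1"
        using M0 by (subst (asm) ennreal_le_iff) auto
      then show ?thesis using z2 by (simp add: field_simps)
    qed
    with p(1) show "\<exists>p\<in>kin_poly k. \<forall>z2\<in>D. dist_kin z1 z2 > 0 \<longrightarrow> z2 \<noteq> z1 \<longrightarrow>
      \<bar>f z2 - p z2\<bar> \<le> (M0 + 1) * dist_kin z1 z2 powr (real k + a)" by blast
  qed (use M0 in auto)
qed

context kinetic_profile
begin

text \<open>On the axis \<open>v = 0\<close> the function is a multiple of \<open>x\<^sup>l\<^sup>/\<^sup>3\<close>.  Near \<open>(h, 0)\<close> with \<open>h\<close> small, a polynomial approximation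
  of order \<open>s = l + e\<close> has error \<open>O(h\<^sup>s\<^sup>/\<^sup>3)\<close> on the dyadic points \<open>2 h, 4 h, \<dots>\<close>.  The dyadic difference removes
  the polynomial, whatever its coefficients are, and leaves a multiple of \<open>h\<^sup>l\<^sup>/\<^sup>3\<close>; this is a contradiction as
  \<open>h\<close> tends to \<open>0\<close>.\<close>

lemma sol_not_kin_holder:
  assumes f: "\<And>x v. x > 0 \<Longrightarrow> f (x, v) = sol (x, v)" and R: "R > 0" and e: "e > 0"
  shows "f \<notin> kin_holder (l + e) (H R)"
proof
  define s where "s = l + e"
  define k where "k = nat \<lfloor>s\<rfloor>"
  have s: "s > 0" "real k + (s - \<lfloor>s\<rfloor>) = s" using l e by (auto simp: s_def k_def)
  assume "f \<in> kin_holder (l + e) (H R)"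
  then have "(\<lambda>(t, x, v). f (x, v)) \<in> kin_C k (s - \<lfloor>s\<rfloor>) (UNIV \<times> H R)"
    by (simp add: kin_holder_def s_def k_def)
  from kin_C_imp_local_poly[OF this, unfolded s(2)] obtain M where M: "M \<ge> 0"
    "\<And>z1. z1 \<in> UNIV \<times> H R \<Longrightarrow> \<exists>p\<in>kin_poly k. \<forall>z2\<in>UNIV \<times> H R. dist_kin z1 z2 > 0 \<longrightarrow> z2 \<noteq> z1 \<longrightarrow>
      \<bar>(\<lambda>(t, x, v). f (x, v)) z2 - p z2\<bar> \<le> M * dist_kin z1 z2 powr s" by blast
  define n where "n = Suc k"
  obtain K where K: "K \<ge> 0" "\<And>g x B. \<forall>i\<le>n. \<bar>g (2 ^ i * x)\<bar> \<le> B \<Longrightarrow> \<bar>dyadic_diff n g x\<bar> \<le> K * B"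
    using dyadic_diff_bound[of n] by blast
  define P where "P = (\<Prod>i<n. 2 powr (l / 3) - (2::real) ^ i)"
  have "2 powr (l / 3) - (2::real) ^ i \<noteq> 0" for i
  proof (cases i)
    case 0
    have "2 powr (l / 3) > (1::real)" using l powr_less_mono[of 0 "l / 3" 2] by simp
    then show ?thesis using 0 by (simp only: power_0)
  next
    case (Suc j)
    have "2 powr (l / 3) < 2 powr (1::real)" using l by (intro powr_less_mono) auto
    moreover have "(2::real) ^ 1 \<le> 2 ^ i" using Suc by (intro power_increasing) auto
    ultimately show ?thesis by simp
  qed
  then have P: "P \<noteq> 0" by (simp add: P_def)
  have w0: "w 0 > 0"
  proof -
    obtain c where "c > 0" "\<And>y. c * max 1 \<bar>y\<bar> powr l \<le> w y" using w_lower by auto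
    from this(2)[of 0] this(1) show ?thesis by simp
  qed
  have ineq: "w 0 * \<bar>P\<bar> * 2 powr (l / 3) \<le> K * (M * (2 ^ (n + 1)) powr (s / 3)) * h powr (e / 3)"
    if h: "h > 0" "2 ^ (n + 1) * h < R^3" for h
  proof -
    have le: "x < R^3" if "x \<le> 2 ^ (n + 1) * h" for x using that h by simp
    have "1 * h \<le> 2 ^ (n + 1) * h" using h by (intro mult_right_mono one_le_power) auto
    then have zh: "(0, h, 0) \<in> UNIV \<times> H R" using h le[of h] R by (simp add: H_def)
    obtain p where p: "p \<in> kin_poly k" "\<And>z2. z2 \<in> UNIV \<times> H R \<Longrightarrow> dist_kin (0, h, 0) z2 > 0 \<Longrightarrow> z2 \<noteq> (0, h, 0) \<Longrightarrow>
      \<bar>(\<lambda>(t, x, v). f (x, v)) z2 - p z2\<bar> \<le> M * dist_kin (0, h, 0) z2 powr s"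
      using M(2)[OF zh] by blast
    define g where "g x = w 0 * x powr (l / 3) - p (0, x, 0)" for x
    \<comment> \<open>the points start at \<open>2 h\<close> because the centre \<open>h\<close> itself is excluded from the seminorm\<close>
    have "\<bar>g (2 ^ i * (2 * h))\<bar> \<le> M * ((2 ^ (n + 1) * h) powr (s / 3))" if i: "i \<le> n" for i
    proof -
      define x where "x = 2 ^ i * (2 * h)"
      have x1: "x \<le> 2 ^ (n + 1) * h"
        using h i power_increasing[of i n "2::real"] by (simp add: x_def)
      have "(1::real) \<le> 2 ^ i" by simp
      then have x2: "2 * h \<le> x" unfolding x_def using h by (simp add: mult_left_le)
      have x3: "x > 0" using x2 h by linarith
      have d: "dist_kin (0, h, 0) (0, x, 0) = (x - h) powr (1/3)"
        unfolding dist_kin_x using x2 h by (simp add: abs_minus_commute)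
      have "\<bar>f (x, 0) - p (0, x, 0)\<bar> \<le> M * dist_kin (0, h, 0) (0, x, 0) powr s"
        using p(2)[of "(0, x, 0)"] x2 x3 h le[OF x1] R by (simp add: H_def d)
      also have "dist_kin (0, h, 0) (0, x, 0) powr s = (x - h) powr (s / 3)"
        unfolding d by (simp add: powr_powr)
      also have "M * (x - h) powr (s / 3) \<le> M * (2 ^ (n + 1) * h) powr (s / 3)"
        using M(1) s(1) x1 x2 h by (intro mult_left_mono powr_mono2) auto
      finally show ?thesis using f[OF x3, of 0] x3 by (simp add: g_def sol_def x_def mult.commute)
    qed
    then have "\<bar>dyadic_diff n g (2 * h)\<bar> \<le> K * (M * ((2 ^ (n + 1) * h) powr (s / 3)))" by (intro K(2)) auto
    moreover have "dyadic_diff n g (2 * h) = w 0 * (P * (2 * h) powr (l / 3))"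
    proof -
      have "dyadic_diff n (\<lambda>x. x powr (l / 3)) (2 * h) = P * (2 * h) powr (l / 3)"
        unfolding P_def by (rule dyadic_diff_homogeneous) (use h in \<open>auto simp: powr_mult\<close>)
      moreover have "dyadic_diff n (\<lambda>x. p (0, x, 0)) (2 * h) = 0"
        unfolding n_def using p(1) h by (intro dyadic_diff_kin_poly) auto
      ultimately show ?thesis unfolding g_def dyadic_diff_diff dyadic_diff_cmult by simp
    qed
    moreover have "(2 ^ (n + 1) * h) powr (s / 3) = (2 ^ (n + 1)) powr (s / 3) * (h powr (e / 3) * h powr (l / 3))"
      using h by (simp add: powr_mult powr_add[symmetric] s_def add_divide_distrib add.commute)
    moreover have "(2 * h) powr (l / 3) = 2 powr (l / 3) * h powr (l / 3)" using h by (simp add: powr_mult)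
    ultimately have "(w 0 * \<bar>P\<bar> * 2 powr (l / 3)) * h powr (l / 3) \<le> (K * (M * (2 ^ (n + 1)) powr (s / 3)) * h powr (e / 3)) * h powr (l / 3)"
      using w0 by (simp only: abs_mult) (simp add: mult_ac)
    then show ?thesis using h by simp
  qed
  have "((\<lambda>h. h powr (e / 3)) \<longlongrightarrow> 0) (at_right 0)" using e by real_asymp
  then have "((\<lambda>h. K * (M * (2 ^ (n + 1)) powr (s / 3)) * h powr (e / 3)) \<longlongrightarrow> K * (M * (2 ^ (n + 1)) powr (s / 3)) * 0) (at_right 0)"
    by (intro tendsto_intros)
  moreover have "\<forall>\<^sub>F h in at_right 0. w 0 * \<bar>P\<bar> * 2 powr (l / 3) \<le> K * (M * (2 ^ (n + 1)) powr (s / 3)) * h powr (e / 3)"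
  proof -
    have "R^3 / 2 ^ (n + 1) > 0" using R by simp
    from eventually_at_right_real[OF this] show ?thesis
      by eventually_elim (rule ineq, auto simp: field_simps)
  qed
  ultimately have "w 0 * \<bar>P\<bar> * 2 powr (l / 3) \<le> K * (M * (2 ^ (n + 1)) powr (s / 3)) * 0"
    by (rule tendsto_lowerbound) simp
  moreover have "w 0 * \<bar>P\<bar> * 2 powr (l / 3) > 0" using w0 P by simp
  ultimately show False by simp
qed

end

section \<open>Test functions and integration over boxes\<close>

lemma test_fun_facts:
  fixes \<psi> :: "real \<times> real \<Rightarrow> real"
  assumes "test_fun D \<psi>"
  shows "continuous_on S \<psi>" "continuous_on S (dx \<psi>)" "continuous_on S (dv \<psi>)"
    and "((\<lambda>x. \<psi> (x, v)) has_real_derivative dx \<psi> (x, v)) (at x)"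
    and "((\<lambda>v. \<psi> (x, v)) has_real_derivative dv \<psi> (x, v)) (at v)"
    and "\<psi> z \<noteq> 0 \<Longrightarrow> z \<in> supp \<psi>"
proof -
  have "cont_diff (Suc 0) \<psi>" using assms unfolding test_fun_def by blast
  then have d: "\<And>z. \<psi> differentiable (at z)" and c: "\<And>w. continuous_on UNIV (\<lambda>z. frechet_derivative \<psi> (at z) w)"
    by auto
  have "continuous_on UNIV \<psi>"
    using d by (intro continuous_at_imp_continuous_on ballI differentiable_imp_continuous_within)
  then show "continuous_on S \<psi>" by (rule continuous_on_subset) auto
  have X: "((\<lambda>x. \<psi> (x, v)) has_real_derivative frechet_derivative \<psi> (at (x, v)) (1, 0)) (at x)" for x v
  proof -
    let ?D = "frechet_derivative \<psi> (at (x, v))"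
    have D: "(\<psi> has_derivative ?D) (at (x, v))" using d[of "(x, v)"] unfolding frechet_derivative_works .
    interpret D: bounded_linear ?D using D by (rule has_derivative_bounded_linear)
    have "((\<lambda>x. (x, v)) has_derivative (\<lambda>h. (h, 0))) (at x)" by (auto intro!: derivative_eq_intros)
    from has_derivative_compose[OF this D]
    have "((\<lambda>x. \<psi> (x, v)) has_derivative (\<lambda>h. ?D (h, 0))) (at x)" .
    moreover have "(\<lambda>h. ?D (h, 0)) = (*) (?D (1, 0))"
    proof
      fix h
      show "?D (h, 0) = ?D (1, 0) * h" using D.scaleR[of h "(1, 0)"] by (simp add: mult.commute)
    qed
    ultimately show ?thesis unfolding has_field_derivative_def by simp
  qed
  have V: "((\<lambda>v. \<psi> (x, v)) has_real_derivative frechet_derivative \<psi> (at (x, v)) (0, 1)) (at v)" for x v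
  proof -
    let ?D = "frechet_derivative \<psi> (at (x, v))"
    have D: "(\<psi> has_derivative ?D) (at (x, v))" using d[of "(x, v)"] unfolding frechet_derivative_works .
    interpret D: bounded_linear ?D using D by (rule has_derivative_bounded_linear)
    have "((\<lambda>v. (x, v)) has_derivative (\<lambda>h. (0, h))) (at v)" by (auto intro!: derivative_eq_intros)
    from has_derivative_compose[OF this D]
    have "((\<lambda>v. \<psi> (x, v)) has_derivative (\<lambda>h. ?D (0, h))) (at v)" .
    moreover have "(\<lambda>h. ?D (0, h)) = (*) (?D (0, 1))"
    proof
      fix h
      show "?D (0, h) = ?D (0, 1) * h" using D.scaleR[of h "(0, 1)"] by (simp add: mult.commute)
    qed
    ultimately show ?thesis unfolding has_field_derivative_def by simp
  qed
  have ex: "dx \<psi> = (\<lambda>z. frechet_derivative \<psi> (at z) (1, 0))" and ev: "dv \<psi> = (\<lambda>z. frechet_derivative \<psi> (at z) (0, 1))"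
    using DERIV_imp_deriv[OF X] DERIV_imp_deriv[OF V] by (auto simp: dx_def dv_def fun_eq_iff)
  show "continuous_on S (dx \<psi>)" "continuous_on S (dv \<psi>)"
    unfolding ex ev using c continuous_on_subset by blast+
  show "((\<lambda>x. \<psi> (x, v)) has_real_derivative dx \<psi> (x, v)) (at x)" unfolding ex by (rule X)
  show "((\<lambda>v. \<psi> (x, v)) has_real_derivative dv \<psi> (x, v)) (at v)" unfolding ev by (rule V)
  show "\<psi> z \<noteq> 0 \<Longrightarrow> z \<in> supp \<psi>" unfolding supp_def by (rule subsetD[OF closure_subset]) simp
qed

lemma H_sets [measurable]: "H R \<in> sets borel" and open_H: "open (H R)"
proof -
  show "open (H R)" unfolding H_def by (intro open_Times) auto
  then show "H R \<in> sets borel" by simp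
qed

text \<open>Fubini's theorem with the indicator of the box split between the two variables.\<close>

lemma set_integral_box_iterated:
  fixes F :: "real \<times> real \<Rightarrow> real"
  assumes "set_integrable lborel ({0<..<c} \<times> {-r<..<r}) F"
  shows "integrable lborel (\<lambda>x. indicator {0<..<c} x * (LINT v:{-r<..<r}|lborel. F (x, v)))"
    and "(LINT z:{0<..<c} \<times> {-r<..<r}|lborel. F z) = (LINT x|lborel. indicator {0<..<c} x * (LINT v:{-r<..<r}|lborel. F (x, v)))"
proof -
  let ?F = "\<lambda>z. indicator ({0<..<c} \<times> {-r<..<r}) z *\<^sub>R F z"
  have I: "integrable (lborel \<Otimes>\<^sub>M lborel) ?F" using assms by (simp add: set_integrable_def lborel_prod)
  have e: "(LINT v|lborel. ?F (x, v)) = indicator {0<..<c} x * (LINT v:{-r<..<r}|lborel. F (x, v))" for x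
  proof -
    have "(\<lambda>v. ?F (x, v)) = (\<lambda>v. indicator {0<..<c} x * (indicator {-r<..<r} v *\<^sub>R F (x, v)))"
      by (auto simp: fun_eq_iff indicator_def)
    then show ?thesis unfolding set_lebesgue_integral_def by (simp only: integral_mult_right_zero)
  qed
  show "integrable lborel (\<lambda>x. indicator {0<..<c} x * (LINT v:{-r<..<r}|lborel. F (x, v)))"
    using lborel_pair.integrable_fst'[OF I] unfolding e .
  show "(LINT z:{0<..<c} \<times> {-r<..<r}|lborel. F z) = (LINT x|lborel. indicator {0<..<c} x * (LINT v:{-r<..<r}|lborel. F (x, v)))"
    using lborel_pair.integral_fst'[OF I] unfolding e by (simp add: set_lebesgue_integral_def lborel_prod)
qed

lemma LINT_eq_integral_Icc:
  fixes f :: "real \<Rightarrow> real"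
  assumes "continuous_on {a..b} f"
  shows "(LINT v:{a<..<b}|lborel. f v) = integral {a..b} f"
proof -
  have "set_integrable lborel {a..b} f"
    using assms by (rule borel_integrable_atLeastAtMost')
  then have "set_integrable lborel {a<..<b} f"
    by (rule set_integrable_subset) auto
  from set_borel_integral_eq_integral(2)[OF this] show ?thesis
    by (simp add: integral_open_interval_real)
qed

lemma set_integrable_mult_bounded:
  fixes f g :: "real \<times> real \<Rightarrow> real"
  assumes f: "set_integrable lborel S f" and g: "set_borel_measurable lborel S g"
    and b: "\<And>z. z \<in> S \<Longrightarrow> \<bar>g z\<bar> \<le> B"
  shows "set_integrable lborel S (\<lambda>z. f z * g z)"
  unfolding set_integrable_def
proof (rule Bochner_Integration.integrable_bound)
  show "integrable lborel (\<lambda>z. B * (indicator S z *\<^sub>R f z))"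
    using f by (simp add: set_integrable_def)
  have "(\<lambda>z. (indicator S z *\<^sub>R f z) * (indicator S z *\<^sub>R g z)) \<in> borel_measurable lborel"
    using f g by (auto simp: set_integrable_def set_borel_measurable_def)
  moreover have "(\<lambda>z. (indicator S z *\<^sub>R f z) * (indicator S z *\<^sub>R g z)) = (\<lambda>z. indicator S z *\<^sub>R (f z * g z))"
    by (auto simp: indicator_def fun_eq_iff)
  ultimately show "(\<lambda>z. indicator S z *\<^sub>R (f z * g z)) \<in> borel_measurable lborel" by simp
  show "AE z in lborel. norm (indicator S z *\<^sub>R (f z * g z)) \<le> norm (B * (indicator S z *\<^sub>R f z))"
  proof (rule AE_I2)
    fix z
    show "norm (indicator S z *\<^sub>R (f z * g z)) \<le> norm (B * (indicator S z *\<^sub>R f z))"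
    proof (cases "z \<in> S")
      case True
      then have "\<bar>f z\<bar> * \<bar>g z\<bar> \<le> \<bar>f z\<bar> * \<bar>B\<bar>" using b[OF True] by (intro mult_left_mono) auto
      then show ?thesis using True by (simp add: abs_mult mult.commute)
    qed simp
  qed
qed

lemma continuous_bounded_on_box:
  fixes g :: "real \<times> real \<Rightarrow> real"
  assumes "continuous_on ({0..c} \<times> {-r..r}) g"
  obtains B where "B \<ge> 0" "\<And>z. z \<in> {0..c} \<times> {-r..r} \<Longrightarrow> \<bar>g z\<bar> \<le> B"
proof -
  have "compact (g ` ({0..c} \<times> {-r..r}))"
    by (intro compact_continuous_image assms compact_Times) auto
  from compact_imp_bounded[OF this] obtain B where "\<And>y. y \<in> g ` ({0..c} \<times> {-r..r}) \<Longrightarrow> norm y \<le> B"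
    unfolding bounded_iff by blast
  then have "\<And>z. z \<in> {0..c} \<times> {-r..r} \<Longrightarrow> \<bar>g z\<bar> \<le> max B 0" by (force simp: le_max_iff_disj)
  then show ?thesis by (intro that[of "max B 0"]) auto
qed

lemma set_borel_measurable_H:
  assumes "continuous_on (H R) (f :: real \<times> real \<Rightarrow> real)"
  shows "set_borel_measurable lborel (H R) f"
proof -
  have "(\<lambda>z. indicator (H R) z *\<^sub>R f z) \<in> borel_measurable borel"
    by (rule borel_measurable_continuous_on_indicator[OF _ assms]) simp
  then show ?thesis by (simp add: set_borel_measurable_def)
qed

lemma set_integrable_box:
  fixes g :: "real \<times> real \<Rightarrow> real"
  assumes "continuous_on ({0..c} \<times> {-r..r}) g"
  shows "set_integrable lborel ({0<..<c} \<times> {-r<..<r}) g"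
proof -
  have "integrable lborel (\<lambda>z. indicator ({0..c} \<times> {-r..r}) z *\<^sub>R g z)"
    by (rule borel_integrable_compact[OF _ assms]) (intro compact_Times; simp)
  then have "set_integrable lborel ({0..c} \<times> {-r..r}) g" by (simp add: set_integrable_def)
  then show ?thesis by (rule set_integrable_subset) (auto intro!: borel_open open_Times)
qed

text \<open>The quadratic form \<open>\<integral> (s f + t g)\<^sup>2\<close> in \<open>(s, t)\<close> is nonnegative; its discriminant gives the inequality.\<close>

lemma Cauchy_Schwarz_set_integral:
  fixes f g :: "'a \<Rightarrow> real"
  assumes f: "set_integrable M S (\<lambda>z. (f z)\<^sup>2)" and g: "set_integrable M S (\<lambda>z. (g z)\<^sup>2)"
    and fg: "set_integrable M S (\<lambda>z. f z * g z)"
  shows "\<bar>LINT z:S|M. f z * g z\<bar> \<le> sqrt (LINT z:S|M. (f z)\<^sup>2) * sqrt (LINT z:S|M. (g z)\<^sup>2)"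
proof -
  define A where "A = (LINT z:S|M. (f z)\<^sup>2)"
  define B where "B = (LINT z:S|M. (g z)\<^sup>2)"
  define C where "C = (LINT z:S|M. f z * g z)"
  have q: "0 \<le> A * s^2 + 2 * s * t * C + B * t^2" for s t
  proof -
    have "0 \<le> (LINT z:S|M. (s * f z + t * g z)\<^sup>2)"
      unfolding set_lebesgue_integral_def by (intro integral_nonneg_AE AE_I2) (simp add: indicator_def)
    also have "(\<lambda>z. (s * f z + t * g z)\<^sup>2) = (\<lambda>z. s^2 * (f z)\<^sup>2 + (2 * s * t) * (f z * g z) + t^2 * (g z)\<^sup>2)"
      by (simp add: power2_eq_square algebra_simps)
    also have "(LINT z:S|M. s^2 * (f z)\<^sup>2 + (2 * s * t) * (f z * g z) + t^2 * (g z)\<^sup>2)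
        = s^2 * A + (2 * s * t) * C + t^2 * B"
    proof -
      have i: "set_integrable M S (\<lambda>z. s^2 * (f z)\<^sup>2)" "set_integrable M S (\<lambda>z. (2 * s * t) * (f z * g z))"
        "set_integrable M S (\<lambda>z. t^2 * (g z)\<^sup>2)"
        using f g fg by (auto intro: set_integrable_mult_right)
      show ?thesis
        unfolding set_integral_add(2)[OF set_integral_add(1)[OF i(1,2)] i(3)] set_integral_add(2)[OF i(1,2)]
          set_integral_mult_right A_def B_def C_def ..
    qed
    finally show ?thesis by (simp add: mult_ac)
  qed
  have A: "A \<ge> 0" using q[of 1 0] by simp
  have "C^2 \<le> A * B"
  proof (cases "A = 0")
    case True
    have "C = 0"
    proof (rule ccontr)
      assume "C \<noteq> 0"
      then show False using q[of "- (B + 1) / (2 * C)" 1] True by (simp add: field_simps)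
    qed
    then show ?thesis using True by simp
  next
    case False
    have "0 \<le> A * C^2 + 2 * C * (- A) * C + B * A^2" using q[of C "- A"] by simp
    then have "0 \<le> A * (A * B - C^2)" by (simp add: power2_eq_square algebra_simps)
    then show ?thesis using False A by (simp add: zero_le_mult_iff)
  qed
  then have "sqrt (C^2) \<le> sqrt (A * B)" by (rule real_sqrt_le_mono)
  then show ?thesis unfolding A_def[symmetric] B_def[symmetric] C_def[symmetric] by (simp add: real_sqrt_mult)
qed

lemma set_integrable_powr_Ioo:
  assumes "0 \<le> e" "e < (1::real)" "c > 0"
  shows "set_integrable lborel {0<..<c} (\<lambda>x. x powr (- e))"
proof -
  have "((\<lambda>x. x powr (- e)) has_integral (c powr (- e + 1) / (- e + 1))) {0..c}"
    using assms by (intro has_integral_powr_from_0) auto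
  then have "((\<lambda>x. x powr (- e)) has_integral (c powr (- e + 1) / (- e + 1))) {0<..<c}"
    by (simp add: has_integral_Icc_iff_Ioo)
  moreover have "set_borel_measurable lborel {0<..<c} (\<lambda>x::real. x powr (- e))"
    unfolding set_borel_measurable_def by measurable
  ultimately show ?thesis by (intro nonneg_has_integral_lborel(1)) auto
qed

text \<open>The homogeneous dimension of the \<open>(x, v)\<close>-plane is \<open>3 + 1 = 4\<close>.  Splitting \<open>e\<close> in the proportion \<open>3 : 1\<close>
  bounds the power of the norm by \<open>x\<^sup>-\<^sup>e\<^sup>/\<^sup>4 \<bar>v\<bar>\<^sup>-\<^sup>e\<^sup>/\<^sup>4\<close>, a product of integrable powers.\<close>

lemma set_integrable_kin_norm_powr:
  assumes e: "0 \<le> e" "e < 4" and R: "R > 0"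
  shows "set_integrable lborel (H R) (\<lambda>z. kin_norm z powr (- e))"
proof -
  define a where "a = e / 4"
  have a: "0 \<le> a" "a < 1" using e by (auto simp: a_def)
  define k where "k x = indicator {0<..<R^3} x * x powr (- a)" for x :: real
  define m where "m v = indicator {-R<..<R} v * \<bar>v\<bar> powr (- a)" for v :: real
  have k: "integrable lborel k"
    using set_integrable_powr_Ioo[OF a, of "R^3"] R by (simp add: set_integrable_def k_def[abs_def])
  have m: "integrable lborel m"
  proof -
    define m0 where "m0 v = indicator {0<..<R} v * v powr (- a)" for v :: real
    have 1: "integrable lborel m0"
      using set_integrable_powr_Ioo[OF a R] by (simp add: set_integrable_def m0_def[abs_def])
    have 2: "integrable lborel (\<lambda>v. m0 (0 + (-1) * v))"
      using 1 by (subst lborel_integrable_real_affine_iff) auto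
    have "m = (\<lambda>v. m0 v + m0 (0 + (-1) * v))"
      by (auto simp: m_def m0_def fun_eq_iff indicator_def)
    then show ?thesis using Bochner_Integration.integrable_add[OF 1 2] by simp
  qed
  have km: "integrable lborel (\<lambda>z. k (fst z) * m (snd z))"
  proof -
    have [measurable]: "k \<in> borel_measurable borel" "m \<in> borel_measurable borel"
      unfolding k_def[abs_def] m_def[abs_def] by measurable
    have "integrable (lborel \<Otimes>\<^sub>M lborel) (\<lambda>z. k (fst z) * m (snd z))"
    proof (rule lborel_pair.Fubini_integrable)
      show "(\<lambda>z. k (fst z) * m (snd z)) \<in> borel_measurable (lborel \<Otimes>\<^sub>M lborel)" by measurable
      show "integrable lborel (\<lambda>x. LINT y|lborel. norm (k (fst (x, y)) * m (snd (x, y))))"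
        using k by (simp add: abs_mult)
      show "AE x in lborel. integrable lborel (\<lambda>y. k (fst (x, y)) * m (snd (x, y)))"
        using m by simp
    qed
    then show ?thesis by (simp add: lborel_prod)
  qed
  \<comment> \<open>on the line \<open>v = 0\<close> the convention \<open>0 powr (- a) = 0\<close> makes the product bound false\<close>
  have nz: "AE z in lborel. snd (z :: real \<times> real) \<noteq> 0"
  proof -
    have "AE z in lborel \<Otimes>\<^sub>M lborel. snd (z :: real \<times> real) \<noteq> (0::real)"
    proof (rule lborel_pair.AE_pair_measure)
      show "{x \<in> space (lborel \<Otimes>\<^sub>M lborel). snd x \<noteq> (0::real)} \<in> sets (lborel \<Otimes>\<^sub>M (lborel :: real measure))"
        by measurable
      show "AE x in lborel. AE y in lborel. snd (x :: real, y) \<noteq> (0::real)"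
        using AE_lborel_singleton[of "0::real"] by simp
    qed
    then show ?thesis unfolding lborel_prod .
  qed
  show ?thesis
    unfolding set_integrable_def
  proof (rule Bochner_Integration.integrable_bound[OF km])
    have "continuous_on (H R) (\<lambda>z. kin_norm z powr (- e))"
      unfolding kin_norm_def[abs_def]
      by (intro continuous_intros continuous_on_powr') (auto simp: H_def max_def)
    from set_borel_measurable_H[OF this] show "(\<lambda>z. indicator (H R) z *\<^sub>R kin_norm z powr (- e)) \<in> borel_measurable lborel"
      by (simp add: set_borel_measurable_def)
    show "AE z in lborel. norm (indicator (H R) z *\<^sub>R kin_norm z powr (- e)) \<le> norm (k (fst z) * m (snd z))"
      using nz
    proof eventually_elim
      case (elim z)
      show ?case
      proof (cases "z \<in> H R")
        case True
        obtain x v where z: "z = (x, v)" by (cases z)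
        have x: "0 < x" "x < R^3" "-R < v" "v < R" "v \<noteq> 0" using True elim by (auto simp: z H_def)
        have r: "kin_norm z powr (- e) = kin_norm z powr (- (3 * a)) * kin_norm z powr (- a)"
          by (simp add: powr_add[symmetric] a_def)
        have "kin_norm z powr (- (3 * a)) \<le> (x powr (1/3)) powr (- (3 * a))"
          using x a by (intro powr_mono2') (auto simp: z kin_norm_def)
        also have "\<dots> = x powr (- a)" by (simp add: powr_powr)
        finally have 1: "kin_norm z powr (- (3 * a)) \<le> x powr (- a)" .
        have 2: "kin_norm z powr (- a) \<le> \<bar>v\<bar> powr (- a)"
          using x a by (intro powr_mono2') (auto simp: z kin_norm_def)
        have "kin_norm z powr (- e) \<le> x powr (- a) * \<bar>v\<bar> powr (- a)"
          unfolding r using 1 2 by (intro mult_mono) auto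
        then show ?thesis using True x by (simp add: z k_def m_def)
      qed simp
    qed
  qed
qed

section \<open>The weak formulation\<close>

lemma frontier_H:
  assumes "R > 0"
  shows "frontier (H R) = {0..R^3} \<times> {-R..R} - H R"
proof -
  have "closure (H R) = {0..R^3} \<times> {-R..R}"
    using assms by (simp add: H_def closure_Times)
  then show ?thesis using open_H[of R] by (simp add: frontier_def interior_open)
qed

lemma has_integral_by_parts_Icc:
  fixes f g :: "real \<Rightarrow> real"
  assumes "a \<le> b" "\<And>v. (f has_real_derivative f' v) (at v)" "\<And>v. (g has_real_derivative g' v) (at v)"
  shows "((\<lambda>v. f' v * g v + g' v * f v) has_integral (f b * g b - f a * g a)) {a..b}"
proof (rule fundamental_theorem_of_calculus[OF assms(1)])
  fix v
  show "((\<lambda>v. f v * g v) has_vector_derivative (f' v * g v + g' v * f v)) (at v within {a..b})"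
    using DERIV_mult[OF assms(2,3)] unfolding has_real_derivative_iff_has_vector_derivative
    by (rule has_vector_derivative_at_within)
qed

context kinetic_profile
begin

text \<open>The derivative in \<open>v\<close> is homogeneous of degree \<open>l - 1\<close>, so the homogeneous dimension \<open>4\<close> decides about
  integrability.  As \<open>l > 0\<close>, exponents slightly above \<open>4\<close> are allowed.\<close>

lemma in_Lp_sol_v:
  assumes p: "p > 0" "p * (1 - l) < 4" and R: "R > 0"
  shows "in_Lp p (H R) sol_v"
proof -
  obtain c where c: "c > 0" "\<And>x v. x > 0 \<Longrightarrow> \<bar>sol_v (x, v)\<bar> \<le> c * kin_norm (x, v) powr (l - 1)"
    using sol_v_bound by blast
  have "continuous_on (H R) sol_v" by (rule continuous_on_interior) (auto simp: H_def)
  then have m: "set_borel_measurable lborel (H R) sol_v" by (rule set_borel_measurable_H)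
  have "set_integrable lborel (H R) (\<lambda>z. \<bar>sol_v z\<bar> powr p)"
    unfolding set_integrable_def
  proof (rule Bochner_Integration.integrable_bound)
    show "integrable lborel (\<lambda>z. c powr p * (indicator (H R) z *\<^sub>R kin_norm z powr (- (p * (1 - l)))))"
      using set_integrable_kin_norm_powr[of "p * (1 - l)" R] p R l by (simp add: set_integrable_def)
    have "(\<lambda>z. \<bar>indicator (H R) z *\<^sub>R sol_v z\<bar> powr p) \<in> borel_measurable lborel"
      using m unfolding set_borel_measurable_def by measurable
    moreover have "(\<lambda>z. \<bar>indicator (H R) z *\<^sub>R sol_v z\<bar> powr p) = (\<lambda>z. indicator (H R) z *\<^sub>R \<bar>sol_v z\<bar> powr p)"
      by (auto simp: indicator_def fun_eq_iff)
    ultimately show "(\<lambda>z. indicator (H R) z *\<^sub>R \<bar>sol_v z\<bar> powr p) \<in> borel_measurable lborel" by simp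
    show "AE z in lborel. norm (indicator (H R) z *\<^sub>R \<bar>sol_v z\<bar> powr p)
       \<le> norm (c powr p * (indicator (H R) z *\<^sub>R kin_norm z powr (- (p * (1 - l)))))"
    proof (rule AE_I2)
      fix z
      show "norm (indicator (H R) z *\<^sub>R \<bar>sol_v z\<bar> powr p) \<le> norm (c powr p * (indicator (H R) z *\<^sub>R kin_norm z powr (- (p * (1 - l)))))"
      proof (cases "z \<in> H R")
        case True
        then have "\<bar>sol_v z\<bar> \<le> c * kin_norm z powr (l - 1)" using c(2)[of "fst z" "snd z"] by (auto simp: H_def)
        then have "\<bar>sol_v z\<bar> powr p \<le> (c * kin_norm z powr (l - 1)) powr p" using p by (intro powr_mono2) auto
        also have "\<dots> = c powr p * kin_norm z powr ((l - 1) * p)" using c(1) by (simp add: powr_mult powr_powr)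
        also have "(l - 1) * p = - (p * (1 - l))" by (simp add: algebra_simps)
        finally show ?thesis using True c(1) by simp
      qed simp
    qed
  qed
  with m show ?thesis by (simp add: in_Lp_def)
qed

lemma set_integrable_sol_v: "R > 0 \<Longrightarrow> set_integrable lborel (H R) sol_v"
proof -
  assume R: "R > 0"
  have "in_Lp 1 (H R) sol_v" using l R by (intro in_Lp_sol_v) auto
  then have m: "set_borel_measurable lborel (H R) sol_v" and i: "set_integrable lborel (H R) (\<lambda>z. \<bar>sol_v z\<bar>)"
    by (auto simp: in_Lp_def)
  show ?thesis
    unfolding set_integrable_def
    by (rule Bochner_Integration.integrable_bound[OF i[unfolded set_integrable_def]])
       (use m in \<open>auto simp: set_borel_measurable_def abs_mult\<close>)
qed

lemma sol_continuous_on: "S \<subseteq> {0..} \<times> UNIV \<Longrightarrow> continuous_on S sol"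
  by (rule continuous_on_subset[OF sol_continuous])

lemma sol_slice_continuous:
  shows "x \<ge> 0 \<Longrightarrow> continuous_on S (\<lambda>v. sol (x, v))"
    and "x > 0 \<Longrightarrow> continuous_on S (\<lambda>v. sol_v (x, v))"
    and "x > 0 \<Longrightarrow> continuous_on S (\<lambda>v. sol_x (x, v))"
proof -
  show "x \<ge> 0 \<Longrightarrow> continuous_on S (\<lambda>v. sol (x, v))"
    by (rule continuous_on_compose2[OF sol_continuous]) (auto intro!: continuous_intros)
  have i: "continuous_on ({0<..} \<times> UNIV) sol_v" "continuous_on ({0<..} \<times> UNIV) sol_x"
    by (rule continuous_on_interior; auto)+
  show "x > 0 \<Longrightarrow> continuous_on S (\<lambda>v. sol_v (x, v))"
    by (rule continuous_on_compose2[OF i(1)]) (auto intro!: continuous_intros)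
  show "x > 0 \<Longrightarrow> continuous_on S (\<lambda>v. sol_x (x, v))"
    by (rule continuous_on_compose2[OF i(2)]) (auto intro!: continuous_intros)
qed

lemma slice_by_parts:
  assumes \<psi>: "test_fun D \<psi>" and x: "x > 0" and z: "\<psi> (x, R) = 0" "\<psi> (x, - R) = 0" and R: "R > 0"
  shows "((\<lambda>v. (v * sol_x (x, v)) * \<psi> (x, v) + dv \<psi> (x, v) * sol_v (x, v)) has_integral 0) {-R..R}"
    and "((\<lambda>v. sol_v (x, v) * \<psi> (x, v) + dv \<psi> (x, v) * sol (x, v)) has_integral 0) {-R..R}"
proof -
  show "((\<lambda>v. (v * sol_x (x, v)) * \<psi> (x, v) + dv \<psi> (x, v) * sol_v (x, v)) has_integral 0) {-R..R}"
    using has_integral_by_parts_Icc[of "-R" R, OF _ DERIV_sol_vv[OF x] test_fun_facts(5)[OF \<psi>, of x]] R z by simp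
  show "((\<lambda>v. sol_v (x, v) * \<psi> (x, v) + dv \<psi> (x, v) * sol (x, v)) has_integral 0) {-R..R}"
    using has_integral_by_parts_Icc[of "-R" R, OF _ DERIV_sol_v[OF x] test_fun_facts(5)[OF \<psi>, of x]] R z by simp
qed

lemma test_fun_slice_continuous:
  assumes "test_fun D \<psi>"
  shows "continuous_on S (\<lambda>v. \<psi> (x, v))" "continuous_on S (\<lambda>v. dx \<psi> (x, v))" "continuous_on S (\<lambda>v. dv \<psi> (x, v))"
proof -
  have p: "continuous_on S (\<lambda>v. (x, v))" by (intro continuous_intros)
  show "continuous_on S (\<lambda>v. \<psi> (x, v))" "continuous_on S (\<lambda>v. dx \<psi> (x, v))" "continuous_on S (\<lambda>v. dv \<psi> (x, v))"
    by (rule continuous_on_compose2[OF test_fun_facts(1)[OF assms, of UNIV] p], simp)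
       (rule continuous_on_compose2[OF test_fun_facts(2)[OF assms, of UNIV] p], simp,
        rule continuous_on_compose2[OF test_fun_facts(3)[OF assms, of UNIV] p], simp)
qed

lemma set_integrable_sol_v_mult:
  assumes R: "R > 0" and g: "continuous_on UNIV g"
  shows "set_integrable lborel (H R) (\<lambda>z. sol_v z * g z)"
proof -
  obtain B where B: "\<And>z. z \<in> {0..R^3} \<times> {-R..R} \<Longrightarrow> \<bar>g z\<bar> \<le> B"
    using continuous_bounded_on_box[of "R^3" R g] continuous_on_subset[OF g] by blast
  show ?thesis
  proof (rule set_integrable_mult_bounded[OF set_integrable_sol_v[OF R]])
    show "set_borel_measurable lborel (H R) g" 
      by (rule set_borel_measurable_H) (use continuous_on_subset[OF g] in blast)
    show "\<bar>g z\<bar> \<le> B" if "z \<in> H R" for z using that by (intro B) (auto simp: H_def)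
  qed
qed

text \<open>The moment \<open>G(x) = \<integral> v f \<psi> dv\<close> is continuous on \<open>[0, R\<^sup>3]\<close>, vanishes at \<open>R\<^sup>3\<close> and is the boundary term at
  \<open>x = 0\<close>.  For \<open>x > 0\<close> its derivative is \<open>\<integral> v f \<partial>\<^sub>x\<psi> + \<partial>\<^sub>v\<^sub>v f \<psi> dv\<close>, and an integration by parts in \<open>v\<close> turns the
  second term into \<open>- \<integral> \<partial>\<^sub>v f \<partial>\<^sub>v\<psi> dv\<close>.  The fundamental theorem of calculus on \<open>[0, R\<^sup>3]\<close> asks for a derivative
  only in the interior, so the singularity of \<open>\<partial>\<^sub>v f\<close> at the origin does no harm.\<close>

lemma weak_identity:
  assumes \<psi>: "test_fun D \<psi>" and supp: "supp \<psi> \<inter> frontier (H R) \<subseteq> {0} \<times> UNIV" and R: "R > 0"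
  shows "- (LINT z:H R|lborel. sol z * snd z * dx \<psi> z) - (LINT v:{-R<..<R}|lborel. sol (0, v) * \<psi> (0, v) * v)
     + (LINT z:H R|lborel. sol_v z * dv \<psi> z) = 0"
proof -
  define A where "A = R^3"
  have A: "A > 0" using R by (simp add: A_def)
  have zero: "\<psi> (x, v) = 0" if "x > 0" "(x, v) \<in> {0..A} \<times> {-R..R} - H R" for x v
  proof (rule ccontr)
    assume "\<psi> (x, v) \<noteq> 0"
    then have "(x, v) \<in> supp \<psi>" by (rule test_fun_facts(6)[OF \<psi>])
    with that supp frontier_H[OF R] show False by (auto simp: A_def)
  qed
  note c\<psi> = test_fun_facts(1-3)[OF \<psi>]
  note cs = test_fun_slice_continuous[OF \<psi>]
  define G where "G x = integral {-R..R} (\<lambda>v. v * sol (x, v) * \<psi> (x, v))" for x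
  define k where "k z = snd z * sol z * dx \<psi> z - sol_v z * dv \<psi> z" for z
  have Gc: "continuous_on {0..A} G"
  proof -
    have "continuous_on ({0..A} \<times> cbox (-R) R) (\<lambda>(x, v). v * sol (x, v) * \<psi> (x, v))"
      unfolding case_prod_beta prod.collapse
      by (intro continuous_intros sol_continuous_on c\<psi>) auto
    from integral_continuous_on_param[OF this] show ?thesis by (simp add: G_def[abs_def])
  qed
  have Gd: "(G has_real_derivative integral {-R..R} (\<lambda>v. k (x, v))) (at x)" if x: "x \<in> {0<..<A}" for x
  proof -
    define fx where "fx x v = v * (sol_x (x, v) * \<psi> (x, v) + dx \<psi> (x, v) * sol (x, v))" for x v
    have x0: "x > 0" using x by simp
    have "((\<lambda>x. integral (cbox (-R) R) (\<lambda>v. v * sol (x, v) * \<psi> (x, v))) has_field_derivative integral (cbox (-R) R) (fx x)) (at x within {0<..})"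
    proof (rule leibniz_rule_field_derivative[where fx=fx])
      fix x v :: real assume "x \<in> {0<..}"
      then have x0: "x > 0" by simp
      have "((\<lambda>x. v * (sol (x, v) * \<psi> (x, v))) has_field_derivative fx x v) (at x)"
        unfolding fx_def by (intro DERIV_cmult DERIV_mult DERIV_sol_x[OF x0] test_fun_facts(4)[OF \<psi>])
      then show "((\<lambda>x. v * sol (x, v) * \<psi> (x, v)) has_field_derivative fx x v) (at x within {0<..})"
        by (simp add: mult.assoc has_field_derivative_at_within)
    next
      fix x :: real assume "x \<in> {0<..}"
      then show "(\<lambda>v. v * sol (x, v) * \<psi> (x, v)) integrable_on cbox (-R) R"
        by (intro integrable_continuous continuous_intros sol_slice_continuous cs) auto
    next
      have "continuous_on ({0<..} \<times> cbox (-R) R) sol_x" by (rule continuous_on_interior) auto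
      then show "continuous_on ({0<..} \<times> cbox (-R) R) (\<lambda>(x, t). fx x t)"
        unfolding fx_def case_prod_beta prod.collapse
        by (intro continuous_intros sol_continuous_on c\<psi>) auto
    qed (use x0 in auto)
    then have D: "(G has_real_derivative integral {-R..R} (fx x)) (at x)"
      using x0 by (simp add: G_def[abs_def] at_within_open[of _ "{0<..}"])
    have i1: "fx x integrable_on {-R..R}"
      unfolding fx_def by (intro integrable_continuous_real continuous_intros sol_slice_continuous cs) (use x0 in auto)
    have B: "((\<lambda>v. (v * sol_x (x, v)) * \<psi> (x, v) + dv \<psi> (x, v) * sol_v (x, v)) has_integral 0) {-R..R}"
      by (rule slice_by_parts(1)[OF \<psi> x0 _ _ R]; rule zero) (use x R in \<open>auto simp: H_def\<close>)
    have "((\<lambda>v. fx x v - ((v * sol_x (x, v)) * \<psi> (x, v) + dv \<psi> (x, v) * sol_v (x, v))) has_integral (integral {-R..R} (fx x) - 0)) {-R..R}"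
      by (rule has_integral_diff[OF integrable_integral[OF i1] B])
    moreover have "(\<lambda>v. fx x v - ((v * sol_x (x, v)) * \<psi> (x, v) + dv \<psi> (x, v) * sol_v (x, v))) = (\<lambda>v. k (x, v))"
      by (simp add: fx_def k_def fun_eq_iff algebra_simps)
    ultimately have "integral {-R..R} (\<lambda>v. k (x, v)) = integral {-R..R} (fx x)"
      by (simp add: integral_unique)
    with D show ?thesis by simp
  qed
  have FTC: "((\<lambda>x. integral {-R..R} (\<lambda>v. k (x, v))) has_integral (G A - G 0)) {0..A}"
    by (rule fundamental_theorem_of_calculus_interior[OF _ Gc])
       (use A Gd in \<open>auto simp: has_real_derivative_iff_has_vector_derivative[symmetric]\<close>)
  have GA: "G A = 0"
  proof -
    have "integral {-R..R} (\<lambda>v. A' v * \<psi> (A, v)) = integral {-R..R} (\<lambda>v. 0)" for A'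
      by (rule integral_cong) (use A zero[of A] in \<open>auto simp: H_def A_def\<close>)
    then show ?thesis unfolding G_def by simp
  qed
  have HA: "H R = {0<..<A} \<times> {-R<..<R}" by (simp add: H_def A_def)
  have I1: "set_integrable lborel (H R) (\<lambda>z. snd z * sol z * dx \<psi> z)"
    unfolding HA by (rule set_integrable_box) (intro continuous_intros sol_continuous_on c\<psi>; auto)
  have I2: "set_integrable lborel (H R) (\<lambda>z. sol_v z * dv \<psi> z)"
    by (rule set_integrable_sol_v_mult[OF R c\<psi>(3)])
  have Ik: "set_integrable lborel (H R) k" unfolding k_def[abs_def] by (rule set_integral_diff(1)[OF I1 I2])
  have Lk: "(LINT z:H R|lborel. k z) = (LINT z:H R|lborel. snd z * sol z * dx \<psi> z) - (LINT z:H R|lborel. sol_v z * dv \<psi> z)"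
    unfolding k_def[abs_def] by (rule set_integral_diff(2)[OF I1 I2])
  have inner: "(LINT v:{-R<..<R}|lborel. k (x, v)) = integral {-R..R} (\<lambda>v. k (x, v))" if "x > 0" for x
  proof (rule LINT_eq_integral_Icc)
    show "continuous_on {-R..R} (\<lambda>v. k (x, v))" unfolding k_def fst_conv snd_conv
      by (intro continuous_intros sol_slice_continuous cs) (use that in auto)
  qed
  have e: "(\<lambda>x. indicator {0<..<A} x * (LINT v:{-R<..<R}|lborel. k (x, v))) = (\<lambda>x. indicator {0<..<A} x *\<^sub>R integral {-R..R} (\<lambda>v. k (x, v)))"
    using inner by (auto simp: fun_eq_iff indicator_def)
  have oi: "set_integrable lborel {0<..<A} (\<lambda>x. integral {-R..R} (\<lambda>v. k (x, v)))"
    using set_integral_box_iterated(1)[OF Ik[unfolded HA]] unfolding e set_integrable_def .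
  have "(LINT z:H R|lborel. k z) = (LINT x:{0<..<A}|lborel. integral {-R..R} (\<lambda>v. k (x, v)))"
    using set_integral_box_iterated(2)[OF Ik[unfolded HA]]
    unfolding e HA set_lebesgue_integral_def[of lborel "{0<..<A}"] .
  also have "\<dots> = integral {0<..<A} (\<lambda>x. integral {-R..R} (\<lambda>v. k (x, v)))"
    by (rule set_borel_integral_eq_integral(2)[OF oi])
  also have "\<dots> = - G 0"
    using integral_unique[OF FTC] GA by (simp only: integral_open_interval_real diff_0)
  finally have main: "(LINT z:H R|lborel. snd z * sol z * dx \<psi> z) - (LINT z:H R|lborel. sol_v z * dv \<psi> z) = - G 0"
    unfolding Lk .
  have "(LINT v:{-R<..<R}|lborel. sol (0, v) * \<psi> (0, v) * v) = integral {-R..R} (\<lambda>v. sol (0, v) * \<psi> (0, v) * v)"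
    by (rule LINT_eq_integral_Icc) (intro continuous_intros sol_slice_continuous cs; simp)
  also have "\<dots> = G 0" unfolding G_def by (simp add: mult_ac)
  finally have e1: "(LINT v:{-R<..<R}|lborel. sol (0, v) * \<psi> (0, v) * v) = G 0" .
  have e2: "(\<lambda>z. snd z * sol z * dx \<psi> z) = (\<lambda>z. sol z * snd z * dx \<psi> z)" by (simp add: mult_ac)
  show ?thesis using main unfolding e1 e2 by linarith
qed

lemma weak_dv_sol:
  assumes R: "R > 0"
  shows "weak_dv (H R) sol sol_v"
  unfolding weak_dv_def
proof (intro conjI allI impI)
  fix K assume K: "compact K \<and> K \<subseteq> H R"
  then have c: "continuous_on K sol" "continuous_on K sol_v"
    by (auto intro!: continuous_on_interior simp: H_def)
  show "set_integrable lborel K sol" "set_integrable lborel K sol_v"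
    unfolding set_integrable_def
    by (rule borel_integrable_compact[OF conjunct1[OF K] c(1)], rule borel_integrable_compact[OF conjunct1[OF K] c(2)])
next
  fix \<psi> assume \<psi>: "test_fun (H R) \<psi>"
  define A where "A = R^3"
  have HA: "H R = {0<..<A} \<times> {-R<..<R}" by (simp add: H_def A_def)
  have zero: "\<psi> z = 0" if "z \<notin> H R" for z
    using that \<psi> test_fun_facts(6)[OF \<psi>, of z] unfolding test_fun_def by blast
  note c\<psi> = test_fun_facts(1-3)[OF \<psi>]
  have I1: "set_integrable lborel (H R) (\<lambda>z. sol z * dv \<psi> z)"
    unfolding HA by (rule set_integrable_box) (intro continuous_intros sol_continuous_on c\<psi>; auto)
  have I2: "set_integrable lborel (H R) (\<lambda>z. sol_v z * \<psi> z)"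
    by (rule set_integrable_sol_v_mult[OF R c\<psi>(1)])
  define k where "k z = sol z * dv \<psi> z + sol_v z * \<psi> z" for z
  have Ik: "set_integrable lborel (H R) k" unfolding k_def[abs_def] by (rule set_integral_add(1)[OF I1 I2])
  have inner: "(LINT v:{-R<..<R}|lborel. k (x, v)) = 0" if x: "x > 0" for x
  proof -
    have "(LINT v:{-R<..<R}|lborel. k (x, v)) = integral {-R..R} (\<lambda>v. k (x, v))"
      unfolding k_def by (intro LINT_eq_integral_Icc continuous_intros sol_slice_continuous test_fun_slice_continuous[OF \<psi>]) (use x in auto)
    also have "\<dots> = 0"
      by (rule integral_unique, rule has_integral_eq[OF _ slice_by_parts(2)[OF \<psi> x _ _ R]])
         (auto simp: k_def H_def intro!: zero)
    finally show ?thesis .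
  qed
  have "(\<lambda>x. indicator {0<..<A} x * (LINT v:{-R<..<R}|lborel. k (x, v))) = (\<lambda>x. 0)"
    using inner by (auto simp: fun_eq_iff indicator_def)
  then have "(LINT z:H R|lborel. k z) = 0"
    using set_integral_box_iterated(2)[OF Ik[unfolded HA]] by (simp add: HA)
  then show "(LINT z:H R|lborel. sol z * dv \<psi> z) = - (LINT z:H R|lborel. sol_v z * \<psi> z)"
    unfolding k_def[abs_def] set_integral_add(2)[OF I1 I2] by simp
qed

text \<open>The average over \<open>(0, \<epsilon>)\<close> is the difference quotient at \<open>0\<close> of a primitive of the continuous moment \<open>G\<close>.\<close>

lemma is_trace_sol: "is_trace sol (\<lambda>v. sol (0, v))"
  unfolding is_trace_def
proof (intro conjI allI impI)
  fix r :: real assume "r > 0"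
  show "set_integrable lborel {-r..r} (\<lambda>v. sol (0, v) * v)"
    by (intro borel_integrable_atLeastAtMost' continuous_intros sol_slice_continuous) simp
next
  fix \<eta> :: "real \<Rightarrow> real" assume \<eta>: "test_fun UNIV \<eta>"
  have c: "continuous_on S \<eta>" for S
  proof -
    have "cont_diff 0 \<eta>" using \<eta> unfolding test_fun_def by blast
    then show ?thesis by (auto intro: continuous_on_subset)
  qed
  have "bounded (supp \<eta>)" using \<eta> unfolding test_fun_def by (blast intro: compact_imp_bounded)
  then obtain r0 where r0: "\<And>v. v \<in> supp \<eta> \<Longrightarrow> norm v \<le> r0" unfolding bounded_iff by blast
  define r where "r = \<bar>r0\<bar> + 1"
  have z: "\<eta> v = 0" if "v \<notin> {-r<..<r}" for v
  proof (rule ccontr)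
    assume "\<eta> v \<noteq> 0"
    then have "v \<in> supp \<eta>" unfolding supp_def by (intro subsetD[OF closure_subset]) simp
    from r0[OF this] that show False by (auto simp: r_def)
  qed
  then have z': "- r < v \<and> v < r" if "\<eta> v \<noteq> 0" for v using that by fastforce
  define G where "G x = integral {-r..r} (\<lambda>v. sol (x, v) * \<eta> v * v)" for x
  have cF: "continuous_on S (\<lambda>z. sol z * \<eta> (snd z) * snd z)" if "S \<subseteq> {0..} \<times> UNIV" for S
    by (intro continuous_intros sol_continuous_on that continuous_on_compose2[OF c]) auto
  have Gc: "continuous_on {0..1} G"
  proof -
    have "continuous_on ({0..1} \<times> cbox (-r) r) (\<lambda>(x, v). sol (x, v) * \<eta> v * v)"
    proof -
      have "{0..1} \<times> cbox (-r) r \<subseteq> {0..} \<times> UNIV" by auto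
      from cF[OF this] show ?thesis by (simp add: case_prod_beta)
    qed
    from integral_continuous_on_param[OF this] show ?thesis by (simp add: G_def[abs_def])
  qed
  have lim: "((\<lambda>\<epsilon>. integral {0..\<epsilon>} G / \<epsilon>) \<longlongrightarrow> G 0) (at_right 0)"
    using integral_has_real_derivative[OF Gc, of 0]
    by (simp add: has_field_derivative_iff at_within_Icc_at_right)
  have eq: "(LINT z:{0<..<\<epsilon>} \<times> UNIV|lborel. sol z * \<eta> (snd z) * snd z) = integral {0..\<epsilon>} G" if \<epsilon>: "0 < \<epsilon>" "\<epsilon> < 1" for \<epsilon>
  proof -
    let ?F = "\<lambda>z. sol z * \<eta> (snd z) * snd z"
    have "(LINT z:{0<..<\<epsilon>} \<times> UNIV|lborel. ?F z) = (LINT z:{0<..<\<epsilon>} \<times> {-r<..<r}|lborel. ?F z)"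
      unfolding set_lebesgue_integral_def
      by (rule Bochner_Integration.integral_cong[OF refl]) (use z' in \<open>auto simp: indicator_def\<close>)
    also have "\<dots> = (LINT x|lborel. indicator {0<..<\<epsilon>} x * (LINT v:{-r<..<r}|lborel. ?F (x, v)))"
      by (rule set_integral_box_iterated(2), rule set_integrable_box, rule cF) auto
    also have "(\<lambda>x. indicator {0<..<\<epsilon>} x * (LINT v:{-r<..<r}|lborel. ?F (x, v))) = (\<lambda>x. indicator {0<..<\<epsilon>} x *\<^sub>R G x)"
    proof
      fix x
      show "indicator {0<..<\<epsilon>} x * (LINT v:{-r<..<r}|lborel. ?F (x, v)) = indicator {0<..<\<epsilon>} x *\<^sub>R G x"
      proof (cases "x \<in> {0<..<\<epsilon>}")
        case True
        then have "(LINT v:{-r<..<r}|lborel. ?F (x, v)) = G x"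
          unfolding G_def snd_conv by (intro LINT_eq_integral_Icc continuous_intros sol_slice_continuous c) auto
        then show ?thesis by simp
      qed simp
    qed
    also have "(LINT x|lborel. indicator {0<..<\<epsilon>} x *\<^sub>R G x) = integral {0..\<epsilon>} G"
      using LINT_eq_integral_Icc[OF continuous_on_subset[OF Gc], of 0 \<epsilon>] \<epsilon> by (simp add: set_lebesgue_integral_def)
    finally show ?thesis .
  qed
  have G0: "G 0 = (LINT v|lborel. sol (0, v) * \<eta> v * v)"
  proof -
    have "G 0 = (LINT v:{-r<..<r}|lborel. sol (0, v) * \<eta> v * v)"
      unfolding G_def by (rule LINT_eq_integral_Icc[symmetric]) (intro continuous_intros sol_slice_continuous c; simp)
    also have "\<dots> = (LINT v|lborel. sol (0, v) * \<eta> v * v)"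
      unfolding set_lebesgue_integral_def
      by (rule Bochner_Integration.integral_cong[OF refl]) (use z' in \<open>auto simp: indicator_def\<close>)
    finally show ?thesis .
  qed
  show "((\<lambda>\<epsilon>. (LINT z:{0<..<\<epsilon>} \<times> UNIV|lborel. sol z * \<eta> (snd z) * snd z) / \<epsilon>)
           \<longlongrightarrow> (LINT v|lborel. sol (0, v) * \<eta> v * v)) (at_right 0)"
    unfolding G0[symmetric]
  proof (rule Lim_transform_eventually[OF lim])
    show "\<forall>\<^sub>F \<epsilon> in at_right 0. integral {0..\<epsilon>} G / \<epsilon> = (LINT z:{0<..<\<epsilon>} \<times> UNIV|lborel. sol z * \<eta> (snd z) * snd z) / \<epsilon>"
      using eventually_at_right_real[OF zero_less_one] by eventually_elim (simp add: eq)
  qed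
qed

text \<open>The first bound in the definition of a weak solution is the weak identity for test functions that vanish
  near the boundary, followed by the Cauchy-Schwarz inequality.\<close>

lemma weak_solution_sol:
  assumes bc: "Ap = \<alpha> * b powr l * Am" and b: "b > 0"
  shows "weak_solution \<alpha> b sol (\<lambda>v. sol (0, v))"
  unfolding weak_solution_def
proof (intro conjI allI impI)
  show "is_trace sol (\<lambda>v. sol (0, v))" by (rule is_trace_sol)
  show "AE v in lborel. v > 0 \<longrightarrow> sol (0, v) = \<alpha> * sol (0, - b * v)"
  proof (intro AE_I2 impI)
    fix v :: real assume v: "v > 0"
    then have "sol (0, v) = \<alpha> * b powr l * Am * v powr l" unfolding bc[symmetric] by (simp add: sol_def)
    moreover have "sol (0, - y) = Am * y powr l" if "y > 0" for y using that by (simp add: sol_def)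
    from this[of "b * v"] have "sol (0, - b * v) = Am * (b powr l * v powr l)"
      using b v by (simp add: powr_mult)
    ultimately show "sol (0, v) = \<alpha> * sol (0, - b * v)" by simp
  qed
  fix R :: real assume R: "R > 0"
  have HA: "H R = {0<..<R^3} \<times> {-R<..<R}" by (simp add: H_def)
  have "continuous_on (H R) sol" by (rule sol_continuous_on) (auto simp: H_def)
  moreover have "set_integrable lborel (H R) (\<lambda>z. (sol z)\<^sup>2)"
    unfolding HA by (rule set_integrable_box) (intro continuous_intros sol_continuous_on; auto)
  moreover have sq: "\<bar>a\<bar> powr 2 = a\<^sup>2" for a :: real by (cases "a = 0") (auto simp: powr_numeral)
  ultimately show "in_Lp 2 (H R) sol" by (simp add: in_Lp_def set_borel_measurable_H)
  have L2: "in_Lp 2 (H R) sol_v" using l R by (intro in_Lp_sol_v) auto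
  have id: "- (LINT z:H R|lborel. sol z * snd z * dx \<psi> z) - (LINT v:{-R<..<R}|lborel. sol (0, v) * \<psi> (0, v) * v)
     + (LINT z:H R|lborel. sol_v z * dv \<psi> z) = 0" if "test_fun D \<psi>" "supp \<psi> \<inter> frontier (H R) \<subseteq> {0} \<times> UNIV" for D \<psi>
    by (rule weak_identity[OF that R])
  show "\<exists>C. \<forall>\<psi>. test_fun (H R) \<psi> \<longrightarrow>
           \<bar>LINT z:H R|lborel. sol z * snd z * dx \<psi> z\<bar> \<le> C * sqrt (LINT z:H R|lborel. (dv \<psi> z)\<^sup>2)"
  proof (intro exI[of _ "sqrt (LINT z:H R|lborel. (sol_v z)\<^sup>2)"] allI impI)
    fix \<psi> assume \<psi>: "test_fun (H R) \<psi>"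
    have sub: "supp \<psi> \<subseteq> H R" using \<psi> by (simp add: test_fun_def)
    then have "supp \<psi> \<inter> frontier (H R) \<subseteq> {0} \<times> UNIV" using frontier_H[OF R] by blast
    note I = id[OF \<psi> this]
    have "\<psi> (0, v) = 0" for v
    proof (rule ccontr)
      assume "\<psi> (0, v) \<noteq> 0"
      then have "(0, v) \<in> H R" using test_fun_facts(6)[OF \<psi>] sub by blast
      then show False by (simp add: H_def)
    qed
    then have "(LINT z:H R|lborel. sol z * snd z * dx \<psi> z) = (LINT z:H R|lborel. sol_v z * dv \<psi> z)"
      using I by simp
    also have "\<bar>\<dots>\<bar> \<le> sqrt (LINT z:H R|lborel. (sol_v z)\<^sup>2) * sqrt (LINT z:H R|lborel. (dv \<psi> z)\<^sup>2)"
    proof (rule Cauchy_Schwarz_set_integral)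
      show "set_integrable lborel (H R) (\<lambda>z. (sol_v z)\<^sup>2)" using L2 by (simp add: in_Lp_def sq)
      show "set_integrable lborel (H R) (\<lambda>z. (dv \<psi> z)\<^sup>2)"
        unfolding HA by (rule set_integrable_box) (intro continuous_intros test_fun_facts(3)[OF \<psi>])
      show "set_integrable lborel (H R) (\<lambda>z. sol_v z * dv \<psi> z)"
        by (rule set_integrable_sol_v_mult[OF R test_fun_facts(3)[OF \<psi>]])
    qed
    finally show "\<bar>LINT z:H R|lborel. sol z * snd z * dx \<psi> z\<bar>
       \<le> sqrt (LINT z:H R|lborel. (sol_v z)\<^sup>2) * sqrt (LINT z:H R|lborel. (dv \<psi> z)\<^sup>2)" .
  qed
  show "\<exists>g. weak_dv (H R) sol g \<and> in_Lp 2 (H R) g \<and>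
           (\<forall>\<psi>. test_fun UNIV \<psi> \<and> supp \<psi> \<inter> frontier (H R) \<subseteq> {0} \<times> UNIV \<longrightarrow>
              - (LINT z:H R|lborel. sol z * snd z * dx \<psi> z)
              - (LINT v:{-R<..<R}|lborel. sol (0, v) * \<psi> (0, v) * v)
              + (LINT z:H R|lborel. g z * dv \<psi> z) = 0)"
    using weak_dv_sol[OF R] L2 id by blast
qed

end

section \<open>The exponent and the main result\<close>

text \<open>At \<open>0\<close> the difference of the two sides of the equation is \<open>1 - \<alpha> > 0\<close>, at \<open>1/2\<close> it is negative.  So \<open>0\<close> may be
  added to the solution set without changing it; the set is then closed, and its infimum is attained.\<close>

lemma lam_properties:
  assumes "0 < \<alpha>" "\<alpha> < 1" "0 < b"
  shows "lam \<alpha> b \<in> {0<..<1/2}" "2 * cos (pi * (lam \<alpha> b / 3 + 1 / 3)) = \<alpha> * b powr lam \<alpha> b"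
proof -
  define f where "f l = 2 * cos (pi * (l / 3 + 1 / 3)) - \<alpha> * b powr l" for l
  have cont: "continuous_on S f" for S
    unfolding f_def using assms by (intro continuous_intros) auto
  have f0: "f 0 > 0" using assms cos_60 by (simp add: f_def)
  have "pi * (1 / 2 / 3 + 1 / 3) = pi / 2" by simp
  then have fh: "f (1/2) < 0" using assms unfolding f_def by (simp only: cos_pi_half) simp
  define S where "S = {l \<in> {0..}. f l = 0}"
  have "S = {l. l > 0 \<and> 2 * cos (pi * (l / 3 + 1 / 3)) = \<alpha> * b powr l}"
    using f0 by (auto simp: S_def f_def order.order_iff_strict)
  then have lam: "lam \<alpha> b = Inf S" by (simp add: lam_def)
  obtain r where r: "0 \<le> r" "r \<le> 1/2" "f r = 0"
    using IVT2'[of f "1/2" 0 0] f0 fh cont by auto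
  then have "r \<noteq> 1/2" using fh by (metis less_irrefl)
  with r have rS: "r \<in> S" "r < 1/2" by (auto simp: S_def)
  have bdd: "bdd_below S" by (rule bdd_belowI[of _ 0]) (simp add: S_def)
  have "closed S" unfolding S_def
    by (intro continuous_closed_preimage_constant cont) auto
  then have IS: "Inf S \<in> S" using closed_contains_Inf bdd rS(1) by blast
  have "Inf S \<le> r" using bdd rS by (intro cInf_lower) auto
  moreover have "Inf S \<noteq> 0" using IS f0 by (auto simp: S_def)
  ultimately show "lam \<alpha> b \<in> {0<..<1/2}" using IS rS(2) unfolding lam by (auto simp: S_def order.order_iff_strict)
  show "2 * cos (pi * (lam \<alpha> b / 3 + 1 / 3)) = \<alpha> * b powr lam \<alpha> b"
    using IS unfolding lam by (simp add: S_def f_def)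
qed

lemma lam_1:
  assumes "0 < \<alpha>" "\<alpha> < 1"
  shows "lam \<alpha> 1 = 3 / pi * arccos (\<alpha> / 2) - 1"
proof -
  define l where "l = lam \<alpha> 1"
  have l: "0 < l" "l < 1/2" "cos (pi * (l / 3 + 1 / 3)) = \<alpha> / 2"
    using lam_properties[OF assms, of 1] by (auto simp: l_def)
  have "pi * (l / 3 + 1 / 3) \<le> pi * 1" using l by (intro mult_left_mono) auto
  then have "arccos (\<alpha> / 2) = pi * (l / 3 + 1 / 3)"
    using l unfolding l(3)[symmetric] by (intro arccos_cos) auto
  then show ?thesis unfolding l_def[symmetric] by (simp add: field_simps)
qed

lemma phi_interior_eq:
  assumes x: "x > 0"
  shows "phi_interior \<alpha> b (x, v) = x powr (lam \<alpha> b / 3) * profile (lam \<alpha> b / 3) (v / x powr (1/3))"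
proof -
  define q where "q = lam \<alpha> b / 3"
  have "(x powr (1/3))^3 = x" using x powr_powr[of x "1/3" 3] by (simp add: powr_numeral)
  then have c: "- ((v / x powr (1/3))^3) / 9 = - (v^3) / (9 * x)" by (simp add: power_divide mult.commute)
  have d: "v / (9 * x) powr (1/3) = v / x powr (1/3) / 9 powr (1/3)" using x by (simp add: powr_mult)
  have p: "- lam \<alpha> b / 3 = - q" "(1 - lam \<alpha> b) / 3 = 1/3 - q" "- (lam \<alpha> b - 1) / 3 = 1/3 - q"
    by (simp_all add: q_def diff_divide_distrib)
  show ?thesis
    unfolding phi_interior_def Let_def prod.case p d q_def[symmetric] profile_def profile_coeff_def c
    by (simp add: mult_ac)
qed

lemma set_LINT_cong_on:
  assumes "\<And>z. z \<in> D \<Longrightarrow> f z = (g z :: real)"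
  shows "(LINT z:D|M. f z) = (LINT z:D|M. g z)"
  unfolding set_lebesgue_integral_def
  by (rule Bochner_Integration.integral_cong[OF refl]) (use assms in \<open>auto simp: indicator_def\<close>)

lemma set_integrable_cong_on:
  assumes "\<And>z. z \<in> D \<Longrightarrow> f z = (g z :: real)"
  shows "set_integrable M D f \<longleftrightarrow> set_integrable M D g"
  unfolding set_integrable_def
  by (rule Bochner_Integration.integrable_cong[OF refl]) (use assms in \<open>auto simp: indicator_def\<close>)

lemma in_Lp_cong:
  assumes "\<And>z. z \<in> D \<Longrightarrow> f z = g z"
  shows "in_Lp p D f \<longleftrightarrow> in_Lp p D g"
proof -
  have "(\<lambda>x. indicat_real D x *\<^sub>R f x) = (\<lambda>x. indicat_real D x *\<^sub>R g x)"
    using assms by (auto simp: indicator_def fun_eq_iff)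
  moreover have "set_integrable lborel D (\<lambda>z. \<bar>f z\<bar> powr p) \<longleftrightarrow> set_integrable lborel D (\<lambda>z. \<bar>g z\<bar> powr p)"
    using assms by (intro set_integrable_cong_on) auto
  ultimately show ?thesis by (simp add: in_Lp_def set_borel_measurable_def)
qed

lemma weak_dv_cong:
  assumes "\<And>z. z \<in> D \<Longrightarrow> h z = h' z"
  shows "weak_dv D h g \<longleftrightarrow> weak_dv D h' g"
proof -
  have 1: "(LINT z:D|lborel. h z * dv \<psi> z) = (LINT z:D|lborel. h' z * dv \<psi> z)" for \<psi>
    by (rule set_LINT_cong_on) (simp add: assms)
  have 2: "set_integrable lborel K h \<longleftrightarrow> set_integrable lborel K h'" if "K \<subseteq> D" for K
    using that assms by (intro set_integrable_cong_on) auto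
  show ?thesis unfolding weak_dv_def 1 using 2 by blast
qed

text \<open>The values for \<open>x \<le> 0\<close> enter a weak solution only through the trace.\<close>

lemma weak_solution_cong:
  assumes h: "\<And>x v. x > 0 \<Longrightarrow> h (x, v) = h' (x, v)"
  shows "weak_solution \<alpha> b h \<tau> \<longleftrightarrow> weak_solution \<alpha> b h' \<tau>"
proof -
  have HR: "h z = h' z" if "z \<in> H R" for z R using that h by (auto simp: H_def)
  have 1: "(LINT z:H R|lborel. h z * snd z * dx \<psi> z) = (LINT z:H R|lborel. h' z * snd z * dx \<psi> z)" for R \<psi>
    by (rule set_LINT_cong_on) (simp add: HR)
  have 2: "in_Lp 2 (H R) h \<longleftrightarrow> in_Lp 2 (H R) h'" for R by (rule in_Lp_cong) (simp add: HR)
  have 3: "weak_dv (H R) h g \<longleftrightarrow> weak_dv (H R) h' g" for R g by (rule weak_dv_cong) (simp add: HR)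
  have 4: "(LINT z:{0<..<\<epsilon>} \<times> UNIV|lborel. h z * \<eta> (snd z) * snd z) = (LINT z:{0<..<\<epsilon>} \<times> UNIV|lborel. h' z * \<eta> (snd z) * snd z)"
    for \<epsilon> and \<eta> :: "real \<Rightarrow> real"
    by (rule set_LINT_cong_on) (use h in auto)
  show ?thesis unfolding weak_solution_def is_trace_def 1 2 3 4 ..
qed

theorem lemma5p1:
  fixes \<alpha> b :: real
  assumes "0 < \<alpha>" "\<alpha> < 1" "0 < b" "b \<le> 1"
  shows
    "continuous_on ({0..} \<times> UNIV) (phi \<alpha> b) \<and>
     (lam \<alpha> b \<in> {0<..<1 / 2} \<and> lam \<alpha> 1 = 3 / pi * arccos (\<alpha> / 2) - 1) \<and>
     (\<forall>z \<in> ({0..} \<times> UNIV) - {(0, 0)}. phi \<alpha> b z > 0) \<and>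
     (\<exists>c. \<forall>v\<le>0. phi \<alpha> b (0, v) = c * \<bar>v\<bar> powr lam \<alpha> b) \<and>
     (weak_solution \<alpha> b (phi \<alpha> b) (\<lambda>v. phi \<alpha> b (0, v)) \<and>
      (\<exists>\<delta>>0. \<forall>R>1. \<exists>g. weak_dv (H R) (phi \<alpha> b) g \<and> in_Lp (4 + \<delta>) (H R) g)) \<and>
     (\<exists>c1>0. \<exists>c2>0. \<forall>x\<ge>0. \<forall>v.
        c1 * (max (\<bar>x\<bar> powr (1 / 3)) \<bar>v\<bar>) powr lam \<alpha> b \<le> phi \<alpha> b (x, v) \<and>
        phi \<alpha> b (x, v) \<le> c2 * (max (\<bar>x\<bar> powr (1 / 3)) \<bar>v\<bar>) powr lam \<alpha> b) \<and>
     (\<forall>R>0. phi \<alpha> b \<in> kin_holder (lam \<alpha> b) (H R) \<and>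
        (\<forall>\<epsilon>>0. phi \<alpha> b \<notin> kin_holder (lam \<alpha> b + \<epsilon>) (H R)))"
proof -
  define l where "l = lam \<alpha> b"
  define q where "q = l / 3"
  note L = lam_properties[OF assms(1-3), folded l_def]
  have l: "0 < l" "l < 1/2" using L(1) by auto
  have q: "0 < q" "q < 1/3" and q3: "3 * q = l" using l by (auto simp: q_def)
  have c: "2 * cos (pi * (q + 1/3)) = \<alpha> * b powr l" using L(2) by (simp add: q_def)
  then have cpos: "cos (pi * (q + 1/3)) > 0" using assms by (smt (verit) mult_pos_pos powr_gt_zero)
  interpret kinetic_profile l "profile_Ap q" "profile_Am q" "profile q" "profile' q" "profile_dx q"
    using kinetic_profile_Kummer[OF q cpos] unfolding q3 .
  have bc: "profile_Ap q = \<alpha> * b powr l * profile_Am q" unfolding profile_Ap_eq[OF q] c ..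
  have int: "phi_interior \<alpha> b z = sol z" if "fst z > 0" for z
    using phi_interior_eq[of "fst z" \<alpha> b "snd z"] that
    unfolding l_def[symmetric] q_def[symmetric] by (simp add: sol_def q_def[symmetric])
  have eq: "phi \<alpha> b z = sol z" if z: "fst z \<ge> 0" for z
  proof (cases "fst z > 0")
    case True
    then show ?thesis by (simp add: phi_def int)
  next
    case False
    then have z0: "z \<in> {0..} \<times> UNIV" "z = (0, snd z)" using z by (auto simp: prod_eq_iff mem_Times_iff)
    have "(sol \<longlongrightarrow> sol z) (at z within {0..} \<times> UNIV)"
      using sol_continuous z0(1) unfolding continuous_on_def by blast
    then have "(sol \<longlongrightarrow> sol z) (at z within {0<..} \<times> UNIV)"
      by (rule tendsto_within_subset) auto
    then have "(phi_interior \<alpha> b \<longlongrightarrow> sol z) (at z within {0<..} \<times> UNIV)"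
      by (rule Lim_transform_eventually) (auto simp: eventually_at_filter int intro!: always_eventually)
    moreover have "\<not> trivial_limit (at z within {0<..} \<times> UNIV)"
    proof -
      have "z \<in> closure ({0<..} \<times> UNIV)" using z0 by (simp add: closure_Times mem_Times_iff)
      moreover have "{0<..} \<times> UNIV - {z} = {0<..} \<times> UNIV" using z0(2) by (auto simp: prod_eq_iff)
      ultimately show ?thesis by (simp add: trivial_limit_within islimpt_in_closure)
    qed
    ultimately have "Lim (at z within {0<..} \<times> UNIV) (phi_interior \<alpha> b) = sol z"
      by (intro tendsto_Lim)
    then show ?thesis using False by (simp add: phi_def)
  qed
  have eqp: "phi \<alpha> b (x, v) = sol (x, v)" if "x > 0" for x v using that eq by simp
  obtain c1 c2 where cc: "c1 > 0" "c2 > 0"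
    "\<And>x v. x \<ge> 0 \<Longrightarrow> c1 * kin_norm (x, v) powr l \<le> sol (x, v)"
    "\<And>x v. x \<ge> 0 \<Longrightarrow> sol (x, v) \<le> c2 * kin_norm (x, v) powr l"
    using sol_comparable by blast
  have "continuous_on ({0..} \<times> UNIV) (phi \<alpha> b)"
    by (subst continuous_on_cong[OF refl eq]) (auto intro: sol_continuous)
  moreover have "\<forall>z \<in> ({0..} \<times> UNIV) - {(0, 0)}. phi \<alpha> b z > 0"
  proof
    fix z :: "real \<times> real" assume z: "z \<in> ({0..} \<times> UNIV) - {(0, 0)}"
    obtain x v where xv: "z = (x, v)" by (cases z)
    have "kin_norm (x, v) > 0" using z by (auto simp: xv kin_norm_def less_max_iff_disj)
    then have "0 < c1 * kin_norm (x, v) powr l" using cc(1) by simp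
    also have "\<dots> \<le> sol (x, v)" using z xv by (intro cc(3)) auto
    finally show "phi \<alpha> b z > 0" using z xv by (simp add: eq)
  qed
  moreover have "\<exists>c. \<forall>v\<le>0. phi \<alpha> b (0, v) = c * \<bar>v\<bar> powr l"
    by (intro exI[of _ "profile_Am q"]) (auto simp: eq sol_def)
  moreover have "weak_solution \<alpha> b (phi \<alpha> b) (\<lambda>v. phi \<alpha> b (0, v))"
    using weak_solution_sol[OF bc assms(3)] by (simp add: weak_solution_cong[of "phi \<alpha> b" sol, OF eqp] eq)
  moreover have "\<exists>\<delta>>0. \<forall>R>1. \<exists>g. weak_dv (H R) (phi \<alpha> b) g \<and> in_Lp (4 + \<delta>) (H R) g"
  proof (intro exI[of _ l] conjI allI impI)
    fix R :: real assume "R > 1"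
    then have R: "R > 0" by simp
    have "weak_dv (H R) (phi \<alpha> b) sol_v"
      using weak_dv_sol[OF R] by (subst weak_dv_cong[of _ _ sol]) (auto simp: H_def eqp)
    moreover have "(4 + l) * (1 - l) < 4"
    proof -
      have "(4 + l) * (1 - l) = 4 - 3 * l - l * l" by (simp add: algebra_simps)
      moreover have "l * l > 0" using l by simp
      ultimately show ?thesis using l by linarith
    qed
    then have "in_Lp (4 + l) (H R) sol_v" using l R by (intro in_Lp_sol_v) auto
    ultimately show "\<exists>g. weak_dv (H R) (phi \<alpha> b) g \<and> in_Lp (4 + l) (H R) g" by blast
  qed (rule l)
  moreover have "\<exists>c1>0. \<exists>c2>0. \<forall>x\<ge>0. \<forall>v.
        c1 * (max (\<bar>x\<bar> powr (1 / 3)) \<bar>v\<bar>) powr l \<le> phi \<alpha> b (x, v) \<and>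
        phi \<alpha> b (x, v) \<le> c2 * (max (\<bar>x\<bar> powr (1 / 3)) \<bar>v\<bar>) powr l"
    using cc by (intro exI[of _ c1] exI[of _ c2] conjI allI impI) (auto simp: eq kin_norm_def)
  moreover have "\<forall>R>0. phi \<alpha> b \<in> kin_holder l (H R) \<and> (\<forall>\<epsilon>>0. phi \<alpha> b \<notin> kin_holder (l + \<epsilon>) (H R))"
    using sol_kin_holder[of "phi \<alpha> b", OF eqp] sol_not_kin_holder[of "phi \<alpha> b", OF eqp] by blast
  ultimately show ?thesis using L(1) lam_1[OF assms(1,2)] unfolding l_def by blast
qed

end
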